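(* For every Fuchsian group $\Gamma\subset\mathrm{PSL}_2(\mathbb R)$ of the first kind, every vertex operator algebra $V$, and every even $k\ge0$, $$\dim M_k(V,\Gamma)\le\sum_{i=0}^{k/2}\dim M_{2i}(\Gamma)\,\dim V_{k/2-i}.$$
   Context: A VOA $V=\bigoplus_nV_n$ has Virasoro modes $L(n)$, with $L(0)=n$ on $V_n$. $F_NV=\bigoplus_{n\le N}V_n$. A Fuchsian group of the first kind is a finitely generated discrete subgroup of $\mathrm{PSL}_2(\mathbb R)$ of finite covolume; elements of $\Gamma$ are lifted to $\mathrm{SL}_2(\mathbb R)$ (full preimage). For $\gamma=\begin{pmatrix}a&b\\c&d\end{pmatrix}$: $j(\gamma,\tau)=c\tau+d$, $f|_k\gamma(\tau)=j(\gamma,\tau)^{-k}f(\gamma\tau)$, $K(\gamma,\tau)=e^{-c\,j(\gamma,\tau)L(1)}j(\gamma,\tau)^{-2L(0)}$, $f\Vert_k\gamma(\tau)=j(\gamma,\tau)^{-k}K(\gamma,\tau)^{-1}f(\gamma\tau)$. At a cusp $s=\sigma\infty$ ($\sigma\in\mathrm{SL}_2(\mathbb R)$), the stabilizer of $\infty$ in $\sigma^{-1}\Gamma\sigma$ is generated up to sign by $\tau\mapsto\tau+\lambda$, and $q_\lambda=e^{2\pi i\tau/\lambda}$. $M_k(\Gamma)$: holomorphic $f:\mathbb H\to\mathbb C$ with $f|_k\gamma=f$ for all $\gamma\in\Gamma$ and $f|_k\sigma\in\mathbb C[[q_\lambda]]$ at every cusp. $M_k(V,\Gamma)$: holomorphic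 $f:\mathbb H\to F_NV$ (some $N$) with $f\Vert_k\gamma=f$ for all $\gamma\in\Gamma$, $f\Vert_k\sigma\in F_NV[[q_\lambda]]$ at every cusp, and $f(\tau_i)$ fixed by $j(\gamma_i,\tau_i)^kK(\gamma_i,\tau_i)$ at every elliptic point $\tau_i$ with stabilizer generator $\gamma_i$.
   Formalization: The vertex operator algebra is taken with no negative weights (V_n = 0 for n < 0); with V_n ≠ 0 for some n < 0 the inequality fails, e.g. at k = 0 forms valued in the lowest weight space contribute dim M_{2m}(Γ)·dim V_{-m}, which is not counted on the right. *)

theory Defs
  imports
    "HOL-Complex_Analysis.Complex_Analysis"
    "HOL-Algebra.Algebra"
    "HOL-Library.Function_Algebras"
    "HOL-Library.Extended_Nat"
begin

section \<open>Dimensions and finitely supported sums\<close>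

text \<open>The library dimension is 0 on infinite-dimensional spaces; here it is \<open>\<infinity>\<close>.\<close>

definition edim :: "(complex \<Rightarrow> 'a::ab_group_add \<Rightarrow> 'a) \<Rightarrow> 'a set \<Rightarrow> enat" where
  "edim s S = (if \<exists>B. finite B \<and> S \<subseteq> module.span s B
               then enat (vector_space.dim s S) else \<infinity>)"

definition supp_sum :: "('i \<Rightarrow> 'a::comm_monoid_add) \<Rightarrow> 'a" where
  "supp_sum t = sum t {i. t i \<noteq> 0}"

section \<open>Fuchsian groups of the first kind\<close>

abbreviation UHP :: "complex set" where
  "UHP \<equiv> {\<tau>. 0 < Im \<tau>}"

definition SL2R :: "(real^2^2) monoid" where
  "SL2R = \<lparr>carrier = {A. det A = 1}, mult = (**), one = mat 1\<rparr>"

definition PSL2R :: "(real^2^2) set monoid" where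
  "PSL2R = SL2R Mod {mat 1, - mat 1}"

definition moebius :: "real^2^2 \<Rightarrow> complex \<Rightarrow> complex" where
  "moebius \<gamma> \<tau> = (of_real (\<gamma>$1$1) * \<tau> + of_real (\<gamma>$1$2)) / (of_real (\<gamma>$2$1) * \<tau> + of_real (\<gamma>$2$2))"

definition autj :: "real^2^2 \<Rightarrow> complex \<Rightarrow> complex" where
  "autj \<gamma> \<tau> = of_real (\<gamma>$2$1) * \<tau> + of_real (\<gamma>$2$2)"

definition hyperbolic_area :: "complex measure" where
  "hyperbolic_area = density lborel (\<lambda>\<tau>. ennreal (indicator UHP \<tau> / (Im \<tau>)\<^sup>2))"

text \<open>
  Elements of \<open>PSL2R\<close> are cosets \<open>{A, -A}\<close>, so for a subset \<open>\<Gamma>\<close> of \<open>PSL2R\<close> the union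
  \<open>\<Union>\<Gamma>\<close> is its full preimage in \<open>SL2R\<close>. Discreteness of \<open>\<Gamma>\<close> for the quotient topology
  is discreteness of this preimage. The covolume is the area of a measurable set \<open>D\<close> of
  representatives of the \<open>\<Gamma>\<close>-orbits; it does not depend on \<open>D\<close>.
\<close>

definition finite_covolume :: "(real^2^2) set set \<Rightarrow> bool" where
  "finite_covolume \<Gamma> \<longleftrightarrow>
     (\<exists>D \<in> sets lborel. D \<subseteq> UHP \<and>
        (\<forall>\<tau>\<in>UHP. \<exists>!z. z \<in> D \<and> (\<exists>\<gamma>\<in>\<Union>\<Gamma>. z = moebius \<gamma> \<tau>)) \<and>
        emeasure hyperbolic_area D < \<infinity>)"

definition fuchsian_first_kind :: "(real^2^2) set set \<Rightarrow> bool" where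
  "fuchsian_first_kind \<Gamma> \<longleftrightarrow>
     subgroup \<Gamma> PSL2R \<and>
     discrete (\<Union>\<Gamma>) \<and>
     (\<exists>S. finite S \<and> S \<subseteq> carrier PSL2R \<and> generate PSL2R S = \<Gamma>) \<and>
     finite_covolume \<Gamma>"

definition translation :: "real \<Rightarrow> real^2^2" where
  "translation x = vector [vector [1, x], vector [0, 1]]"

text \<open>
  \<open>cusp_width \<Gamma> \<sigma> l\<close>: the point \<open>\<sigma>\<infinity>\<close> is a cusp of \<open>\<Gamma>\<close>, i.e. it is fixed by a parabolic element,
  and the stabilizer of \<open>\<infinity>\<close> in \<open>\<sigma>\<^sup>-\<^sup>1\<Gamma>\<sigma>\<close> is generated up to sign by \<open>\<tau> \<mapsto> \<tau> + l\<close>, where \<open>l > 0\<close>.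
  A matrix fixes \<open>\<infinity>\<close> iff its lower left entry is 0.
\<close>

definition cusp_width :: "(real^2^2) set set \<Rightarrow> real^2^2 \<Rightarrow> real \<Rightarrow> bool" where
  "cusp_width \<Gamma> \<sigma> l \<longleftrightarrow>
     \<sigma> \<in> carrier SL2R \<and> 0 < l \<and>
     {\<delta> \<in> (\<lambda>\<gamma>. matrix_inv \<sigma> ** \<gamma> ** \<sigma>) ` \<Union>\<Gamma>. \<delta>$2$1 = 0} = generate SL2R {translation l, - mat 1}"

definition qpar :: "real \<Rightarrow> complex \<Rightarrow> complex" where
  "qpar l \<tau> = exp (2 * of_real pi * \<i> * \<tau> / of_real l)"

definition stab :: "(real^2^2) set set \<Rightarrow> complex \<Rightarrow> (real^2^2) set" where
  "stab \<Gamma> \<tau> = {\<gamma> \<in> \<Union>\<Gamma>. moebius \<gamma> \<tau> = \<tau>}"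

definition elliptic_point :: "(real^2^2) set set \<Rightarrow> complex \<Rightarrow> bool" where
  "elliptic_point \<Gamma> \<tau> \<longleftrightarrow> \<tau> \<in> UHP \<and> stab \<Gamma> \<tau> \<noteq> {mat 1, - mat 1}"

definition stab_generator :: "(real^2^2) set set \<Rightarrow> complex \<Rightarrow> real^2^2 \<Rightarrow> bool" where
  "stab_generator \<Gamma> \<tau> \<gamma> \<longleftrightarrow> \<gamma> \<in> \<Union>\<Gamma> \<and> stab \<Gamma> \<tau> = generate SL2R {\<gamma>, - mat 1}"

section \<open>Scalar modular forms\<close>

text \<open>
  Functions on the upper half-plane are total functions on the complex numbers that vanish
  off it, so that two forms are equal iff they agree on the upper half-plane.
\<close>

definition slash :: "int \<Rightarrow> real^2^2 \<Rightarrow> (complex \<Rightarrow> complex) \<Rightarrow> complex \<Rightarrow> complex" where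
  "slash k \<gamma> f \<tau> = autj \<gamma> \<tau> powi (- k) * f (moebius \<gamma> \<tau>)"

definition modular_forms :: "int \<Rightarrow> (real^2^2) set set \<Rightarrow> (complex \<Rightarrow> complex) set" where
  "modular_forms k \<Gamma> = {f.
     (\<forall>\<tau>. \<tau> \<notin> UHP \<longrightarrow> f \<tau> = 0) \<and>
     f holomorphic_on UHP \<and>
     (\<forall>\<gamma>\<in>\<Union>\<Gamma>. \<forall>\<tau>\<in>UHP. slash k \<gamma> f \<tau> = f \<tau>) \<and>
     (\<forall>\<sigma> l. cusp_width \<Gamma> \<sigma> l \<longrightarrow>
        (\<exists>a. \<forall>\<tau>\<in>UHP. (\<lambda>n. a n * qpar l \<tau> ^ n) sums slash k \<sigma> f \<tau>))}"

section \<open>Vertex operator algebras and vector-valued modular forms\<close>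

text \<open>
  \<open>Y a n b\<close> is the mode \<open>a\<^sub>(\<^sub>n\<^sub>)b\<close>, the coefficient of \<open>z\<^sup>-\<^sup>n\<^sup>-\<^sup>1\<close> in \<open>Y(a,z)b\<close>. The modes of the
  conformal vector are \<open>L(n) = \<omega>\<^sub>(\<^sub>n\<^sub>+\<^sub>1\<^sub>)\<close>. The Jacobi identity is stated by modes (Borcherds
  identity); all sums in it are finite by \<open>truncation\<close>. The grading is by nonnegative
  integers: \<open>V n\<close> is indexed by all integers and is zero for \<open>n < 0\<close>.
\<close>

locale vertex_operator_algebra = vector_space scale
  for scale :: "complex \<Rightarrow> 'v::ab_group_add \<Rightarrow> 'v" +
  fixes V :: "int \<Rightarrow> 'v set"
    and Y :: "'v \<Rightarrow> int \<Rightarrow> 'v \<Rightarrow> 'v"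
    and vac :: 'v
    and \<omega> :: 'v
    and central_charge :: complex
  assumes subspace_V: "subspace (V n)"
    and finite_dim_V: "\<exists>B. finite B \<and> V n \<subseteq> span B"
    and V_negative: "n < 0 \<Longrightarrow> V n = {0}"
    and direct_sum: "\<exists>!d. (\<forall>n. d n \<in> V n) \<and> finite {n. d n \<noteq> 0} \<and> supp_sum d = v"
    and linear_left: "Vector_Spaces.linear scale scale (\<lambda>a. Y a n b)"
    and linear_right: "Vector_Spaces.linear scale scale (\<lambda>b. Y a n b)"
    and truncation: "\<exists>N. \<forall>n\<ge>N. Y a n b = 0"
    and vac_in: "vac \<in> V 0"
    and vacuum: "Y vac n b = (if n = -1 then b else 0)"
    and creation: "n \<ge> 0 \<Longrightarrow> Y a n vac = 0"
    and creation_minus_one: "Y a (-1) vac = a"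
    and borcherds:
      "supp_sum (\<lambda>i::nat. scale (of_int p gchoose i) (Y (Y a (r + int i) b) (p + q - int i) c)) =
       supp_sum (\<lambda>i::nat. scale ((-1) ^ i * (of_int r gchoose i))
          (Y a (p + r - int i) (Y b (q + int i) c)
           - scale ((-1) powi r) (Y b (q + r - int i) (Y a (p + int i) c))))"
    and conformal_in: "\<omega> \<in> V 2"
    and virasoro:
      "Y \<omega> (m + 1) (Y \<omega> (n + 1) v) - Y \<omega> (n + 1) (Y \<omega> (m + 1) v) =
       scale (of_int (m - n)) (Y \<omega> (m + n + 1) v)
       + (if m + n = 0 then scale (of_int (m ^ 3 - m) / 12 * central_charge) v else 0)"
    and L0_grading: "v \<in> V n \<Longrightarrow> Y \<omega> 1 v = scale (of_int n) v"
    and L_minus_one_derivative: "Y (Y \<omega> 0 a) n b = scale (- of_int n) (Y a (n - 1) b)"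
begin

definition L :: "int \<Rightarrow> 'v \<Rightarrow> 'v" where
  "L n = Y \<omega> (n + 1)"

definition F :: "int \<Rightarrow> 'v set" where
  "F N = span (\<Union>n\<in>{..N}. V n)"

definition component :: "'v \<Rightarrow> int \<Rightarrow> 'v" where
  "component v = (THE d. (\<forall>n. d n \<in> V n) \<and> finite {n. d n \<noteq> 0} \<and> supp_sum d = v)"

text \<open>
  \<open>x_pow_L0 x e\<close> is the operator \<open>x\<^bsup>e L(0)\<^esup>\<close>, acting on \<open>V n\<close> by \<open>x\<^bsup>e n\<^esup>\<close>.
  The series \<open>exp_op T v\<close> is finite for the locally nilpotent \<open>T\<close> used below.
\<close>

definition x_pow_L0 :: "complex \<Rightarrow> int \<Rightarrow> 'v \<Rightarrow> 'v" where
  "x_pow_L0 x e v = supp_sum (\<lambda>n. scale (x powi (e * n)) (component v n))"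

definition exp_op :: "('v \<Rightarrow> 'v) \<Rightarrow> 'v \<Rightarrow> 'v" where
  "exp_op T v = supp_sum (\<lambda>m::nat. scale (1 / fact m) ((T ^^ m) v))"

definition K :: "real^2^2 \<Rightarrow> complex \<Rightarrow> 'v \<Rightarrow> 'v" where
  "K \<gamma> \<tau> v = exp_op (\<lambda>w. scale (- (of_real (\<gamma>$2$1) * autj \<gamma> \<tau>)) (L 1 w))
               (x_pow_L0 (autj \<gamma> \<tau>) (- 2) v)"

definition slashV :: "int \<Rightarrow> real^2^2 \<Rightarrow> (complex \<Rightarrow> 'v) \<Rightarrow> complex \<Rightarrow> 'v" where
  "slashV k \<gamma> f \<tau> = scale (autj \<gamma> \<tau> powi (- k)) (inv_into UNIV (K \<gamma> \<tau>) (f (moebius \<gamma> \<tau>)))"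

text \<open>
  Holomorphy and convergence are only used for functions and series with values in a
  finite-dimensional \<open>F N\<close>, whose standard topology is the one given by its linear functionals
  (each of which extends to the whole space).
\<close>

definition holomorphicV :: "(complex \<Rightarrow> 'v) \<Rightarrow> complex set \<Rightarrow> bool" where
  "holomorphicV f S \<longleftrightarrow>
     (\<forall>\<phi>. Vector_Spaces.linear scale (*) \<phi> \<longrightarrow> (\<lambda>\<tau>. \<phi> (f \<tau>)) holomorphic_on S)"

definition sumsV :: "(nat \<Rightarrow> 'v) \<Rightarrow> 'v \<Rightarrow> bool" where
  "sumsV a v \<longleftrightarrow>
     (\<forall>\<phi>. Vector_Spaces.linear scale (*) \<phi> \<longrightarrow> (\<lambda>n. \<phi> (a n)) sums \<phi> v)"

definition modular_formsV :: "int \<Rightarrow> (real^2^2) set set \<Rightarrow> (complex \<Rightarrow> 'v) set" where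
  "modular_formsV k \<Gamma> = {f.
     (\<forall>\<tau>. \<tau> \<notin> UHP \<longrightarrow> f \<tau> = 0) \<and>
     (\<exists>N. (\<forall>\<tau>\<in>UHP. f \<tau> \<in> F N) \<and>
        holomorphicV f UHP \<and>
        (\<forall>\<gamma>\<in>\<Union>\<Gamma>. \<forall>\<tau>\<in>UHP. slashV k \<gamma> f \<tau> = f \<tau>) \<and>
        (\<forall>\<sigma> l. cusp_width \<Gamma> \<sigma> l \<longrightarrow>
           (\<exists>a. (\<forall>n. a n \<in> F N) \<and>
              (\<forall>\<tau>\<in>UHP. sumsV (\<lambda>n. scale (qpar l \<tau> ^ n) (a n)) (slashV k \<sigma> f \<tau>)))) \<and>
        (\<forall>\<tau> \<gamma>. elliptic_point \<Gamma> \<tau> \<and> stab_generator \<Gamma> \<tau> \<gamma> \<longrightarrow>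
           scale (autj \<gamma> \<tau> powi k) (K \<gamma> \<tau> (f \<tau>)) = f \<tau>))}"

end

end

theory Submission
  imports Defs
begin

text \<open>
Each operator \<open>K \<gamma> \<tau>\<close> preserves the filtration \<open>F n\<close>, and because \<open>L(1)\<close> lowers degrees it acts
on \<open>F n / F (n - 1)\<close>, which is \<open>V n\<close>, as the scalar \<open>j(\<gamma>,\<tau>)\<^sup>-\<^sup>2\<^sup>n\<close>. So the degree \<open>n\<close> component
of a form of weight \<open>k\<close> with values in \<open>F n\<close> transforms with weight \<open>k - 2n\<close>: its coordinates in
a basis of \<open>V n\<close> are scalar forms of weight \<open>k - 2n\<close> (\<open>top_coordinate_modular\<close>), and they all
vanish exactly when the form takes values in \<open>F (n - 1)\<close>. Rank-nullity along the filtration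
(\<open>edim_filtered_forms_step\<close>) bounds the dimension by the sum over \<open>n\<close> of \<open>dim M\<^bsub>k - 2n\<^esub>(\<Gamma>) dim V
n\<close>, and \<open>n = k/2 - i\<close> gives the stated sum once the degrees \<open>n > k/2\<close> contribute nothing, that
is, once there are no nonzero scalar forms of negative weight.

Let \<open>f\<close> be a form of weight \<open>-m < 0\<close> and \<open>\<phi> = |f|\<^sup>2 / y\<^sup>m\<close>. This function is \<open>\<Gamma>\<close>-invariant, and
\<open>log \<phi>\<close> is strictly subharmonic off the zeros of \<open>f\<close>, so \<open>\<phi>\<close> has no positive local maximum
(\<open>invariant_modulus_no_max\<close>). It therefore suffices that \<open>\<phi>\<close>, if it is positive somewhere,
attains its supremum. Conjugate \<open>\<gamma>\<close> so that \<open>z\<close> moves to \<open>\<i>\<close>, and let the length of \<open>\<gamma>\<close> at \<open>z\<close>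
be the norm of the traceless part of the result; it vanishes only for \<open>\<gamma> = \<plusminus>1\<close>. Call \<open>z\<close> thick
if all other elements of the group have length at least \<open>1/8\<close> at \<open>z\<close>.

The thick part is compact modulo \<open>\<Gamma>\<close> (\<open>thick_cocompact\<close>): around thick points, boxes of a fixed
hyperbolic area overlap a bounded number of times modulo \<open>\<Gamma>\<close>, and the covolume is finite.

At a thin point let \<open>A\<close> be an element other than \<open>\<plusminus>1\<close> of least length, and consider the region
where the length of \<open>A\<close> is at most \<open>1/8\<close>. Elements that are short at the same point commute
(\<open>small_elements_commute\<close>, by shrinking commutators), and the ratio of the lengths of commuting
elements is the same at all points; so nothing becomes shorter than \<open>A\<close>, and the boundary of the
region is thick (\<open>thick_boundary\<close>). If \<open>\<phi>\<close> is positive somewhere on the region, it attains its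
maximum there: for elliptic \<open>A\<close> the region is a compact disc, for hyperbolic \<open>A\<close> a tube which is
compact modulo the powers of \<open>A\<close>, and for parabolic \<open>A\<close> the fixed point is a cusp where the
\<open>q\<close>-expansion of \<open>f\<close> forces \<open>\<phi>\<close> to tend to 0. Since this maximum is not interior, it is on the
boundary, at a thick point. Hence the supremum of \<open>\<phi>\<close> is its maximum over a compact set.
\<close>

\<comment> \<open>Coefficients of power series and entries of vectors share the symbol \<open>$\<close>.\<close>
no_notation fps_nth (infixl \<open>$\<close> 75)

section \<open>Two-by-two real matrices and the action on the upper half-plane\<close>

lemma matrix_mult_nth: "((A::real^2^2) ** (B::real^2^2)) $ i $ j = A$i$1 * B$1$j + A$i$2 * B$2$j"
  by (simp add: matrix_matrix_mult_def sum_2)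

lemma mat_nth [simp]: "(mat x :: real^2^2) $ i $ j = (if i = j then x else 0)"
  by (simp add: mat_def)

lemma matrix_eq_2: "(A::real^2^2) = B \<longleftrightarrow>
    A$1$1 = B$1$1 \<and> A$1$2 = B$1$2 \<and> A$2$1 = B$2$1 \<and> A$2$2 = B$2$2"
  by (auto simp: vec_eq_iff forall_2)

definition matrix2 :: "real \<Rightarrow> real \<Rightarrow> real \<Rightarrow> real \<Rightarrow> real^2^2" where
  "matrix2 a b c d = vector [vector [a, b], vector [c, d]]"

lemma matrix2_nth [simp]:
  "matrix2 a b c d $ 1 $ 1 = a" "matrix2 a b c d $ 1 $ 2 = b"
  "matrix2 a b c d $ 2 $ 1 = c" "matrix2 a b c d $ 2 $ 2 = d"
  by (simp_all add: matrix2_def)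

text \<open>
On determinant 1 this is the inverse, with entries that are linear in those of \<open>A\<close>.
\<close>

definition adjugate :: "real^2^2 \<Rightarrow> real^2^2" where
  "adjugate A = matrix2 (A$2$2) (- A$1$2) (- A$2$1) (A$1$1)"

lemma adjugate_nth [simp]:
  "adjugate A $ 1 $ 1 = A$2$2" "adjugate A $ 1 $ 2 = - A$1$2"
  "adjugate A $ 2 $ 1 = - A$2$1" "adjugate A $ 2 $ 2 = A$1$1"
  by (simp_all add: adjugate_def)

lemma mult_adjugate:
  assumes "det A = 1"
  shows "A ** adjugate A = mat 1" "adjugate A ** A = mat 1"
  using assms by (auto simp: matrix_eq_2 matrix_mult_nth det_2 algebra_simps)

lemma conj_adjugate_cancel:
  assumes "det S = 1"
  shows "S ** (adjugate S ** A ** S) ** adjugate S = A" "adjugate S ** (S ** A ** adjugate S) ** S = A"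
proof -
  have "S ** (adjugate S ** A ** S) ** adjugate S = (S ** adjugate S) ** A ** (S ** adjugate S)"
    "adjugate S ** (S ** A ** adjugate S) ** S = (adjugate S ** S) ** A ** (adjugate S ** S)"
    by (simp_all only: matrix_mul_assoc)
  then show "S ** (adjugate S ** A ** S) ** adjugate S = A" "adjugate S ** (S ** A ** adjugate S) ** S = A"
    by (simp_all add: mult_adjugate[OF assms])
qed

lemma det_adjugate [simp]: "det (adjugate A) = det A"
  by (simp add: det_2)

lemma adjugate_adjugate [simp]: "adjugate (adjugate A) = A"
  by (simp add: matrix_eq_2)

lemma matrix_inv_eq_adjugate:
  assumes "det A = 1"
  shows "matrix_inv A = adjugate A"
proof -
  have inv: "A ** matrix_inv A = mat 1"
    unfolding matrix_inv_def
    using someI[of "\<lambda>A'. A ** A' = mat 1 \<and> A' ** A = mat 1" "adjugate A"] mult_adjugate[OF assms] by auto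
  have "matrix_inv A = (adjugate A ** A) ** matrix_inv A" by (simp add: mult_adjugate[OF assms])
  also have "\<dots> = adjugate A" unfolding matrix_mul_assoc[symmetric] inv by simp
  finally show ?thesis .
qed

lemma adjugate_mult: "adjugate (A ** B) = adjugate B ** adjugate A"
  by (simp add: matrix_eq_2 matrix_mult_nth)

lemma det_neg_2 [simp]: "det (- (A::real^2^2)) = det A"
  by (simp add: det_2)

lemma norm_matrix_2: "(norm (A::real^2^2))\<^sup>2 = (A$1$1)\<^sup>2 + (A$1$2)\<^sup>2 + (A$2$1)\<^sup>2 + (A$2$2)\<^sup>2"
  by (simp add: norm_vec_def L2_set_def sum_2 real_sqrt_pow2 add_nonneg_nonneg)

text \<open>
The norm of \<open>real^2^2\<close> is the Frobenius norm, and each entry of a product is bounded by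
Cauchy-Schwarz.
\<close>

lemma norm_matrix_mult_2: "norm ((A::real^2^2) ** (B::real^2^2)) \<le> norm A * norm B"
proof (rule power2_le_imp_le)
  have cs: "(p * q + r * s)\<^sup>2 \<le> (p\<^sup>2 + r\<^sup>2) * (q\<^sup>2 + s\<^sup>2)" for p q r s :: real
  proof -
    have "(p\<^sup>2 + r\<^sup>2) * (q\<^sup>2 + s\<^sup>2) - (p * q + r * s)\<^sup>2 = (p * s - r * q)\<^sup>2"
      by (simp add: power2_eq_square algebra_simps)
    then show ?thesis by (metis diff_ge_0_iff_ge zero_le_power2)
  qed
  have "(norm (A ** B))\<^sup>2 \<le>
      ((A$1$1)\<^sup>2 + (A$1$2)\<^sup>2) * ((B$1$1)\<^sup>2 + (B$2$1)\<^sup>2) +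
      ((A$1$1)\<^sup>2 + (A$1$2)\<^sup>2) * ((B$1$2)\<^sup>2 + (B$2$2)\<^sup>2) +
      ((A$2$1)\<^sup>2 + (A$2$2)\<^sup>2) * ((B$1$1)\<^sup>2 + (B$2$1)\<^sup>2) +
      ((A$2$1)\<^sup>2 + (A$2$2)\<^sup>2) * ((B$1$2)\<^sup>2 + (B$2$2)\<^sup>2)"
    unfolding norm_matrix_2 matrix_mult_nth by (intro add_mono cs)
  also have "\<dots> = (norm A * norm B)\<^sup>2"
    unfolding power_mult_distrib norm_matrix_2 by (simp add: algebra_simps)
  finally show "(norm (A ** B))\<^sup>2 \<le> (norm A * norm B)\<^sup>2" .
qed simp

lemma norm_adjugate [simp]: "norm (adjugate A) = norm A"
proof -
  have "(norm (adjugate A))\<^sup>2 = (norm A)\<^sup>2" by (simp add: norm_matrix_2)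
  then show ?thesis by (metis norm_ge_zero power2_eq_iff_nonneg)
qed

lemma autj_nonzero:
  assumes "det \<gamma> = 1" "0 < Im \<tau>"
  shows "autj \<gamma> \<tau> \<noteq> 0"
proof
  assume 0: "autj \<gamma> \<tau> = 0"
  then have "Im (autj \<gamma> \<tau>) = 0" "Re (autj \<gamma> \<tau>) = 0" by simp_all
  then have "\<gamma>$2$1 = 0" "\<gamma>$2$2 = 0" using assms(2) by (auto simp: autj_def)
  then show False using assms(1) by (simp add: det_2)
qed

lemma moebius_autj: "moebius A z = (of_real (A$1$1) * z + of_real (A$1$2)) / autj A z"
  by (simp add: moebius_def autj_def)

lemma Im_moebius:
  assumes "det A = 1" "0 < Im z"
  shows "Im (moebius A z) = Im z / (cmod (autj A z))\<^sup>2"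
proof -
  have "Im (moebius A z) = (det A * Im z) / (cmod (autj A z))\<^sup>2"
    by (simp add: moebius_autj Im_divide cmod_power2 det_2 autj_def) (simp add: algebra_simps)
  then show ?thesis using assms by simp
qed

lemma Im_moebius_pos:
  assumes "det A = 1" "0 < Im z"
  shows "0 < Im (moebius A z)"
  using assms autj_nonzero[OF assms] by (simp add: Im_moebius)

lemma autj_mult:
  assumes "det B = 1" "0 < Im z"
  shows "autj (A ** B) z = autj A (moebius B z) * autj B z"
proof -
  have "moebius B z * autj B z = of_real (B$1$1) * z + of_real (B$1$2)"
    using autj_nonzero[OF assms] by (simp add: moebius_autj)
  then have "autj A (moebius B z) * autj B z
      = of_real (A$2$1) * (of_real (B$1$1) * z + of_real (B$1$2)) + of_real (A$2$2) * autj B z"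
    by (simp add: autj_def[of A] distrib_right mult.assoc)
  then show ?thesis by (simp add: autj_def matrix_mult_nth algebra_simps)
qed

lemma moebius_mult:
  assumes "det A = 1" "det B = 1" "0 < Im z"
  shows "moebius (A ** B) z = moebius A (moebius B z)"
proof -
  have j: "autj B z \<noteq> 0" "autj A (moebius B z) \<noteq> 0"
    using autj_nonzero[OF assms(2,3)] autj_nonzero[OF assms(1) Im_moebius_pos[OF assms(2,3)]] by auto
  have "moebius A (moebius B z)
      = (of_real (A$1$1) * moebius B z + of_real (A$1$2)) * autj B z / (autj A (moebius B z) * autj B z)"
    using j by (simp add: moebius_autj[of A])
  also have "(of_real (A$1$1) * moebius B z + of_real (A$1$2)) * autj B z
      = of_real ((A ** B)$1$1) * z + of_real ((A ** B)$1$2)"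
    using j(1) by (simp add: moebius_autj[of B] matrix_mult_nth distrib_right)
      (simp add: autj_def algebra_simps)
  finally show ?thesis using autj_mult[OF assms(2,3)] by (simp add: moebius_autj)
qed

lemma moebius_one [simp]: "moebius (mat 1) z = z"
  by (simp add: moebius_def)

lemma moebius_neg [simp]: "moebius (- A) z = moebius A z"
proof -
  have "moebius (- A) z = (- (of_real (A$1$1) * z + of_real (A$1$2))) / (- (of_real (A$2$1) * z + of_real (A$2$2)))"
    by (simp add: moebius_def)
  then show ?thesis unfolding moebius_def by (simp only: minus_divide_divide)
qed

lemma moebius_adjugate:
  assumes "det A = 1" "0 < Im z"
  shows "moebius (adjugate A) (moebius A z) = z" "moebius A (moebius (adjugate A) z) = z"
  using assms moebius_mult[of "adjugate A" A z] moebius_mult[of A "adjugate A" z]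
  by (simp_all add: mult_adjugate)

lemma continuous_on_moebius:
  assumes "det A = 1"
  shows "continuous_on UHP (moebius A)"
proof -
  have "continuous_on UHP (\<lambda>z. (of_real (A$1$1) * z + of_real (A$1$2)) / autj A z)"
    using autj_nonzero[OF assms] by (intro continuous_intros) (auto simp: autj_def intro!: continuous_intros)
  then show ?thesis by (simp add: moebius_autj[abs_def])
qed

text \<open>
\<open>4 sinh\<^sup>2(d/2)\<close> for the hyperbolic distance \<open>d\<close>. It is rational in the coordinates, and its weak
triangle inequality \<open>point_pair_triangle\<close> suffices for packing arguments.
\<close>

definition point_pair :: "complex \<Rightarrow> complex \<Rightarrow> real" where
  "point_pair z w = (cmod (z - w))\<^sup>2 / (Im z * Im w)"

lemma point_pair_commute: "point_pair z w = point_pair w z"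
  by (simp add: point_pair_def norm_minus_commute mult.commute)

lemma moebius_diff:
  assumes "det A = 1" "0 < Im z" "0 < Im w"
  shows "moebius A z - moebius A w = (z - w) / (autj A z * autj A w)"
proof -
  have j: "autj A z \<noteq> 0" "autj A w \<noteq> 0" using autj_nonzero[OF assms(1)] assms by blast+
  have "(of_real (A$1$1) * z + of_real (A$1$2)) * autj A w - (of_real (A$1$1) * w + of_real (A$1$2)) * autj A z
     = of_real (det A) * (z - w)"
    by (simp add: autj_def det_2 algebra_simps)
  then show ?thesis using j assms by (simp add: moebius_autj diff_frac_eq)
qed

lemma point_pair_moebius:
  assumes "det A = 1" "0 < Im z" "0 < Im w"
  shows "point_pair (moebius A z) (moebius A w) = point_pair z w"
proof -
  have j: "autj A z \<noteq> 0" "autj A w \<noteq> 0" using autj_nonzero[OF assms(1)] assms by blast+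
  show ?thesis
    using j assms
    by (simp add: point_pair_def moebius_diff Im_moebius norm_divide norm_mult power_mult_distrib power_divide)
qed

text \<open>
The upper triangular matrix that carries \<open>\<i>\<close> to \<open>z\<close>. Conjugation by it, called \<open>framed z\<close> below,
turns questions at \<open>z\<close> into questions about matrix norms.
\<close>

definition frame :: "complex \<Rightarrow> real^2^2" where
  "frame z = matrix2 (sqrt (Im z)) (Re z / sqrt (Im z)) 0 (1 / sqrt (Im z))"

definition traceless :: "real^2^2 \<Rightarrow> real^2^2" where
  "traceless A = matrix2 ((A$1$1 - A$2$2) / 2) (A$1$2) (A$2$1) ((A$2$2 - A$1$1) / 2)"

text \<open>
The square of the length of \<open>A\<close> at \<open>z\<close>, that is, of the norm of the traceless part of \<open>framed z A\<close>
(\<open>length2_eq_norm\<close>). In contrast to the displacement \<open>point_pair z (moebius A z)\<close>, which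
vanishes at the fixed point of an elliptic element, it is positive unless \<open>A\<close> is \<open>\<plusminus>1\<close>; and it is a
quadratic form in the traceless part of \<open>A\<close>.
\<close>

definition length2 :: "real^2^2 \<Rightarrow> complex \<Rightarrow> real" where
  "length2 A z = ((A$2$1 * (cmod z)\<^sup>2 + (A$2$2 - A$1$1) * Re z - A$1$2) / Im z)\<^sup>2
     + ((A$2$2 - A$1$1)\<^sup>2 + 4 * A$1$2 * A$2$1) / 2"

definition framed :: "complex \<Rightarrow> real^2^2 \<Rightarrow> real^2^2" where
  "framed z A = adjugate (frame z) ** A ** frame z"

lemma det_frame [simp]: "0 < Im z \<Longrightarrow> det (frame z) = 1"
  by (simp add: frame_def det_2)

lemma framed_mult: "0 < Im z \<Longrightarrow> framed z (A ** B) = framed z A ** framed z B"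
proof -
  assume z: "0 < Im z"
  have "framed z A ** framed z B = adjugate (frame z) ** A ** (frame z ** adjugate (frame z)) ** B ** frame z"
    unfolding framed_def by (simp only: matrix_mul_assoc)
  then show ?thesis
    using mult_adjugate(1)[OF det_frame[OF z]] by (simp add: framed_def matrix_mul_assoc)
qed

lemma det_framed: "0 < Im z \<Longrightarrow> det (framed z A) = det A"
  by (simp add: framed_def det_mul)

lemma framed_nth:
  assumes "0 < Im z"
  shows "framed z A $ 1 $ 1 = A$1$1 - Re z * A$2$1"
    "framed z A $ 1 $ 2 = (A$1$2 + Re z * (A$1$1 - A$2$2) - (Re z)\<^sup>2 * A$2$1) / Im z"
    "framed z A $ 2 $ 1 = A$2$1 * Im z"
    "framed z A $ 2 $ 2 = A$2$2 + Re z * A$2$1"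
proof -
  define s where "s = sqrt (Im z)"
  have s: "s \<noteq> 0" and y: "Im z = s * s" using assms by (auto simp: s_def)
  show "framed z A $ 1 $ 1 = A$1$1 - Re z * A$2$1"
    "framed z A $ 1 $ 2 = (A$1$2 + Re z * (A$1$1 - A$2$2) - (Re z)\<^sup>2 * A$2$1) / Im z"
    "framed z A $ 2 $ 1 = A$2$1 * Im z"
    "framed z A $ 2 $ 2 = A$2$2 + Re z * A$2$1"
    unfolding framed_def frame_def s_def[symmetric] y using s
    by (simp_all add: matrix_mult_nth field_simps power2_eq_square)
qed

lemma framed_one: "0 < Im z \<Longrightarrow> framed z (mat 1) = mat 1"
  by (simp add: matrix_eq_2 framed_nth)

lemma framed_adjugate: "0 < Im z \<Longrightarrow> framed z (adjugate A) = adjugate (framed z A)"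
  by (simp add: matrix_eq_2 framed_nth field_simps)

lemma framed_neg: "0 < Im z \<Longrightarrow> framed z (- A) = - framed z A"
  by (simp add: matrix_eq_2 framed_nth field_simps)

lemma inj_framed: "0 < Im z \<Longrightarrow> framed z A = framed z B \<Longrightarrow> A = B"
  by (auto simp: matrix_eq_2 framed_nth)

lemma norm_traceless: "(norm A)\<^sup>2 = (norm (traceless A))\<^sup>2 + (A$1$1 + A$2$2)\<^sup>2 / 2"
  unfolding norm_matrix_2 traceless_def by (simp add: power2_eq_square field_simps)

lemma length2_eq_norm:
  assumes "0 < Im z"
  shows "length2 A z = (norm (traceless (framed z A)))\<^sup>2"
proof -
  have y: "Im z \<noteq> 0" using assms by auto
  show ?thesis
    using y unfolding norm_matrix_2 traceless_def length2_def cmod_power2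
    by (simp add: framed_nth[OF assms] field_simps power2_eq_square)
qed

text \<open>
Since the displacement and the trace are invariant under conjugation, the first formula makes
\<open>length2\<close> invariant as well. The second one turns bounds on the displacement into bounds on
matrices.
\<close>

lemma point_pair_moebius_self:
  assumes "det A = 1" "0 < Im z"
  shows "point_pair z (moebius A z) = length2 A z + ((A$1$1 + A$2$2)\<^sup>2 - 4) / 2"
    and "point_pair z (moebius A z) = (norm (framed z A))\<^sup>2 - 2"
proof -
  have j: "autj A z \<noteq> 0" using autj_nonzero assms by auto
  have y: "Im z \<noteq> 0" using assms by auto
  have d: "A$1$1 * A$2$2 = 1 + A$1$2 * A$2$1" using assms by (simp add: det_2)
  have "z - moebius A z = (z * autj A z - (of_real (A$1$1) * z + of_real (A$1$2))) / autj A z"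
    using j by (simp add: moebius_autj field_simps)
  then have 1: "point_pair z (moebius A z) = (cmod (z * autj A z - (of_real (A$1$1) * z + of_real (A$1$2))))\<^sup>2 / (Im z)\<^sup>2"
    using j y assms by (simp add: point_pair_def Im_moebius norm_divide power_divide) (simp add: power2_eq_square field_simps)
  have tr: "(A$1$1 + A$2$2)\<^sup>2 - 4 = (A$2$2 - A$1$1)\<^sup>2 + 4 * A$1$2 * A$2$1"
    using d by (simp add: power2_eq_square algebra_simps)
  have 2: "(cmod (z * autj A z - (of_real (A$1$1) * z + of_real (A$1$2))))\<^sup>2
     = (A$2$1 * (cmod z)\<^sup>2 + (A$2$2 - A$1$1) * Re z - A$1$2)\<^sup>2
       + (Im z)\<^sup>2 * ((A$2$2 - A$1$1)\<^sup>2 + 4 * A$1$2 * A$2$1)"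
    unfolding cmod_power2 autj_def by (simp add: power2_eq_square algebra_simps)
  show *: "point_pair z (moebius A z) = length2 A z + ((A$1$1 + A$2$2)\<^sup>2 - 4) / 2"
    unfolding 1 2 tr length2_def using y by (simp add: power_divide field_simps)
  show "point_pair z (moebius A z) = (norm (framed z A))\<^sup>2 - 2"
    unfolding * length2_eq_norm[OF assms(2)] norm_traceless[of "framed z A"]
    by (simp add: framed_nth[OF assms(2)] field_simps)
qed

lemma trace_conj: "det B = 1 \<Longrightarrow> (B ** A ** adjugate B)$1$1 + (B ** A ** adjugate B)$2$2 = A$1$1 + A$2$2"
proof -
  assume "det B = 1"
  then have "B$1$1 * B$2$2 - B$1$2 * B$2$1 = 1" by (simp add: det_2)
  then have d: "B$1$1 * B$2$2 = 1 + B$1$2 * B$2$1" by simp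
  have "(B ** A ** adjugate B)$1$1 + (B ** A ** adjugate B)$2$2
     = (A$1$1 + A$2$2) * (B$1$1 * B$2$2 - B$1$2 * B$2$1)"
    by (simp add: matrix_mult_nth algebra_simps)
  then show ?thesis using d by simp
qed

lemma length2_conj:
  assumes "det A = 1" "det B = 1" "0 < Im z"
  shows "length2 (B ** A ** adjugate B) (moebius B z) = length2 A z"
proof -
  have d: "det (B ** A ** adjugate B) = 1" using assms by (simp add: det_mul)
  have "moebius (B ** A ** adjugate B) (moebius B z) = moebius B (moebius A z)"
    using assms Im_moebius_pos[OF assms(2,3)]
    by (simp add: moebius_mult det_mul moebius_adjugate Im_moebius_pos)
  then have "point_pair (moebius B z) (moebius (B ** A ** adjugate B) (moebius B z)) = point_pair z (moebius A z)"
    using assms by (simp add: point_pair_moebius Im_moebius_pos)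
  then show ?thesis
    using point_pair_moebius_self(1)[OF d Im_moebius_pos[OF assms(2,3)]] point_pair_moebius_self(1)[OF assms(1,3)]
      trace_conj[OF assms(2), of A] by simp
qed

lemma frame_point: "0 < Im z \<Longrightarrow> moebius (frame z) \<i> = z"
proof -
  assume "0 < Im z"
  then have s: "sqrt (Im z) \<noteq> 0" "Im z = sqrt (Im z) * sqrt (Im z)" by auto
  have "Re (moebius (frame z) \<i>) = Re z" "Im (moebius (frame z) \<i>) = Im z"
    using s by (auto simp: moebius_def frame_def Re_divide Im_divide power2_eq_square field_simps)
  then show ?thesis by (simp add: complex_eq_iff)
qed

text \<open>
The left-hand side is the square of the norm of \<open>g\<^sub>z\<^sup>-\<^sup>1 g\<^sub>v\<close>, where \<open>g\<close> denotes frames, and the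
factors on the right belong to \<open>g\<^sub>z\<^sup>-\<^sup>1 g\<^sub>w\<close> and \<open>g\<^sub>w\<^sup>-\<^sup>1 g\<^sub>v\<close>; the norm is submultiplicative.
\<close>

lemma point_pair_triangle:
  assumes "0 < Im z" "0 < Im w" "0 < Im v"
  shows "point_pair z v + 2 \<le> (point_pair z w + 2) * (point_pair w v + 2)"
proof -
  have *: "point_pair z w + 2 = (norm (adjugate (frame z) ** frame w))\<^sup>2" if z: "0 < Im z" and w: "0 < Im w" for z w
  proof -
    have f1: "framed \<i> M = M" for M by (simp add: matrix_eq_2 framed_nth)
    let ?M = "adjugate (frame z) ** frame w"
    have d: "det ?M = 1" using z w by (simp add: det_mul)
    have iU: "0 < Im \<i>" by simp
    have "moebius ?M \<i> = moebius (adjugate (frame z)) w"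
      using moebius_mult[of "adjugate (frame z)" "frame w" \<i>] z w frame_point[OF w] by simp
    then have "point_pair z w = point_pair (moebius (frame z) \<i>) (moebius (frame z) (moebius ?M \<i>))"
      using z w by (simp add: frame_point moebius_adjugate)
    also have "\<dots> = point_pair \<i> (moebius ?M \<i>)"
      by (rule point_pair_moebius) (use z d Im_moebius_pos[OF d iU] in auto)
    also have "\<dots> = (norm ?M)\<^sup>2 - 2" using point_pair_moebius_self(2)[OF d iU] by (simp add: f1)
    finally show ?thesis by simp
  qed
  have "adjugate (frame z) ** frame v = (adjugate (frame z) ** frame w) ** (adjugate (frame w) ** frame v)"
    using mult_adjugate(1)[of "frame w"] det_frame[OF assms(2)]
    by (metis matrix_mul_assoc matrix_mul_rid)
  then have "norm (adjugate (frame z) ** frame v)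
      \<le> norm (adjugate (frame z) ** frame w) * norm (adjugate (frame w) ** frame v)"
    using norm_matrix_mult_2 by metis
  then have "(norm (adjugate (frame z) ** frame v))\<^sup>2
      \<le> (norm (adjugate (frame z) ** frame w) * norm (adjugate (frame w) ** frame v))\<^sup>2"
    by (intro power_mono) auto
  then show ?thesis using assms by (simp add: * power_mult_distrib)
qed

section \<open>Commutators of elements near the identity\<close>

lemma norm_matrix_mult_3: "norm ((A::real^2^2) ** (B::real^2^2) ** (C::real^2^2)) \<le> norm A * norm B * norm C"
  using norm_matrix_mult_2[of "A ** B" C] mult_right_mono[OF norm_matrix_mult_2[of A B], of "norm C"]
  by (simp add: order_trans)

lemma adjugate_mult_eq_one:
  assumes "det A = 1" "adjugate A ** B = mat 1"
  shows "A = B"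
proof -
  have "A ** adjugate A ** B = A ** (adjugate A ** B)" by (simp only: matrix_mul_assoc)
  then show ?thesis using assms by (simp add: mult_adjugate)
qed

lemma le_eighth: "(x::real)\<^sup>2 \<le> 1/64 \<Longrightarrow> x \<le> 1/8"
  by (rule power2_le_imp_le) (simp_all add: power_divide)

lemma ge_eighth: "1/64 \<le> (x::real)\<^sup>2 \<Longrightarrow> 0 \<le> x \<Longrightarrow> 1/8 \<le> x"
  by (rule power2_le_imp_le) (simp_all add: power_divide)

lemma matrix_diff_mult_2: "((A::real^2^2) - B) ** (C::real^2^2) = A ** C - B ** C"
  by (simp add: matrix_eq_2 matrix_mult_nth algebra_simps)

lemma matrix_mult_diff_2: "(C::real^2^2) ** ((A::real^2^2) - B) = C ** A - C ** B"
  by (simp add: matrix_eq_2 matrix_mult_nth algebra_simps)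

lemma matrix_neg_mult_2: "(- (A::real^2^2)) ** (B::real^2^2) = - (A ** B)" "(A::real^2^2) ** (- (B::real^2^2)) = - (A ** B)"
  by (simp_all add: matrix_eq_2 matrix_mult_nth)

lemma traceless_nth [simp]:
  "traceless A $ 1 $ 1 = (A$1$1 - A$2$2) / 2" "traceless A $ 1 $ 2 = A$1$2"
  "traceless A $ 2 $ 1 = A$2$1" "traceless A $ 2 $ 2 = (A$2$2 - A$1$1) / 2"
  by (simp_all add: traceless_def)

lemma traceless_eq_0_iff:
  assumes "det A = 1"
  shows "traceless A = 0 \<longleftrightarrow> A = mat 1 \<or> A = - mat 1"
proof -
  define a b c d where "a = A$1$1" and "b = A$1$2" and "c = A$2$1" and "d = A$2$2"
  have "a * d - b * c = 1" using assms by (simp add: det_2 a_def b_def c_def d_def)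
  then have "a = 1 \<and> d = 1 \<or> a = -1 \<and> d = -1" if "a = d" "b = 0"
    using that by (simp add: square_eq_1_iff)
  then show ?thesis
    unfolding matrix_eq_2 traceless_nth a_def[symmetric] b_def[symmetric] c_def[symmetric] d_def[symmetric]
    by (cases "b = 0"; cases "c = 0") auto
qed

lemma norm_traceless_le: "norm (traceless A) \<le> norm (A - mat 1)"
proof (rule power2_le_imp_le)
  have "traceless A = traceless (A - mat 1)" by (simp add: matrix_eq_2)
  then show "(norm (traceless A))\<^sup>2 \<le> (norm (A - mat 1))\<^sup>2"
    using norm_traceless[of "A - mat 1"] by simp
qed simp

lemma norm_det_1_le:
  assumes "det A = 1"
  shows "(norm A)\<^sup>2 \<le> 2 + 2 * (norm (traceless A))\<^sup>2"
proof -
  have "A$1$1 * A$2$2 = 1 + A$1$2 * A$2$1" using assms by (simp add: det_2)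
  then have "(A$1$1 + A$2$2)\<^sup>2 = (A$2$2 - A$1$1)\<^sup>2 + 4 + 4 * (A$1$2 * A$2$1)"
    by (simp add: power2_eq_square algebra_simps)
  moreover have "2 * (A$1$2 * A$2$1) \<le> (A$1$2)\<^sup>2 + (A$2$1)\<^sup>2"
    using sum_squares_bound[of "A$1$2" "A$2$1"] by simp
  moreover have "(norm (traceless A))\<^sup>2 = (A$2$2 - A$1$1)\<^sup>2 / 2 + (A$1$2)\<^sup>2 + (A$2$1)\<^sup>2"
    unfolding norm_matrix_2 traceless_nth by (simp add: power2_eq_square field_simps)
  ultimately show ?thesis using norm_traceless[of A] by linarith
qed

text \<open>
\<open>P Q P\<^sup>-\<^sup>1 Q\<^sup>-\<^sup>1 - 1 = (P Q - Q P) P\<^sup>-\<^sup>1 Q\<^sup>-\<^sup>1\<close>, and \<open>P Q - Q P\<close> depends only on the traceless parts. So the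
distance of the commutator from 1 is a fraction of the norm of the traceless part of \<open>P\<close>, also when
\<open>P\<close> and \<open>Q\<close> are close to \<open>-1\<close>.
\<close>

lemma commutator_near_one:
  assumes d: "det P = 1" "det Q = 1"
    and small: "norm (traceless P) \<le> 1/8" "norm (traceless Q) \<le> 1/8"
  shows "norm (P ** Q ** adjugate P ** adjugate Q - mat 1) \<le> 17/32 * norm (traceless P)"
proof -
  let ?x = "norm (traceless P)" and ?y = "norm (traceless Q)"
  have norm_le: "(norm A)\<^sup>2 \<le> 65/32" if "det A = 1" "norm (traceless A) \<le> 1/8" for A
  proof -
    have "(norm (traceless A))\<^sup>2 \<le> (1/8)\<^sup>2" using that(2) by (intro power_mono) auto
    then show ?thesis using norm_det_1_le[OF that(1)] by (simp add: power2_eq_square)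
  qed
  have XY: "norm P * norm Q \<le> 65/32"
  proof (rule power2_le_imp_le)
    show "(norm P * norm Q)\<^sup>2 \<le> (65/32)\<^sup>2"
      unfolding power_mult_distrib power2_eq_square[of "65/32::real"]
      using norm_le d small by (intro mult_mono) auto
  qed simp
  have "P ** Q - Q ** P = traceless P ** traceless Q - traceless Q ** traceless P"
    by (simp add: matrix_eq_2 matrix_mult_nth field_simps)
  also have "norm \<dots> \<le> norm (traceless P ** traceless Q) + norm (traceless Q ** traceless P)"
    by (rule norm_triangle_ineq4)
  also have "\<dots> \<le> ?x * ?y + ?y * ?x" by (intro add_mono norm_matrix_mult_2)
  finally have comm: "norm (P ** Q - Q ** P) \<le> 2 * ?x * ?y" by simp
  have "Q ** P ** adjugate P ** adjugate Q = Q ** (P ** adjugate P) ** adjugate Q"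
    by (simp only: matrix_mul_assoc)
  then have "Q ** P ** adjugate P ** adjugate Q = mat 1"
    using mult_adjugate[OF d(1)] mult_adjugate[OF d(2)] by simp
  then have "P ** Q ** adjugate P ** adjugate Q - mat 1 = (P ** Q - Q ** P) ** adjugate P ** adjugate Q"
    by (simp add: matrix_diff_mult_2)
  then have "norm (P ** Q ** adjugate P ** adjugate Q - mat 1)
      \<le> norm (P ** Q - Q ** P) * norm P * norm Q"
    using norm_matrix_mult_3[of "P ** Q - Q ** P" "adjugate P" "adjugate Q"] by simp
  also have "\<dots> = norm (P ** Q - Q ** P) * (norm P * norm Q)" by simp
  also have "\<dots> \<le> (2 * ?x * ?y) * (65/32)" using comm XY by (intro mult_mono) auto
  also have "\<dots> \<le> (2 * ?x * (1/8)) * (65/32)" using small by (intro mult_right_mono mult_left_mono) auto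
  also have "\<dots> \<le> 17/32 * ?x" by simp
  finally show ?thesis .
qed

text \<open>
The centralizer of a nonscalar \<open>A\<close> consists of the combinations of 1 and \<open>A\<close>. A nonzero entry of the
traceless part of \<open>A\<close> determines the factor.
\<close>

lemma commuting_traceless_parallel:
  assumes "det A = 1" "A ** B = B ** A" "A \<noteq> mat 1" "A \<noteq> - mat 1"
  shows "\<exists>\<beta>. traceless B = \<beta> *\<^sub>R traceless A"
proof -
  have en: "(A ** B)$1$1 = (B ** A)$1$1" "(A ** B)$1$2 = (B ** A)$1$2" "(A ** B)$2$1 = (B ** A)$2$1"
    using assms(2) by simp_all
  have e1: "A$1$2 * B$2$1 = B$1$2 * A$2$1"
    using en(1) unfolding matrix_mult_nth by (simp add: mult.commute)
  have e2: "A$1$2 * (B$2$2 - B$1$1) = B$1$2 * (A$2$2 - A$1$1)"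
    using en(2) unfolding matrix_mult_nth by (simp add: algebra_simps)
  have e3: "A$2$1 * (B$2$2 - B$1$1) = B$2$1 * (A$2$2 - A$1$1)"
    using en(3) unfolding matrix_mult_nth by (simp add: algebra_simps)
  have parallel: "traceless B = \<beta> *\<^sub>R traceless A"
    if "B$1$2 = \<beta> * A$1$2" "B$2$1 = \<beta> * A$2$1" "B$2$2 - B$1$1 = \<beta> * (A$2$2 - A$1$1)" for \<beta>
  proof -
    have "B$1$1 - B$2$2 = \<beta> * (A$1$1 - A$2$2)" using that(3) by (simp add: algebra_simps)
    then show ?thesis using that unfolding matrix_eq_2 by simp
  qed
  have "traceless A \<noteq> 0" using traceless_eq_0_iff assms by blast
  then have "A$1$2 \<noteq> 0 \<or> A$2$1 \<noteq> 0 \<or> A$2$2 - A$1$1 \<noteq> 0"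
    unfolding matrix_eq_2 traceless_nth by auto
  then consider "A$1$2 \<noteq> 0" | "A$2$1 \<noteq> 0" | "A$1$2 = 0" "A$2$1 = 0" "A$2$2 - A$1$1 \<noteq> 0"
    by blast
  then show ?thesis
  proof cases
    case 1
    then have "B$2$1 = B$1$2 / A$1$2 * A$2$1" "B$2$2 - B$1$1 = B$1$2 / A$1$2 * (A$2$2 - A$1$1)"
      using e1 e2 by (simp_all add: nonzero_eq_divide_eq mult.commute)
    then show ?thesis using 1 by (intro exI[of _ "B$1$2 / A$1$2"] parallel) auto
  next
    case 2
    then have "B$1$2 = B$2$1 / A$2$1 * A$1$2" "B$2$2 - B$1$1 = B$2$1 / A$2$1 * (A$2$2 - A$1$1)"
      using e1 e3 by (simp_all add: nonzero_eq_divide_eq mult.commute)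
    then show ?thesis using 2 by (intro exI[of _ "B$2$1 / A$2$1"] parallel) auto
  next
    case 3
    then have "B$1$2 = 0" "B$2$1 = 0" using e2 e3 by auto
    then show ?thesis using 3 by (intro exI[of _ "(B$2$2 - B$1$1) / (A$2$2 - A$1$1)"] parallel) auto
  qed
qed

lemma parallel_entries:
  assumes "traceless B = \<beta> *\<^sub>R traceless A"
  shows "B$1$2 = \<beta> * A$1$2" "B$2$1 = \<beta> * A$2$1" "B$2$2 - B$1$1 = \<beta> * (A$2$2 - A$1$1)"
  using assms by (auto simp: matrix_eq_2 field_simps)

lemma parallel_commute:
  assumes "traceless B = \<beta> *\<^sub>R traceless A" "traceless C = \<gamma> *\<^sub>R traceless A"
  shows "B ** C = C ** B"
proof -
  note b = parallel_entries[OF assms(1)] and c = parallel_entries[OF assms(2)]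
  have b': "B$2$2 = B$1$1 + \<beta> * (A$2$2 - A$1$1)" and c': "C$2$2 = C$1$1 + \<gamma> * (A$2$2 - A$1$1)"
    using b(3) c(3) by auto
  show ?thesis
    by (simp add: matrix_eq_2 matrix_mult_nth b(1,2) c(1,2) b' c' algebra_simps)
qed

text \<open>
The ratio of the lengths of commuting elements does not depend on the point. Comparing lengths at
one point of a thin region therefore compares them on the whole region.
\<close>

lemma length2_parallel:
  assumes "traceless B = \<beta> *\<^sub>R traceless A"
  shows "length2 B z = \<beta>\<^sup>2 * length2 A z"
proof -
  note b = parallel_entries[OF assms]
  have "\<beta> * A$2$1 * (cmod z)\<^sup>2 + \<beta> * (A$2$2 - A$1$1) * Re z - \<beta> * A$1$2
     = \<beta> * (A$2$1 * (cmod z)\<^sup>2 + (A$2$2 - A$1$1) * Re z - A$1$2)" by (simp add: algebra_simps)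
  then show ?thesis
    unfolding length2_def b by (simp add: power_mult_distrib power_divide) (simp add: algebra_simps power2_eq_square)
qed

section \<open>Discrete groups and their thick part\<close>

text \<open>
The ball of radius \<open>R\<close> is covered by finitely many balls of radius \<open>e/2\<close>, and each of them contains at
most one point of a separated set.
\<close>

lemma separated_bounded_card:
  fixes R e :: real
  assumes "e > 0"
  shows "\<exists>N. \<forall>S :: 'a::euclidean_space set. (\<forall>x\<in>S. norm x \<le> R) \<and> (\<forall>x\<in>S. \<forall>y\<in>S. x \<noteq> y \<longrightarrow> e \<le> dist x y)
    \<longrightarrow> finite S \<and> card S \<le> N"
proof -
  have "cball (0::'a) R \<subseteq> (\<Union>x\<in>cball 0 R. ball x (e / 2))" using assms by auto
  then obtain K where K: "finite K" "cball (0::'a) R \<subseteq> (\<Union>x\<in>K. ball x (e / 2))"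
    using compactE_image[OF compact_cball, of "cball (0::'a) R" "\<lambda>x. ball x (e/2)" 0 R] by (metis open_ball)
  show ?thesis
  proof (intro exI[of _ "card K"] allI impI)
    fix S :: "'a set"
    assume S: "(\<forall>x\<in>S. norm x \<le> R) \<and> (\<forall>x\<in>S. \<forall>y\<in>S. x \<noteq> y \<longrightarrow> e \<le> dist x y)"
    have "\<forall>x\<in>S. \<exists>k\<in>K. dist k x < e / 2" using S K(2) by fastforce
    then obtain h where h: "\<And>x. x \<in> S \<Longrightarrow> h x \<in> K" "\<And>x. x \<in> S \<Longrightarrow> dist (h x) x < e / 2" by metis
    have "inj_on h S"
    proof (rule inj_onI, rule ccontr)
      fix x y assume xy: "x \<in> S" "y \<in> S" "h x = h y" "x \<noteq> y"
      have "dist x y \<le> dist (h x) x + dist (h y) y" using xy(3) by (metis dist_triangle3)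
      then show False using h(2)[OF xy(1)] h(2)[OF xy(2)] S xy by fastforce
    qed
    moreover have "h ` S \<subseteq> K" using h by auto
    ultimately show "finite S \<and> card S \<le> card K"
      using K(1) by (metis card_inj_on_le finite_imageD finite_subset)
  qed
qed

locale discrete_matrix_group =
  fixes G :: "(real^2^2) set"
  assumes det_G: "A \<in> G \<Longrightarrow> det A = 1"
    and one_G: "mat 1 \<in> G"
    and neg_G: "A \<in> G \<Longrightarrow> - A \<in> G"
    and mult_G: "A \<in> G \<Longrightarrow> B \<in> G \<Longrightarrow> A ** B \<in> G"
    and adjugate_G: "A \<in> G \<Longrightarrow> adjugate A \<in> G"
    and isolated_one: "\<exists>e>0. \<forall>A\<in>G. norm (A - mat 1) < e \<longrightarrow> A = mat 1"
begin

definition nontrivial :: "(real^2^2) set" where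
  "nontrivial = G - {mat 1, - mat 1}"

text \<open>
The threshold \<open>1/64\<close> for the square of the length is the one of \<open>commutator_near_one\<close>.
\<close>

definition thick :: "complex set" where
  "thick = {z. 0 < Im z \<and> (\<forall>A\<in>nontrivial. 1/64 \<le> length2 A z)}"

text \<open>
From \<open>A\<^sup>-\<^sup>1 B - 1 = A\<^sup>-\<^sup>1 (B - A)\<close>: in a bounded set of matrices, a lower bound for the distance of
quotients from 1 separates the elements.
\<close>

lemma framed_separated:
  assumes z: "0 < Im z" and "A \<in> G" "B \<in> G" "norm (framed z A) \<le> R"
    and far: "e \<le> norm (framed z (adjugate A ** B) - mat 1)" and R: "R > 0"
  shows "e / R \<le> dist (framed z A) (framed z B)"
proof -
  have "framed z (adjugate A ** B) - mat 1 = adjugate (framed z A) ** (framed z B - framed z A)"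
    using mult_adjugate[of "framed z A"] det_framed[OF z, of A] det_G[OF assms(2)]
    by (simp add: framed_mult[OF z] framed_adjugate[OF z] matrix_mult_diff_2)
  then have "e \<le> norm (framed z A) * norm (framed z B - framed z A)"
    using far norm_matrix_mult_2[of "adjugate (framed z A)" "framed z B - framed z A"] by simp
  also have "\<dots> \<le> R * dist (framed z A) (framed z B)"
    using assms(4) by (simp add: dist_norm norm_minus_commute mult_right_mono)
  finally show ?thesis using R by (simp add: field_simps)
qed

lemma finite_framed_bounded:
  assumes z: "0 < Im z"
  shows "finite {A \<in> G. norm (framed z A) \<le> R}"
proof (cases "R > 0")
  case R: True
  obtain e where e: "e > 0" "\<And>A. A \<in> G \<Longrightarrow> norm (A - mat 1) < e \<Longrightarrow> A = mat 1"
    using isolated_one by blast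
  define g where "g = norm (frame z)"
  have dg: "det (frame z) = 1" using z by simp
  have "frame z \<noteq> 0" using dg by (auto simp: det_2)
  then have g: "g > 0" by (simp add: g_def)
  have far: "e / g\<^sup>2 \<le> norm (framed z C - mat 1)" if C: "C \<in> G" "C \<noteq> mat 1" for C
  proof -
    have "frame z ** framed z C ** adjugate (frame z) = C"
      unfolding framed_def by (rule conj_adjugate_cancel(1)[OF dg])
    then have "C - mat 1 = frame z ** (framed z C - mat 1) ** adjugate (frame z)"
      using mult_adjugate[OF dg] by (simp add: matrix_mult_diff_2 matrix_diff_mult_2)
    then have "norm (C - mat 1) \<le> g * norm (framed z C - mat 1) * g"
      using norm_matrix_mult_3[of "frame z" "framed z C - mat 1" "adjugate (frame z)"]
      by (simp add: g_def)
    moreover have "e \<le> norm (C - mat 1)" using e(2)[OF C(1)] C(2) by fastforce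
    ultimately show ?thesis using g by (simp add: field_simps power2_eq_square)
  qed
  have "e / g\<^sup>2 / R > 0" using e g R by simp
  from separated_bounded_card[OF this, of R]
  obtain N where N: "\<forall>S :: (real^2^2) set. (\<forall>x\<in>S. norm x \<le> R) \<and>
      (\<forall>x\<in>S. \<forall>y\<in>S. x \<noteq> y \<longrightarrow> e / g\<^sup>2 / R \<le> dist x y) \<longrightarrow> finite S \<and> card S \<le> N"
    by (rule exE)
  let ?T = "{A \<in> G. norm (framed z A) \<le> R}"
  have "e / g\<^sup>2 / R \<le> dist (framed z A) (framed z B)" if "A \<in> ?T" "B \<in> ?T" "framed z A \<noteq> framed z B" for A B
  proof (rule framed_separated[OF z])
    have AB: "A \<in> G" "B \<in> G" using that by blast+
    have "A \<noteq> B" using that(3) by blast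
    then have "adjugate A ** B \<noteq> mat 1"
      using adjugate_mult_eq_one[OF det_G[OF AB(1)]] by blast
    then show "e / g\<^sup>2 \<le> norm (framed z (adjugate A ** B) - mat 1)"
      by (rule far[OF mult_G[OF adjugate_G[OF AB(1)] AB(2)]])
  qed (use that R in blast)+
  then have "finite (framed z ` ?T)" by (intro conjunct1[OF N[rule_format]]) auto
  moreover have "inj_on (framed z) ?T" using inj_framed[OF z] by (auto simp: inj_on_def)
  ultimately show ?thesis by (rule finite_imageD)
next
  case False
  have "norm (framed z A) > 0" if "A \<in> G" for A
    using det_framed[OF z, of A] det_G[OF that] by (auto simp: det_2)
  then have "\<not> norm (framed z A) \<le> R" if "A \<in> G" for A using False that by fastforce
  then have "{A \<in> G. norm (framed z A) \<le> R} = {}" by blast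
  then show ?thesis by (simp only: finite.emptyI)
qed

lemma countable_G: "countable G"
proof -
  have "A \<in> (\<Union>n::nat. {A \<in> G. norm (framed \<i> A) \<le> real n})" if "A \<in> G" for A
    using that real_arch_simple[of "norm (framed \<i> A)"] by auto
  then have "G \<subseteq> (\<Union>n::nat. {A \<in> G. norm (framed \<i> A) \<le> real n})" by blast
  moreover have "countable (\<Union>n::nat. {A \<in> G. norm (framed \<i> A) \<le> real n})"
    using countable_finite[OF finite_framed_bounded[of \<i>]] by (intro countable_UN) auto
  ultimately show ?thesis by (rule countable_subset)
qed

lemma nontrivial_length2_pos: "A \<in> nontrivial \<Longrightarrow> 0 < Im z \<Longrightarrow> 0 < length2 A z"
proof -
  assume A: "A \<in> nontrivial" and z: "0 < Im z"
  have "traceless (framed z A) \<noteq> 0"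
  proof
    assume "traceless (framed z A) = 0"
    then have "framed z A = framed z (mat 1) \<or> framed z A = framed z (- mat 1)"
      using traceless_eq_0_iff[of "framed z A"] det_framed[OF z] det_G A z
      by (auto simp: nontrivial_def framed_one framed_neg)
    then have "A = mat 1 \<or> A = - mat 1" using inj_framed[OF z] by blast
    then show False using A by (auto simp: nontrivial_def)
  qed
  then show ?thesis by (simp add: length2_eq_norm[OF z])
qed

lemma finite_length2_bounded:
  assumes z: "0 < Im z"
  shows "finite {A \<in> G. length2 A z \<le> R}"
proof (rule finite_subset[OF _ finite_framed_bounded[OF z, of "sqrt (2 + 2 * R)"]])
  show "{A \<in> G. length2 A z \<le> R} \<subseteq> {A \<in> G. norm (framed z A) \<le> sqrt (2 + 2 * R)}"
  proof safe
    fix A assume A: "A \<in> G" "length2 A z \<le> R"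
    then have "(norm (framed z A))\<^sup>2 \<le> 2 + 2 * R"
      using norm_det_1_le[of "framed z A"] det_framed[OF z, of A] det_G length2_eq_norm[OF z, of A] by simp
    then show "norm (framed z A) \<le> sqrt (2 + 2 * R)" by (rule real_le_rsqrt)
  qed
qed

text \<open>
Take \<open>A0\<close> of least length at \<open>z\<close> among the nontrivial elements of length at most \<open>1/8\<close>. Its commutator
with another such element is shorter, hence \<open>\<plusminus>1\<close>, and it is too close to 1 to be \<open>-1\<close>. So all these
elements lie in the centralizer of \<open>A0\<close>, which is commutative.
\<close>

lemma small_elements_commute:
  assumes z: "0 < Im z" and A: "A \<in> G" "length2 A z \<le> 1/64" and B: "B \<in> G" "length2 B z \<le> 1/64"
  shows "A ** B = B ** A"
proof (cases "A \<in> nontrivial")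
  case nontriv: True
  define S where "S = {C \<in> nontrivial. length2 C z \<le> 1/64}"
  have "finite S" unfolding S_def nontrivial_def
    by (rule finite_subset[OF _ finite_length2_bounded[OF z, of "1/64"]]) auto
  moreover have "S \<noteq> {}" using A nontriv by (auto simp: S_def)
  ultimately obtain A0 where A0: "A0 \<in> S" "\<And>C. C \<in> S \<Longrightarrow> length2 A0 z \<le> length2 C z"
    using arg_min_if_finite[of S "\<lambda>C. length2 C z"] that[of "arg_min_on (\<lambda>C. length2 C z) S"]
    by (meson linorder_not_less)
  have A0': "A0 \<in> G" "A0 \<noteq> mat 1" "A0 \<noteq> - mat 1" "length2 A0 z \<le> 1/64" "A0 \<in> nontrivial"
    using A0(1) by (auto simp: S_def nontrivial_def)
  have parallel: "\<exists>\<beta>. traceless C = \<beta> *\<^sub>R traceless A0" if C: "C \<in> G" "length2 C z \<le> 1/64" for C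
  proof (rule commuting_traceless_parallel[OF det_G[OF A0'(1)] _ A0'(2,3)])
    \<comment> \<open>The commutator is shorter than \<open>A0\<close>, so it is \<open>\<plusminus>1\<close> by minimality.\<close>
    define E where "E = A0 ** C ** adjugate A0 ** adjugate C"
    have dA0: "det A0 = 1" and dC: "det C = 1" using det_G A0' C by auto
    let ?P = "framed z A0" and ?Q = "framed z C"
    have P: "norm (traceless ?P) \<le> 1/8" and Q: "norm (traceless ?Q) \<le> 1/8"
      using A0'(4) C(2) le_eighth unfolding length2_eq_norm[OF z] by blast+
    have E: "E \<in> G" unfolding E_def using A0'(1) C(1) by (intro mult_G adjugate_G)
    have fE: "framed z E = ?P ** ?Q ** adjugate ?P ** adjugate ?Q"
      by (simp add: E_def framed_mult[OF z] framed_adjugate[OF z])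
    have near: "norm (framed z E - mat 1) \<le> 17/32 * norm (traceless ?P)"
      unfolding fE using P Q dA0 dC by (intro commutator_near_one) (auto simp: det_framed[OF z])
    have pos: "0 < norm (traceless ?P)"
      using nontrivial_length2_pos[OF A0'(5) z] by (auto simp: length2_eq_norm[OF z])
    have "norm (traceless (framed z E)) < norm (traceless ?P)"
      using near norm_traceless_le[of "framed z E"] pos by linarith
    then have less: "length2 E z < length2 A0 z" unfolding length2_eq_norm[OF z] by (intro power_strict_mono) auto
    then have "E \<notin> S" using A0(2)[of E] by linarith
    then have "E = mat 1 \<or> E = - mat 1" using E less A0'(4) by (auto simp: S_def nontrivial_def)
    moreover have "E \<noteq> - mat 1"
    proof
      assume "E = - mat 1"
      then have "(norm (framed z E - mat 1))\<^sup>2 = 8"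
        using z by (simp add: norm_matrix_2 framed_neg framed_one)
      moreover have "norm (framed z E - mat 1) \<le> 1" using near P by linarith
      then have "(norm (framed z E - mat 1))\<^sup>2 \<le> 1" by (simp add: power_le_one)
      ultimately show False by simp
    qed
    ultimately have "E ** C ** A0 = C ** A0" by simp
    moreover have "E ** C ** A0 = A0 ** C ** (adjugate A0 ** (adjugate C ** C) ** A0)"
      unfolding E_def by (simp only: matrix_mul_assoc)
    then have "E ** C ** A0 = A0 ** C"
      by (simp add: mult_adjugate[OF dA0] mult_adjugate[OF dC])
    ultimately show "A0 ** C = C ** A0" by simp
  qed
  obtain \<alpha> \<beta> where "traceless A = \<alpha> *\<^sub>R traceless A0" "traceless B = \<beta> *\<^sub>R traceless A0"
    using parallel A B by meson
  then show ?thesis by (rule parallel_commute)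
next
  case False
  then have "A = mat 1 \<or> A = - mat 1" using A by (simp add: nontrivial_def)
  then show ?thesis
  proof
    assume "A = - mat 1"
    then show ?thesis by (simp only: matrix_neg_mult_2 matrix_mul_lid matrix_mul_rid)
  qed simp
qed

text \<open>
The bound is uniform in \<open>z\<close>: in the frame at \<open>z\<close>, the elements in question lie in a fixed ball, and
thickness keeps them a fixed distance apart.
\<close>

lemma thick_orbit_count:
  "\<exists>N. \<forall>z\<in>thick. finite {A \<in> G. point_pair z (moebius A z) \<le> 7} \<and> card {A \<in> G. point_pair z (moebius A z) \<le> 7} \<le> N"
proof -
  have "(0::real) < 1/8/3" by simp
  from separated_bounded_card[OF this, of 3]
  obtain N where N: "\<forall>S :: (real^2^2) set. (\<forall>x\<in>S. norm x \<le> 3) \<and>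
      (\<forall>x\<in>S. \<forall>y\<in>S. x \<noteq> y \<longrightarrow> 1/8/3 \<le> dist x y) \<longrightarrow> finite S \<and> card S \<le> N"
    by (rule exE)
  show ?thesis
  proof (intro exI[of _ N] ballI)
    fix z assume th: "z \<in> thick"
    then have z: "0 < Im z" by (simp add: thick_def)
    let ?T = "{A \<in> G. point_pair z (moebius A z) \<le> 7}"
    have b: "norm (framed z A) \<le> 3" if "A \<in> ?T" for A
    proof (rule power2_le_imp_le)
      show "(norm (framed z A))\<^sup>2 \<le> 3\<^sup>2" using that point_pair_moebius_self(2)[OF det_G z, of A] by simp
    qed simp
    have "1/8/3 \<le> dist (framed z A) (framed z B)" if AB: "A \<in> ?T" "B \<in> ?T" "framed z A \<noteq> framed z B" for A B
    proof (rule framed_separated[OF z _ _ b])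
      let ?C = "adjugate A ** B"
      have C: "?C \<in> G" using AB by (intro mult_G adjugate_G) auto
      have C1: "?C \<noteq> mat 1"
        using AB(3) adjugate_mult_eq_one[OF det_G, of A B] AB(1) by blast
      show "1/8 \<le> norm (framed z ?C - mat 1)"
      proof (cases "?C = - mat 1")
        case True
        have "(norm (framed z ?C - mat 1))\<^sup>2 = 8"
          unfolding True using z by (simp add: norm_matrix_2 framed_neg framed_one)
        then show ?thesis by (intro ge_eighth) simp_all
      next
        case False
        then have "1/64 \<le> length2 ?C z" using th C C1 by (auto simp: thick_def nontrivial_def)
        then have "1/8 \<le> norm (traceless (framed z ?C))"
          unfolding length2_eq_norm[OF z] by (intro ge_eighth) simp_all
        then show ?thesis using norm_traceless_le[of "framed z ?C"] by linarith
      qed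
    qed (use AB in auto)
    then have "finite (framed z ` ?T) \<and> card (framed z ` ?T) \<le> N" using b by (intro N[rule_format]) auto
    moreover have "inj_on (framed z) ?T" using inj_framed[OF z] by (auto simp: inj_on_def)
    ultimately show "finite ?T \<and> card ?T \<le> N"
      using card_image[of "framed z" ?T] finite_imageD[of "framed z" ?T] by simp
  qed
qed

end

section \<open>Invariance of hyperbolic area\<close>

text \<open>
The change of variables formula is a statement about \<open>real^2\<close>. The maps \<open>to_complex\<close> and
\<open>of_complex_vec\<close> transport it to the complex plane.
\<close>

definition to_complex :: "real^2 \<Rightarrow> complex" where
  "to_complex v = Complex (v$1) (v$2)"

definition of_complex_vec :: "complex \<Rightarrow> real^2" where
  "of_complex_vec z = vector [Re z, Im z]"

lemma of_complex_vec_nth [simp]: "of_complex_vec z $ 1 = Re z" "of_complex_vec z $ 2 = Im z"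
  by (simp_all add: of_complex_vec_def)

lemma to_of_complex [simp]: "to_complex (of_complex_vec z) = z" "of_complex_vec (to_complex v) = v"
  by (simp_all add: to_complex_def vec_eq_iff forall_2)

lemma Re_Im_to_complex [simp]: "Re (to_complex v) = v$1" "Im (to_complex v) = v$2"
  by (simp_all add: to_complex_def)

lemma bounded_linear_to_complex: "bounded_linear to_complex"
  by (rule linear_conv_bounded_linear[THEN iffD1]) (auto intro!: linearI simp: complex_eq_iff)

lemma bounded_linear_of_complex_vec: "bounded_linear of_complex_vec"
  by (rule linear_conv_bounded_linear[THEN iffD1]) (auto intro!: linearI simp: vec_eq_iff forall_2)

lemma measurable_to_complex [measurable]: "to_complex \<in> borel_measurable borel"
  by (intro borel_measurable_continuous_onI linear_continuous_on bounded_linear_to_complex)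

lemma lborel_complex: "(lborel :: complex measure) = distr lborel borel to_complex"
proof (rule lborel_eqI)
  fix l u :: complex
  have "to_complex -` box l u = box (of_complex_vec l) (of_complex_vec u)"
    by (auto simp: in_box_complex_iff mem_box_cart forall_2)
  then have "emeasure (distr lborel borel to_complex) (box l u) = emeasure lborel (box (of_complex_vec l) (of_complex_vec u))"
    by (subst emeasure_distr) auto
  also assume le: "\<And>b. b \<in> Basis \<Longrightarrow> l \<bullet> b \<le> u \<bullet> b"
  have "Re l \<le> Re u" "Im l \<le> Im u" using le[of 1] le[of \<i>] by (auto simp: Basis_complex_def inner_complex_def)
  then have ne: "cbox (of_complex_vec l) (of_complex_vec u) \<noteq> {}"
    by (auto simp: interval_ne_empty_cart forall_2)
  have "emeasure lborel (box (of_complex_vec l) (of_complex_vec u)) = ennreal (measure lborel (cbox (of_complex_vec l) (of_complex_vec u)))"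
    by (simp add: emeasure_lborel_box_eq emeasure_lborel_cbox_eq measure_def)
  also have "measure lborel (cbox (of_complex_vec l) (of_complex_vec u)) = (\<Prod>b\<in>Basis. (u - l) \<bullet> b)"
    unfolding content_cbox_cart[OF ne] by (simp add: Basis_complex_def inner_complex_def UNIV_2)
  finally show "emeasure (distr lborel borel to_complex) (box l u) = ennreal (\<Prod>b\<in>Basis. (u - l) \<bullet> b)" .
qed simp

lemma hyperbolic_area_eq:
  assumes "E \<in> sets borel" "E \<subseteq> UHP"
  shows "emeasure hyperbolic_area E
    = (\<integral>\<^sup>+v. ennreal (if v \<in> to_complex -` E then 1 / (v$2)\<^sup>2 else 0) \<partial>lborel)"
proof -
  have [measurable]: "UHP \<in> sets borel"
    by (intro borel_open open_halfspace_Im_gt)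
  have [measurable]: "E \<in> sets borel" by fact
  have m: "(\<lambda>\<tau>. ennreal (indicator UHP \<tau> / (Im \<tau>)\<^sup>2)) \<in> borel_measurable lborel" by measurable
  have "emeasure hyperbolic_area E = (\<integral>\<^sup>+\<tau>. ennreal (indicator UHP \<tau> / (Im \<tau>)\<^sup>2) * indicator E \<tau> \<partial>lborel)"
    unfolding hyperbolic_area_def by (rule emeasure_density[OF m]) simp
  also have "\<dots> = (\<integral>\<^sup>+v. ennreal (indicator UHP (to_complex v) / (Im (to_complex v))\<^sup>2) * indicator E (to_complex v) \<partial>lborel)"
    by (subst lborel_complex, subst nn_integral_distr) measurable
  also have "\<dots> = (\<integral>\<^sup>+v. ennreal (if v \<in> to_complex -` E then 1 / (v$2)\<^sup>2 else 0) \<partial>lborel)"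
    using assms(2) by (intro nn_integral_cong) (auto simp: indicator_def)
  finally show ?thesis .
qed

lemma has_field_derivative_moebius:
  assumes "det A = 1" "0 < Im z"
  shows "(moebius A has_field_derivative 1 / (autj A z)\<^sup>2) (at z)"
proof -
  have j: "autj A z \<noteq> 0" by (rule autj_nonzero[OF assms])
  have "((\<lambda>z. (of_real (A$1$1) * z + of_real (A$1$2)) / (of_real (A$2$1) * z + of_real (A$2$2)))
     has_field_derivative
     (of_real (A$1$1) * (of_real (A$2$1) * z + of_real (A$2$2)) - (of_real (A$1$1) * z + of_real (A$1$2)) * of_real (A$2$1))
       / ((of_real (A$2$1) * z + of_real (A$2$2)) * (of_real (A$2$1) * z + of_real (A$2$2)))) (at z)"
    using j unfolding autj_def by (auto intro!: derivative_eq_intros)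
  moreover have "of_real (A$1$1) * (of_real (A$2$1) * z + of_real (A$2$2)) - (of_real (A$1$1) * z + of_real (A$1$2)) * of_real (A$2$1)
     = complex_of_real (det A)"
    by (simp add: det_2 algebra_simps)
  ultimately show ?thesis
    using assms by (simp add: moebius_def[abs_def] autj_def power2_eq_square)
qed

lemma det_complex_mult: "det (matrix (\<lambda>h. of_complex_vec (c * to_complex h))) = (cmod c)\<^sup>2"
proof -
  have "to_complex (axis 1 1) = 1" "to_complex (axis 2 1) = \<i>"
    by (auto simp: complex_eq_iff axis_def)
  then show ?thesis
    unfolding cmod_power2 by (simp add: det_2 matrix_def axis_def power2_eq_square)
qed

lemma borel_moebius_vimage:
  assumes "det A = 1" "E \<in> sets borel" "E \<subseteq> UHP"
  shows "{z \<in> UHP. moebius A z \<in> E} \<in> sets borel"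
proof -
  have U: "UHP \<in> sets borel" by (intro borel_open open_halfspace_Im_gt)
  have "moebius A \<in> borel_measurable (restrict_space borel UHP)"
    by (intro borel_measurable_continuous_on_restrict continuous_on_moebius assms)
  from measurable_sets[OF this assms(2)] have "moebius A -` E \<inter> UHP \<in> sets (restrict_space borel UHP)"
    by (simp add: space_restrict_space)
  then show ?thesis using U by (auto simp: sets_restrict_space_iff Collect_conj_eq vimage_def Int_commute)
qed

lemma moebius_image_eq:
  assumes "det A = 1" "E \<subseteq> UHP"
  shows "moebius A ` E = {z \<in> UHP. moebius (adjugate A) z \<in> E}"
proof safe
  fix z assume "z \<in> E"
  then show "0 < Im (moebius A z)" "moebius (adjugate A) (moebius A z) \<in> E"
    using assms by (auto simp: Im_moebius_pos moebius_adjugate)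
next
  fix z assume "0 < Im z" "moebius (adjugate A) z \<in> E"
  then show "z \<in> moebius A ` E"
    using moebius_adjugate(2)[OF assms(1), of z] by (metis imageI)
qed

text \<open>
The Jacobian determinant \<open>|j|\<^sup>-\<^sup>4\<close> of the Moebius map cancels against the change of the density
\<open>1/y\<^sup>2\<close>.
\<close>

lemma hyperbolic_area_moebius_le:
  assumes A: "det A = 1" and E: "E \<in> sets borel" "E \<subseteq> UHP"
    and fin: "emeasure hyperbolic_area E < \<infinity>"
  shows "emeasure hyperbolic_area (moebius A ` E) \<le> emeasure hyperbolic_area E"
proof -
  let ?S = "to_complex -` E"
  let ?g = "\<lambda>v. of_complex_vec (moebius A (to_complex v))"
  let ?g' = "\<lambda>v h. of_complex_vec (1 / (autj A (to_complex v))\<^sup>2 * to_complex h)"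
  let ?f = "\<lambda>v::real^2. 1 / (v$2)\<^sup>2"
  have S: "?S \<in> sets borel" using measurable_sets[OF measurable_to_complex E(1)] by simp
  have E': "moebius A ` E \<in> sets borel" "moebius A ` E \<subseteq> UHP"
    using borel_moebius_vimage[of "adjugate A" E] A E by (auto simp: moebius_image_eq)
  have gS: "?g ` ?S = to_complex -` (moebius A ` E)"
  proof safe
    fix v assume "to_complex v \<in> E"
    then show "?g v \<in> to_complex -` (moebius A ` E)" by simp
  next
    fix w z assume "z \<in> E" "to_complex w = moebius A z"
    then have "w = ?g (of_complex_vec z)" "of_complex_vec z \<in> ?S" by (simp_all, metis to_of_complex(2))
    then show "w \<in> ?g ` ?S" by blast
  qed
  have der: "(?g has_derivative ?g' v) (at v within ?S)" if "v \<in> ?S" for v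
  proof -
    have z: "0 < Im (to_complex v)" using that E by auto
    have "(to_complex has_derivative to_complex) (at v within ?S)"
      by (rule bounded_linear_imp_has_derivative[OF bounded_linear_to_complex])
    moreover have "(moebius A has_derivative (*) (1 / (autj A (to_complex v))\<^sup>2)) (at (to_complex v))"
      using has_field_derivative_moebius[OF A z] by (simp add: has_field_derivative_def)
    ultimately have "((\<lambda>v. moebius A (to_complex v)) has_derivative (\<lambda>h. 1 / (autj A (to_complex v))\<^sup>2 * to_complex h)) (at v within ?S)"
      using has_derivative_compose by blast
    then show ?thesis by (rule bounded_linear.has_derivative[OF bounded_linear_of_complex_vec])
  qed
  have jac: "\<bar>det (matrix (?g' v))\<bar> * ?f (?g v) = ?f v" if "v \<in> ?S" for v
  proof -
    have z: "0 < Im (to_complex v)" using that E by auto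
    have j: "autj A (to_complex v) \<noteq> 0" by (rule autj_nonzero[OF A z])
    show ?thesis
      unfolding det_complex_mult using j z
      by (simp add: Im_moebius[OF A z] norm_divide norm_power power_divide)
  qed
  obtain r where r: "r \<ge> 0" "emeasure hyperbolic_area E = ennreal r"
    using fin by (cases "emeasure hyperbolic_area E") auto
  have meas: "(\<lambda>v. if v \<in> T then ?f v else 0) \<in> borel_measurable borel" if "T \<in> sets borel" for T
    using that by measurable
  have "((\<lambda>v. if v \<in> ?S then ?f v else 0) has_integral r) UNIV"
  proof (rule nn_integral_has_integral[OF meas[OF S]])
    show "(\<integral>\<^sup>+v. ennreal (if v \<in> ?S then ?f v else 0) \<partial>lborel) = ennreal r"
      using hyperbolic_area_eq[OF E] r(2) by (rule trans[OF sym])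
  qed (use r in auto)
  then have f_int: "(?f has_integral r) ?S" by (simp only: has_integral_restrict_UNIV)
  have "((\<lambda>v. \<bar>det (matrix (?g' v))\<bar> * ?f (?g v)) has_integral r) ?S"
    using f_int by (rule has_integral_eq[rotated]) (simp only: jac)
  then have int: "?f integrable_on (?g ` ?S)" "integral (?g ` ?S) ?f \<le> r"
    using integral_on_image_ubound_nonneg[of ?S ?f ?g ?g'] der
    by (auto simp: has_integral_iff)
  have "((\<lambda>v. if v \<in> to_complex -` (moebius A ` E) then ?f v else 0) has_integral integral (?g ` ?S) ?f) UNIV"
    using int(1) unfolding gS by (simp only: has_integral_restrict_UNIV has_integral_integral)
  moreover have "to_complex -` (moebius A ` E) \<in> sets borel"
    using measurable_sets[OF measurable_to_complex E'(1)] by simp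
  ultimately have "emeasure hyperbolic_area (moebius A ` E) = ennreal (integral (?g ` ?S) ?f)"
    unfolding hyperbolic_area_eq[OF E']
    by (intro nn_integral_has_integral_lborel meas) auto
  then show ?thesis using int(2) r by (simp add: ennreal_leI)
qed

section \<open>Cocompactness of the thick part\<close>

text \<open>
A Euclidean box inside a hyperbolic ball of fixed radius about \<open>z\<close>. Its sides are proportional to
\<open>Im z\<close>, so its hyperbolic area is bounded below uniformly in \<open>z\<close>.
\<close>

definition small_box :: "complex \<Rightarrow> complex set" where
  "small_box z = cbox (Complex (Re z - Im z / 4) (3 * Im z / 4)) (Complex (Re z + Im z / 4) (5 * Im z / 4))"

lemma small_box:
  assumes z: "0 < Im z"
  shows small_box_subset: "small_box z \<subseteq> UHP"
    and small_box_point_pair: "w \<in> small_box z \<Longrightarrow> point_pair z w \<le> 1"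
    and small_box_area: "ennreal (4 / 25) \<le> emeasure hyperbolic_area (small_box z)"
    and small_box_borel: "small_box z \<in> sets borel"
proof -
  show sub: "small_box z \<subseteq> UHP" using z by (auto simp: small_box_def in_cbox_complex_iff)
  show b: "small_box z \<in> sets borel" by (simp add: small_box_def)
  show "point_pair z w \<le> 1" if w: "w \<in> small_box z"
  proof -
    have w': "\<bar>Re (z - w)\<bar> \<le> Im z / 4" "\<bar>Im (z - w)\<bar> \<le> Im z / 4" "3 * Im z / 4 \<le> Im w"
    proof -
      have "Re z - Im z / 4 \<le> Re w" "Re w \<le> Re z + Im z / 4" "3 * Im z / 4 \<le> Im w" "Im w \<le> 5 * Im z / 4"
        using w by (auto simp: small_box_def in_cbox_complex_iff)
      then show "\<bar>Re (z - w)\<bar> \<le> Im z / 4" "\<bar>Im (z - w)\<bar> \<le> Im z / 4" "3 * Im z / 4 \<le> Im w"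
        unfolding abs_le_iff minus_complex.sel by linarith+
    qed
    have "(cmod (z - w))\<^sup>2 \<le> (Im z / 4)\<^sup>2 + (Im z / 4)\<^sup>2"
      unfolding cmod_power2 using power_mono[OF w'(1), of 2] power_mono[OF w'(2), of 2] by simp
    also have "\<dots> \<le> Im z * (3 * Im z / 4)" using z by (simp add: power2_eq_square)
    also have "\<dots> \<le> Im z * Im w" using w'(3) z by (intro mult_left_mono) auto
    finally show ?thesis using z w'(3) by (simp add: point_pair_def divide_le_eq)
  qed
  have [measurable]: "UHP \<in> sets borel" "small_box z \<in> sets borel"
    using b by (auto intro: borel_open open_halfspace_Im_gt)
  have m: "(\<lambda>\<tau>. ennreal (indicator UHP \<tau> / (Im \<tau>)\<^sup>2)) \<in> borel_measurable lborel" by measurable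
  have "ennreal (4 / 25) = ennreal (1 / (5 * Im z / 4)\<^sup>2) * ennreal (Im z / 2 * (Im z / 2))"
    using z by (simp add: ennreal_mult[symmetric] power2_eq_square)
  also have "ennreal (Im z / 2 * (Im z / 2)) = emeasure lborel (small_box z)"
    unfolding small_box_def
    by (subst emeasure_lborel_cbox) (use z in \<open>auto simp: Basis_complex_def inner_complex_def\<close>)
  also have "ennreal (1 / (5 * Im z / 4)\<^sup>2) * emeasure lborel (small_box z)
     = (\<integral>\<^sup>+\<tau>. ennreal (1 / (5 * Im z / 4)\<^sup>2) * indicator (small_box z) \<tau> \<partial>lborel)"
    by (subst nn_integral_cmult_indicator) auto
  also have "\<dots> \<le> (\<integral>\<^sup>+\<tau>. ennreal (indicator UHP \<tau> / (Im \<tau>)\<^sup>2) * indicator (small_box z) \<tau> \<partial>lborel)"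
  proof (intro nn_integral_mono)
    fix \<tau>
    show "ennreal (1 / (5 * Im z / 4)\<^sup>2) * indicator (small_box z) \<tau>
        \<le> ennreal (indicator UHP \<tau> / (Im \<tau>)\<^sup>2) * indicator (small_box z) \<tau>"
    proof (cases "\<tau> \<in> small_box z")
      case True
      then have "0 < Im \<tau>" "Im \<tau> \<le> 5 * Im z / 4" using z by (auto simp: small_box_def in_cbox_complex_iff)
      then have "1 / (5 * Im z / 4)\<^sup>2 \<le> 1 / (Im \<tau>)\<^sup>2"
        by (intro divide_left_mono power_mono) auto
      then show ?thesis using True \<open>0 < Im \<tau>\<close> by (simp add: ennreal_leI)
    qed simp
  qed
  also have "\<dots> = emeasure hyperbolic_area (small_box z)"
    unfolding hyperbolic_area_def by (rule emeasure_density[OF m, symmetric]) simp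
  finally show "ennreal (4 / 25) \<le> emeasure hyperbolic_area (small_box z)" .
qed

text \<open>
Inside the closed upper half-plane the condition \<open>|u - w|\<^sup>2 \<le> 7 Im u Im w\<close> is closed, it excludes the
real line, and it forces \<open>|u - w| \<le> 8 Im w\<close>.
\<close>

lemma compact_point_pair_ball:
  assumes w: "0 < Im w"
  shows "compact {u. 0 < Im u \<and> point_pair u w \<le> 7}"
proof -
  have eq: "{u. 0 < Im u \<and> point_pair u w \<le> 7} = {u. (cmod (u - w))\<^sup>2 \<le> 7 * (Im u * Im w)} \<inter> {u. 0 \<le> Im u}"
  proof safe
    fix u assume u: "0 < Im u" "point_pair u w \<le> 7"
    then show "(cmod (u - w))\<^sup>2 \<le> 7 * (Im u * Im w)" using w by (simp add: point_pair_def divide_le_eq)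
  next
    fix u assume u: "(cmod (u - w))\<^sup>2 \<le> 7 * (Im u * Im w)" "0 \<le> Im u"
    show pos: "0 < Im u"
    proof (rule ccontr)
      assume "\<not> 0 < Im u"
      then have 0: "Im u = 0" using u by simp
      then have "u = w" using u(1) by simp
      then show False using 0 w by simp
    qed
    then show "point_pair u w \<le> 7" using u w by (simp add: point_pair_def divide_le_eq)
  qed (auto simp: less_imp_le)
  have "closed {u. (cmod (u - w))\<^sup>2 \<le> 7 * (Im u * Im w)}"
    by (intro closed_Collect_le continuous_intros)
  moreover have "closed {u. 0 \<le> Im u}" by (rule closed_halfspace_Im_ge)
  ultimately have cl: "closed {u. 0 < Im u \<and> point_pair u w \<le> 7}" unfolding eq by (rule closed_Int)
  have "dist w u \<le> 8 * Im w" if u: "0 < Im u" "point_pair u w \<le> 7" for u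
  proof (rule ccontr)
    let ?t = "cmod (u - w)"
    assume "\<not> dist w u \<le> 8 * Im w"
    then have t: "8 * Im w < ?t" by (simp add: dist_norm norm_minus_commute)
    have "Im u \<le> Im w + ?t" using abs_Im_le_cmod[of "u - w"] by simp
    then have "7 * (Im u * Im w) \<le> 7 * ((Im w + ?t) * Im w)" using w by simp
    moreover have "?t\<^sup>2 \<le> 7 * (Im u * Im w)" using u w by (simp add: point_pair_def divide_le_eq)
    moreover have "7 * ((Im w + ?t) * Im w) \<le> 7 * ((?t / 8 + ?t) * (?t / 8))"
      using t w by (intro mult_left_mono mult_mono add_mono) auto
    moreover have "7 * ((?t / 8 + ?t) * (?t / 8)) = 63 / 64 * ?t\<^sup>2"
      by (simp add: power2_eq_square field_simps)
    ultimately have "?t\<^sup>2 \<le> 63 / 64 * ?t\<^sup>2" by linarith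
    moreover have "?t > 0" using t w by linarith
    then have "?t\<^sup>2 > 0" by (rule zero_less_power)
    ultimately show False by simp
  qed
  then have "bounded {u. 0 < Im u \<and> point_pair u w \<le> 7}"
    unfolding bounded_def by (intro exI[of _ w] exI[of _ "8 * Im w"]) auto
  with cl show ?thesis by (simp add: compact_eq_bounded_closed)
qed

locale cofinite_matrix_group = discrete_matrix_group +
  fixes D :: "complex set"
  assumes D_borel: "D \<in> sets borel" and D_subset: "D \<subseteq> UHP"
    and D_covers: "0 < Im z \<Longrightarrow> \<exists>A\<in>G. moebius A z \<in> D"
    and D_area: "emeasure hyperbolic_area D < \<infinity>"
begin

lemma sets_area: "sets hyperbolic_area = sets borel"
  by (simp add: hyperbolic_area_def)

definition hits :: "complex \<Rightarrow> real^2^2 \<Rightarrow> complex set" where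
  "hits z A = {w \<in> D. moebius (adjugate A) w \<in> small_box z}"

lemma hits_subset: "hits z A \<subseteq> D" "hits z A \<subseteq> UHP"
  using D_subset by (auto simp: hits_def)

lemma hits_borel:
  assumes "A \<in> G" "0 < Im z"
  shows "hits z A \<in> sets borel"
proof -
  have "hits z A = {w \<in> UHP. moebius (adjugate A) w \<in> small_box z} \<inter> D"
    using D_subset by (auto simp: hits_def)
  moreover have "{w \<in> UHP. moebius (adjugate A) w \<in> small_box z} \<in> sets borel"
    using small_box_borel small_box_subset assms(2) det_G[OF assms(1)] by (intro borel_moebius_vimage) auto
  ultimately show ?thesis using D_borel by auto
qed

text \<open>
The translates of \<open>D\<close> cover the box, and each piece can be moved into \<open>D\<close> without losing area.
\<close>

lemma box_area_le_translates:
  assumes z: "0 < Im z"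
  shows "emeasure hyperbolic_area (small_box z)
    \<le> (\<integral>\<^sup>+A. emeasure hyperbolic_area (hits z A) \<partial>count_space G)"
proof -
  let ?S = "\<lambda>A. moebius (adjugate A) ` hits z A"
  have S: "?S A \<in> sets borel" if A: "A \<in> G" for A
  proof -
    have d: "det (adjugate A) = 1" using det_G[OF A] by simp
    show ?thesis
      unfolding moebius_image_eq[OF d hits_subset(2)]
      using borel_moebius_vimage[of "adjugate (adjugate A)", OF _ hits_borel[OF A z] hits_subset(2)] det_G[OF A]
      by simp
  qed
  have "emeasure hyperbolic_area (small_box z) = (\<integral>\<^sup>+u. indicator (small_box z) u \<partial>hyperbolic_area)"
    using small_box_borel[OF z] by (simp add: sets_area)
  also have "\<dots> \<le> (\<integral>\<^sup>+u. (\<integral>\<^sup>+A. indicator (?S A) u \<partial>count_space G) \<partial>hyperbolic_area)"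
  proof (rule nn_integral_mono)
    fix u
    show "indicator (small_box z) u \<le> (\<integral>\<^sup>+A. indicator (?S A) u \<partial>count_space G)"
    proof (cases "u \<in> small_box z")
      case True
      then have u: "0 < Im u" using small_box_subset[OF z] by auto
      obtain A where A: "A \<in> G" "moebius A u \<in> D" using D_covers[OF u] by blast
      have "moebius (adjugate A) (moebius A u) = u" by (rule moebius_adjugate(1)[OF det_G[OF A(1)] u])
      then have "u \<in> ?S A" using A(2) True by (force simp: hits_def)
      then have "indicator (small_box z) u \<le> (indicator (?S A) u :: ennreal)"
        by (simp add: indicator_def)
      also have "\<dots> \<le> (\<integral>\<^sup>+A. indicator (?S A) u \<partial>count_space G)"
        by (rule nn_integral_ge_point[OF A(1)])
      finally show ?thesis .
    qed simp
  qed
  also have "\<dots> = (\<integral>\<^sup>+A. (\<integral>\<^sup>+u. indicator (?S A) u \<partial>hyperbolic_area) \<partial>count_space G)"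
    using S by (intro nn_integral_count_space_nn_integral[OF countable_G] borel_measurable_indicator)
      (simp add: sets_area)
  also have "\<dots> = (\<integral>\<^sup>+A. emeasure hyperbolic_area (?S A) \<partial>count_space G)"
    using S by (intro nn_integral_cong) (simp add: sets_area)
  also have "\<dots> \<le> (\<integral>\<^sup>+A. emeasure hyperbolic_area (hits z A) \<partial>count_space G)"
  proof (rule nn_integral_mono)
    fix A assume "A \<in> space (count_space G)"
    then have A: "A \<in> G" by simp
    have "emeasure hyperbolic_area (hits z A) \<le> emeasure hyperbolic_area D"
      using D_borel hits_subset(1) by (intro emeasure_mono) (simp_all add: sets_area)
    then have "emeasure hyperbolic_area (hits z A) < \<infinity>" using D_area by (rule order_le_less_trans)
    then show "emeasure hyperbolic_area (?S A) \<le> emeasure hyperbolic_area (hits z A)"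
      using det_G[OF A] by (intro hyperbolic_area_moebius_le hits_borel[OF A z] hits_subset(2)) auto
  qed
  finally show ?thesis .
qed

text \<open>
Translates of the boxes about two different points of \<open>Z\<close> are disjoint, since points in a common box
would make \<open>point_pair\<close> at most \<open>(1 + 2)(1 + 2) - 2 = 7\<close>.
\<close>

definition separated :: "complex set \<Rightarrow> bool" where
  "separated Z \<longleftrightarrow> Z \<subseteq> thick \<and>
     (\<forall>z\<in>Z. \<forall>w\<in>Z. \<forall>A\<in>G. z \<noteq> w \<longrightarrow> 7 < point_pair (moebius A z) w)"

text \<open>
Only one point \<open>z\<close> of \<open>Z\<close> has translates of its box through \<open>w\<close>, and quotients of two elements that
carry \<open>w\<close> back into the box move \<open>z\<close> by a bounded amount, so \<open>thick_orbit_count\<close> applies.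
\<close>

lemma separated_translates_overlap:
  assumes N: "\<forall>z\<in>thick. finite {A \<in> G. point_pair z (moebius A z) \<le> 7} \<and> card {A \<in> G. point_pair z (moebius A z) \<le> 7} \<le> N"
    and Z: "finite Z" "separated Z" and w: "0 < Im w"
  shows "(\<Sum>z\<in>Z. \<integral>\<^sup>+A. indicator (hits z A) w \<partial>count_space G)
    \<le> of_nat N * indicator D w"
proof (cases "w \<in> D")
  case wD: True
  let ?T = "\<lambda>z. {A \<in> G. moebius (adjugate A) w \<in> small_box z}"
  have pos: "0 < Im z" if "z \<in> Z" for z using that Z by (auto simp: separated_def thick_def)
  have close: "point_pair (moebius (adjugate B ** A) z) z' \<le> 7"
    if z: "z \<in> Z" "z' \<in> Z" and A: "A \<in> ?T z" and B: "B \<in> ?T z'" for z z' A B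
  proof -
    let ?u = "moebius (adjugate A) w" and ?u' = "moebius (adjugate B) w"
    have d: "det A = 1" "det B = 1" using A B det_G by auto
    have u: "0 < Im ?u" "0 < Im ?u'" using w d by (auto intro!: Im_moebius_pos)
    have C: "det (adjugate B ** A) = 1" using d by (simp add: det_mul)
    have "moebius (adjugate B ** A) ?u = moebius (adjugate B) (moebius A ?u)"
      using d u by (intro moebius_mult) auto
    then have eq: "moebius (adjugate B ** A) ?u = ?u'" using moebius_adjugate(2)[OF d(1) w] by simp
    have "point_pair (moebius (adjugate B ** A) z) ?u' = point_pair z ?u"
      using point_pair_moebius[OF C pos[OF z(1)] u(1)] eq by simp
    then have 1: "point_pair (moebius (adjugate B ** A) z) ?u' \<le> 1"
      using small_box_point_pair[OF pos[OF z(1)]] A by auto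
    have 2: "point_pair ?u' z' \<le> 1" using small_box_point_pair[OF pos[OF z(2)], of ?u'] B point_pair_commute[of ?u' z'] by simp
    have nonneg: "0 \<le> point_pair ?u' z'" using u pos[OF z(2)] by (simp add: point_pair_def)
    have "point_pair (moebius (adjugate B ** A) z) z' + 2
        \<le> (point_pair (moebius (adjugate B ** A) z) ?u' + 2) * (point_pair ?u' z' + 2)"
      by (rule point_pair_triangle[OF Im_moebius_pos[OF C pos[OF z(1)]] u(2) pos[OF z(2)]])
    also have "\<dots> \<le> (1 + 2) * (1 + 2)" using 1 2 nonneg by (intro mult_mono) auto
    finally show ?thesis by simp
  qed
  have unique: "z = z'" if "z \<in> Z" "z' \<in> Z" "A \<in> ?T z" "B \<in> ?T z'" for z z' A B
  proof (rule ccontr)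
    assume "z \<noteq> z'"
    moreover have "adjugate B ** A \<in> G" using that by (auto intro!: mult_G adjugate_G)
    ultimately show False using close[OF that] Z(2) that(1,2) by (fastforce simp: separated_def)
  qed
  have card: "finite (?T z) \<and> card (?T z) \<le> N" if z: "z \<in> Z" for z
  proof (cases "?T z = {}")
    case False
    then obtain B where B: "B \<in> ?T z" by blast
    let ?R = "{A \<in> G. point_pair z (moebius A z) \<le> 7}"
    have R: "finite ?R \<and> card ?R \<le> N" using N Z z by (auto simp: separated_def)
    have inj: "inj_on (\<lambda>A. adjugate B ** A) (?T z)"
    proof (rule inj_onI)
      fix A A' assume "adjugate B ** A = adjugate B ** A'"
      then have "B ** adjugate B ** A = B ** adjugate B ** A'" by (simp only: matrix_mul_assoc[symmetric])
      then show "A = A'" using B det_G by (simp add: mult_adjugate)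
    qed
    have "(\<lambda>A. adjugate B ** A) ` ?T z \<subseteq> ?R"
    proof
      fix C assume "C \<in> (\<lambda>A. adjugate B ** A) ` ?T z"
      then obtain A where A: "A \<in> ?T z" "C = adjugate B ** A" by blast
      then show "C \<in> ?R" using close[OF z z A(1) B] B
        by (auto simp: point_pair_commute intro!: mult_G adjugate_G)
    qed
    then show ?thesis using R inj
      by (meson card_inj_on_le finite_imageD finite_subset order_trans)
  next
    case True
    then show ?thesis by (simp only: card.empty finite.emptyI le0 simp_thms)
  qed
  have val: "(\<integral>\<^sup>+A. indicator (hits z A) w \<partial>count_space G) = of_nat (card (?T z))"
    if z: "z \<in> Z" for z
  proof -
    have "(\<integral>\<^sup>+A. indicator (hits z A) w \<partial>count_space G)
        = (\<integral>\<^sup>+A. indicator (?T z) A \<partial>count_space G)"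
    proof (rule nn_integral_cong)
      fix A assume "A \<in> space (count_space G)"
      then show "indicator (hits z A) w = (indicator (?T z) A :: ennreal)"
        using wD by (simp add: indicator_def hits_def)
    qed
    also have "\<dots> = emeasure (count_space G) (?T z)" by (rule nn_integral_indicator) auto
    also have "\<dots> = of_nat (card (?T z))" using card[OF z] by (intro emeasure_count_space_finite) auto
    finally show ?thesis .
  qed
  have "(\<Sum>z\<in>Z. of_nat (card (?T z)) :: ennreal) \<le> of_nat N"
  proof (cases "\<exists>z0\<in>Z. ?T z0 \<noteq> {}")
    case True
    then obtain z0 where z0: "z0 \<in> Z" "?T z0 \<noteq> {}" by blast
    have "card (?T z) = 0" if "z \<in> Z - {z0}" for z
    proof -
      have "?T z = {}" using unique z0 that by blast
      then show ?thesis by (simp only: card.empty)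
    qed
    then have "(\<Sum>z\<in>Z. of_nat (card (?T z)) :: ennreal) = of_nat (card (?T z0))"
      using sum.remove[OF Z(1) z0(1), of "\<lambda>z. of_nat (card (?T z)) :: ennreal"] by simp
    then show ?thesis using card[OF z0(1)] by simp
  next
    case False
    then have "card (?T z) = 0" if "z \<in> Z" for z
    proof -
      have "?T z = {}" using False that by blast
      then show ?thesis by (simp only: card.empty)
    qed
    then show ?thesis by simp
  qed
  then have "(\<Sum>z\<in>Z. \<integral>\<^sup>+A. indicator (hits z A) w \<partial>count_space G) \<le> of_nat N"
    by (simp only: val cong: sum.cong)
  then show ?thesis using wD by (simp only: indicator_simps mult_1_right)
next
  case False
  then show ?thesis by (simp add: hits_def)
qed

text \<open>
Integrate the overlap bound over \<open>D\<close>: the boxes have total area at least \<open>4/25\<close> times the number of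
points, and at most \<open>N\<close> times the area of \<open>D\<close>.
\<close>

lemma separated_card_bounded: "\<exists>M. \<forall>Z. finite Z \<and> separated Z \<longrightarrow> card Z \<le> M"
proof -
  obtain N where N: "\<forall>z\<in>thick. finite {A \<in> G. point_pair z (moebius A z) \<le> 7} \<and> card {A \<in> G. point_pair z (moebius A z) \<le> 7} \<le> N"
    using thick_orbit_count by (rule exE)
  obtain r where r: "0 \<le> r" "emeasure hyperbolic_area D = ennreal r"
    using D_area by (cases "emeasure hyperbolic_area D") auto
  have "real (card Z) * (4 / 25) \<le> real N * r" if Z: "finite Z" "separated Z" for Z
  proof -
    have pos: "0 < Im z" if "z \<in> Z" for z using that Z by (auto simp: separated_def thick_def)
    have meas: "(\<lambda>w. indicator (hits z A) w :: ennreal) \<in> borel_measurable hyperbolic_area" if "A \<in> G" "z \<in> Z" for z A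
      using hits_borel[OF that(1) pos[OF that(2)]] by (intro borel_measurable_indicator) (simp add: sets_area)
    have "of_nat (card Z) * ennreal (4 / 25) = (\<Sum>z\<in>Z. ennreal (4 / 25))" by simp
    also have "\<dots> \<le> (\<Sum>z\<in>Z. \<integral>\<^sup>+A. emeasure hyperbolic_area (hits z A) \<partial>count_space G)"
      using small_box_area[OF pos] box_area_le_translates[OF pos] by (intro sum_mono) (meson order_trans)
    also have "\<dots> = (\<Sum>z\<in>Z. \<integral>\<^sup>+A. (\<integral>\<^sup>+w. indicator (hits z A) w \<partial>hyperbolic_area) \<partial>count_space G)"
      using hits_borel pos by (intro sum.cong nn_integral_cong refl) (simp add: sets_area)
    also have "\<dots> = (\<integral>\<^sup>+A. (\<Sum>z\<in>Z. \<integral>\<^sup>+w. indicator (hits z A) w \<partial>hyperbolic_area) \<partial>count_space G)"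
      by (rule nn_integral_sum[symmetric]) simp
    also have "\<dots> = (\<integral>\<^sup>+A. (\<integral>\<^sup>+w. (\<Sum>z\<in>Z. indicator (hits z A) w) \<partial>hyperbolic_area) \<partial>count_space G)"
      using meas by (intro nn_integral_cong nn_integral_sum[symmetric]) auto
    also have "\<dots> = (\<integral>\<^sup>+w. (\<integral>\<^sup>+A. (\<Sum>z\<in>Z. indicator (hits z A) w) \<partial>count_space G) \<partial>hyperbolic_area)"
      using meas by (intro nn_integral_count_space_nn_integral[symmetric] countable_G borel_measurable_sum)
    also have "\<dots> = (\<integral>\<^sup>+w. (\<Sum>z\<in>Z. \<integral>\<^sup>+A. indicator (hits z A) w \<partial>count_space G) \<partial>hyperbolic_area)"
      by (intro nn_integral_cong nn_integral_sum) simp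
    also have "\<dots> \<le> (\<integral>\<^sup>+w. of_nat N * indicator D w \<partial>hyperbolic_area)"
    proof (rule nn_integral_mono)
      fix w
      show "(\<Sum>z\<in>Z. \<integral>\<^sup>+A. indicator (hits z A) w \<partial>count_space G) \<le> of_nat N * indicator D w"
      proof (cases "0 < Im w")
        case True
        then show ?thesis by (rule separated_translates_overlap[OF N Z])
      next
        case False
        then have "w \<notin> D" using D_subset by auto
        then show ?thesis by (simp add: hits_def)
      qed
    qed
    also have "\<dots> = of_nat N * ennreal r"
      using D_borel by (simp add: nn_integral_cmult_indicator sets_area r(2))
    finally have "ennreal (real (card Z) * (4 / 25)) \<le> ennreal (real N * r)"
      using r(1) by (simp only: ennreal_mult[symmetric] ennreal_of_nat_eq_real_of_nat of_nat_0_le_iff)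
    then show ?thesis using r(1) by (simp add: ennreal_le_iff)
  qed
  then have "card Z \<le> nat \<lceil>real N * r * 25 / 4\<rceil>" if "finite Z" "separated Z" for Z
    using that by (force simp: le_nat_iff le_ceiling_iff intro: order_trans[OF _ le_of_int_ceiling])
  then show ?thesis by blast
qed

text \<open>
Every thick point has a translate close to a point of a separated set of maximal size.
\<close>

lemma thick_cocompact:
  "\<exists>C. compact C \<and> C \<subseteq> UHP \<and> (\<forall>z\<in>thick. \<exists>A\<in>G. moebius A z \<in> C)"
proof -
  obtain M where M: "\<And>Z. finite Z \<Longrightarrow> separated Z \<Longrightarrow> card Z \<le> M"
    using separated_card_bounded by blast
  have "\<exists>Z. (finite Z \<and> separated Z) \<and> (\<forall>Z'. finite Z' \<and> separated Z' \<longrightarrow> card Z' \<le> card Z)"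
  proof (rule ex_has_greatest_nat)
    show "finite {} \<and> separated {}" by (simp add: separated_def)
    show "\<forall>Z. finite Z \<and> separated Z \<longrightarrow> card Z < Suc M" using M by (simp add: less_Suc_eq_le)
  qed
  then obtain Z where Z: "finite Z" "separated Z"
    and max: "\<And>Z'. finite Z' \<Longrightarrow> separated Z' \<Longrightarrow> card Z' \<le> card Z"
    by blast
  have posZ: "0 < Im w" if "w \<in> Z" for w using that Z by (auto simp: separated_def thick_def)
  let ?C = "\<Union>w\<in>Z. {u. 0 < Im u \<and> point_pair u w \<le> 7}"
  have "\<exists>A\<in>G. moebius A z \<in> ?C" if z: "z \<in> thick" for z
  proof (rule ccontr)
    assume no: "\<not> (\<exists>A\<in>G. moebius A z \<in> ?C)"
    have pz: "0 < Im z" using z by (simp add: thick_def)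
    have far: "7 < point_pair (moebius A z) w" if "A \<in> G" "w \<in> Z" for A w
      using no that Im_moebius_pos[OF det_G[OF that(1)] pz] by force
    have far': "7 < point_pair (moebius A w) z" if A: "A \<in> G" and w: "w \<in> Z" for A w
    proof -
      have "point_pair (moebius A w) z = point_pair (moebius (adjugate A) (moebius A w)) (moebius (adjugate A) z)"
        using det_G[OF A] pz posZ[OF w] by (intro point_pair_moebius[symmetric] Im_moebius_pos) auto
      also have "\<dots> = point_pair (moebius (adjugate A) z) w"
        using moebius_adjugate(1)[OF det_G[OF A] posZ[OF w]] by (simp add: point_pair_commute)
      finally show ?thesis using far[OF adjugate_G[OF A] w] by simp
    qed
    have "z \<notin> Z"
    proof
      assume "z \<in> Z"
      from far[OF one_G this] show False by (simp add: point_pair_def)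
    qed
    moreover have "separated (insert z Z)"
      using Z(2) z far far' by (auto simp: separated_def)
    ultimately show False using max[of "insert z Z"] Z(1) by simp
  qed
  moreover have "compact ?C" using Z(1) compact_point_pair_ball posZ by (intro compact_UN) auto
  moreover have "?C \<subseteq> UHP" by auto
  ultimately show ?thesis by blast
qed

end

section \<open>Translations, elliptic elements and fixed points\<close>

lemma continuous_on_length2: "continuous_on UHP (length2 A)"
  unfolding length2_def[abs_def] by (intro continuous_intros) auto

lemma translation_nth [simp]:
  "translation x $ 1 $ 1 = 1" "translation x $ 1 $ 2 = x"
  "translation x $ 2 $ 1 = 0" "translation x $ 2 $ 2 = 1"
  by (simp_all add: translation_def)

lemma translation_mult: "translation x ** translation y = translation (x + y)"
  by (simp add: matrix_eq_2 matrix_mult_nth)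

lemma adjugate_translation: "adjugate (translation x) = translation (- x)"
  by (simp add: matrix_eq_2)

lemma moebius_translation: "moebius (translation x) z = z + of_real x"
  by (simp add: moebius_def)

lemma det_translation [simp]: "det (translation x) = 1"
  by (simp add: det_2)

lemma length2_translation: "length2 (translation x) z = (x / Im z)\<^sup>2"
  by (simp add: length2_def power2_eq_square)

lemma length2_neg: "length2 (- A) z = length2 A z"
proof -
  have "traceless (- A) = (-1) *\<^sub>R traceless A"
    by (simp add: matrix_eq_2 diff_divide_distrib)
  from length2_parallel[OF this, of z] show ?thesis by simp
qed

text \<open>
The group generated by \<open>translation l\<close> and \<open>-1\<close> (\<open>generate_translation\<close>), with its elements listed.
\<close>

definition translation_group :: "real \<Rightarrow> (real^2^2) set" where
  "translation_group l = {B. \<exists>n::int. B = translation (of_int n * l) \<or> B = - translation (of_int n * l)}"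

lemma translation_group_subset:
  assumes T: "translation l \<in> H" and one: "mat 1 \<in> H"
    and mult: "\<And>B C. B \<in> H \<Longrightarrow> C \<in> H \<Longrightarrow> B ** C \<in> H"
    and adj: "\<And>B. B \<in> H \<Longrightarrow> adjugate B \<in> H" and neg: "\<And>B. B \<in> H \<Longrightarrow> - B \<in> H"
  shows "translation_group l \<subseteq> H"
proof -
  have nat: "translation (real n * l) \<in> H" for n
  proof (induction n)
    case 0
    have "translation 0 = mat 1" by (simp add: matrix_eq_2)
    then show ?case using one by simp
  next
    case (Suc n)
    then show ?case using mult[OF Suc T] by (simp add: translation_mult algebra_simps)
  qed
  have "translation (of_int n * l) \<in> H" for n :: int
  proof (cases "n \<ge> 0")
    case True
    then show ?thesis using nat[of "nat n"] by simp
  next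
    case False
    then show ?thesis using adj[OF nat[of "nat (- n)"]] by (simp add: adjugate_translation)
  qed
  then show ?thesis using neg unfolding translation_group_def by blast
qed

lemma length2_one: "length2 (mat 1) z = 0"
  by (simp add: length2_def)

text \<open>
A negative discriminant means that \<open>A\<close> is elliptic. The region is then a hyperbolic disc about the
fixed point; completing the square in the defining inequality bounds it and keeps it away from the
real line.
\<close>

lemma elliptic_sublevel_compact:
  assumes neg: "(A$2$2 - A$1$1)\<^sup>2 + 4 * A$1$2 * A$2$1 < 0"
  shows "\<exists>C. compact C \<and> C \<subseteq> UHP \<and> (\<forall>z. 0 < Im z \<longrightarrow> length2 A z \<le> 1/64 \<longrightarrow> z \<in> C)"
proof -
  define c where "c = A$2$1"
  define e where "e = (A$2$2 - A$1$1) / (2 * c)"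
  define \<Delta> where "\<Delta> = (A$2$2 - A$1$1)\<^sup>2 + 4 * A$1$2 * A$2$1"
  define h where "h = - \<Delta> / (4 * c\<^sup>2)"
  define r where "r = sqrt (1/64 - \<Delta> / 2) / \<bar>c\<bar>"
  have c: "c \<noteq> 0"
  proof
    assume "c = 0"
    then have "\<Delta> = (A$2$2 - A$1$1)\<^sup>2" by (simp add: \<Delta>_def c_def)
    then show False using neg unfolding \<Delta>_def[symmetric] by (simp add: not_less[symmetric])
  qed
  have \<Delta>: "\<Delta> < 0" using neg by (simp add: \<Delta>_def)
  have h: "h > 0" using \<Delta> c by (simp add: h_def divide_neg_pos)
  have r: "r > 0" using \<Delta> c by (simp add: r_def)
  have "z \<in> cbox (Complex (- e - r) (h / r)) (Complex (- e + r) r)"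
    if z: "0 < Im z" and mu: "length2 A z \<le> 1/64" for z
  proof -
    let ?x = "Re z" and ?y = "Im z"
    let ?N = "A$2$1 * (cmod z)\<^sup>2 + (A$2$2 - A$1$1) * Re z - A$1$2"
    have "(A$2$2 - A$1$1) = 2 * c * e" using c by (simp add: e_def)
    moreover have "A$1$2 = - c * (e\<^sup>2 + h)"
      using c by (simp add: h_def e_def \<Delta>_def c_def field_simps power2_eq_square)
    ultimately have N: "?N = c * ((?x + e)\<^sup>2 + ?y\<^sup>2 + h)"
      unfolding cmod_power2 by (simp add: c_def power2_eq_square algebra_simps)
    have "(?N / ?y)\<^sup>2 \<le> 1/64 - \<Delta> / 2" using mu unfolding length2_def \<Delta>_def by linarith
    then have "\<bar>?N / ?y\<bar> \<le> sqrt (1/64 - \<Delta> / 2)" by (metis real_sqrt_abs real_sqrt_le_mono)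
    moreover have "\<bar>?N / ?y\<bar> = \<bar>c\<bar> * (((?x + e)\<^sup>2 + ?y\<^sup>2 + h) / ?y)"
      using z h unfolding N by (simp add: abs_mult abs_of_nonneg)
    moreover have "sqrt (1/64 - \<Delta> / 2) = \<bar>c\<bar> * r" using c by (simp add: r_def)
    ultimately have "\<bar>c\<bar> * (((?x + e)\<^sup>2 + ?y\<^sup>2 + h) / ?y) \<le> \<bar>c\<bar> * r" by linarith
    moreover have "0 < \<bar>c\<bar>" using c by simp
    ultimately have "((?x + e)\<^sup>2 + ?y\<^sup>2 + h) / ?y \<le> r" by (simp only: mult_le_cancel_left_pos)
    then have main: "(?x + e)\<^sup>2 + ?y\<^sup>2 + h \<le> r * ?y" using z by (simp only: pos_divide_le_eq)
    have "?y\<^sup>2 \<le> r * ?y" using main h zero_le_power2[of "?x + e"] by linarith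
    then have y1: "?y \<le> r" using z by (simp add: power2_eq_square)
    have "h \<le> r * ?y" using main zero_le_power2[of "?x + e"] zero_le_power2[of ?y] by linarith
    then have y2: "h / r \<le> ?y" using r by (simp add: pos_divide_le_eq mult.commute)
    have "r * ?y \<le> r\<^sup>2" using y1 r by (simp add: power2_eq_square)
    then have "(?x + e)\<^sup>2 \<le> r\<^sup>2" using main h zero_le_power2[of ?y] by linarith
    then have "\<bar>?x + e\<bar> \<le> r" using r by (simp add: abs_le_square_iff[symmetric])
    then show ?thesis using y1 y2 by (auto simp: in_cbox_complex_iff)
  qed
  moreover have "cbox (Complex (- e - r) (h / r)) (Complex (- e + r) r) \<subseteq> UHP"
    using h r by (auto simp: in_cbox_complex_iff) (meson divide_pos_pos order_less_le_trans)
  ultimately show ?thesis by (intro exI[of _ "cbox (Complex (- e - r) (h / r)) (Complex (- e + r) r)"]) auto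
qed

text \<open>
The fixed points of \<open>A\<close> are the roots of a quadratic polynomial with this discriminant; a real one
(or \<open>\<infinity>\<close>, if the lower left entry is 0) is carried to \<open>\<infinity>\<close>.
\<close>

lemma real_fixed_point_conjugate:
  assumes "(A$2$2 - A$1$1)\<^sup>2 + 4 * A$1$2 * A$2$1 \<ge> 0"
  shows "\<exists>\<sigma>. det \<sigma> = 1 \<and> (adjugate \<sigma> ** A ** \<sigma>)$2$1 = 0"
proof (cases "A$2$1 = 0")
  case True
  then show ?thesis by (intro exI[of _ "mat 1"]) (simp add: matrix_mult_nth)
next
  case False
  define \<Delta> where "\<Delta> = (A$2$2 - A$1$1)\<^sup>2 + 4 * A$1$2 * A$2$1"
  define s where "s = (A$1$1 - A$2$2 + sqrt \<Delta>) / (2 * A$2$1)"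
  have "2 * A$2$1 * s + (A$2$2 - A$1$1) = sqrt \<Delta>" using False by (simp add: s_def)
  then have "(2 * A$2$1 * s + (A$2$2 - A$1$1))\<^sup>2 = \<Delta>" using assms by (simp add: \<Delta>_def)
  then have "4 * A$2$1 * (A$2$1 * s\<^sup>2 + (A$2$2 - A$1$1) * s - A$1$2) = 0"
    by (simp add: \<Delta>_def power2_eq_square algebra_simps)
  then have root: "A$2$1 * s\<^sup>2 + (A$2$2 - A$1$1) * s - A$1$2 = 0" using False by simp
  \<comment> \<open>This matrix carries \<open>\<infinity>\<close> to \<open>s\<close>.\<close>
  show ?thesis
  proof (intro exI[of _ "matrix2 s (-1) 1 0"] conjI)
    show "det (matrix2 s (-1) 1 0) = 1" by (simp add: det_2)
    show "(adjugate (matrix2 s (-1) 1 0) ** A ** matrix2 s (-1) 1 0)$2$1 = 0"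
      using root by (simp add: matrix_mult_nth power2_eq_square algebra_simps)
  qed
qed

lemma power_interval:
  fixes p y :: real
  assumes p: "p > 1" and y: "y \<ge> 1"
  shows "\<exists>n. p ^ n \<le> y \<and> y < p ^ Suc n"
proof -
  define N where "N = (LEAST n. y < p ^ n)"
  have N: "y < p ^ N" unfolding N_def using real_arch_pow[OF p, of y] by (rule LeastI_ex)
  then obtain n where n: "N = Suc n" using y by (cases N) auto
  have "\<not> y < p ^ n" using not_less_Least[of n "\<lambda>n. y < p ^ n"] n by (simp add: N_def)
  then show ?thesis using N n by (intro exI[of _ n]) auto
qed

section \<open>A maximum principle for automorphic functions\<close>

text \<open>
The properties of \<open>|f|\<^sup>2 / y\<^sup>m\<close> that force it to vanish. In the last one, the condition on \<open>\<sigma>\<close> and \<open>l\<close>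
says that \<open>\<sigma>\<infinity>\<close> is a cusp of width \<open>l\<close>.
\<close>

locale automorphic_modulus = cofinite_matrix_group +
  fixes \<phi> :: "complex \<Rightarrow> real"
  assumes \<phi>_continuous: "continuous_on UHP \<phi>"
    and \<phi>_invariant: "A \<in> G \<Longrightarrow> 0 < Im z \<Longrightarrow> \<phi> (moebius A z) = \<phi> z"
    and \<phi>_no_max: "0 < Im z \<Longrightarrow> 0 < \<phi> z \<Longrightarrow> 0 < e \<Longrightarrow> \<exists>w\<in>ball z e. 0 < Im w \<and> \<phi> z < \<phi> w"
    and \<phi>_cusp: "det \<sigma> = 1 \<Longrightarrow> 0 < l \<Longrightarrow>
      (\<And>B. B$2$1 = 0 \<Longrightarrow> \<sigma> ** B ** adjugate \<sigma> \<in> G \<longleftrightarrow>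
        B \<in> translation_group l) \<Longrightarrow>
      0 < \<eta> \<Longrightarrow> \<exists>y0. \<forall>w. 0 < Im w \<longrightarrow> y0 \<le> Im w \<longrightarrow> \<phi> (moebius \<sigma> w) < \<eta>"
begin

text \<open>
An element that is shorter than \<open>1/8\<close> at \<open>z\<close> would commute with \<open>A\<close>, hence be shorter than \<open>A\<close> at
\<open>z0\<close> as well.
\<close>

lemma thick_boundary:
  assumes A: "A \<in> nontrivial" and z0: "0 < Im z0"
    and min: "\<And>B. B \<in> nontrivial \<Longrightarrow> length2 A z0 \<le> length2 B z0"
    and z: "0 < Im z" "length2 A z = 1/64"
  shows "z \<in> thick"
proof (rule ccontr)
  assume "z \<notin> thick"
  then obtain B where B: "B \<in> nontrivial" "length2 B z < 1/64" using z by (force simp: thick_def)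
  have AB: "A \<in> G" "A \<noteq> mat 1" "A \<noteq> - mat 1" "B \<in> G" using A B by (auto simp: nontrivial_def)
  have "A ** B = B ** A"
    by (rule small_elements_commute[OF z(1) AB(1) _ AB(4)]) (use z B in auto)
  then obtain \<beta> where \<beta>: "traceless B = \<beta> *\<^sub>R traceless A"
    using commuting_traceless_parallel[OF det_G[OF AB(1)] _ AB(2,3)] by blast
  have "\<beta>\<^sup>2 < 1" using length2_parallel[OF \<beta>, of z] B(2) z(2) by simp
  then have "length2 B z0 < length2 A z0"
    using length2_parallel[OF \<beta>, of z0] nontrivial_length2_pos[OF A z0] by simp
  then show False using min[OF B(1)] by simp
qed

text \<open>
If all large values of \<open>\<phi>\<close> on the region where \<open>A\<close> is short occur in one compact set, then \<open>\<phi>\<close> attains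
its maximum over that region. The maximum is not interior, hence it is at a point of the boundary,
which is thick.
\<close>

lemma thick_point_above:
  assumes A: "A \<in> nontrivial" and z0: "0 < Im z0" "0 < \<phi> z0" "length2 A z0 < 1/64"
    and min: "\<And>B. B \<in> nontrivial \<Longrightarrow> length2 A z0 \<le> length2 B z0"
    and C: "compact C" "C \<subseteq> UHP"
    and rep: "\<And>z. 0 < Im z \<Longrightarrow> length2 A z \<le> 1/64 \<Longrightarrow> \<phi> z0 \<le> \<phi> z
      \<Longrightarrow> \<exists>z'\<in>C. length2 A z' \<le> 1/64 \<and> \<phi> z' = \<phi> z"
  shows "\<exists>w\<in>thick. \<phi> z0 \<le> \<phi> w"
proof -
  define S where "S = {z \<in> C. length2 A z \<le> 1/64}"
  have "closedin (top_of_set C) (C \<inter> length2 A -` {..1/64})"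
    by (rule continuous_closedin_preimage[OF continuous_on_subset[OF continuous_on_length2 C(2)] closed_atMost])
  moreover have "S = C \<inter> length2 A -` {..1/64}" by (auto simp: S_def)
  ultimately have "compact S" using closedin_compact[OF C(1)] by simp
  moreover
  obtain z0' where z0': "z0' \<in> C" "length2 A z0' \<le> 1/64" "\<phi> z0' = \<phi> z0"
    using rep[OF z0(1) less_imp_le[OF z0(3)] order_refl] by blast
  then have S0: "z0' \<in> S" by (simp add: S_def)
  then have "S \<noteq> {}" by blast
  moreover have "continuous_on S \<phi>"
    using \<phi>_continuous by (rule continuous_on_subset) (use C in \<open>auto simp: S_def\<close>)
  ultimately obtain z1 where z1: "z1 \<in> S" "\<And>z. z \<in> S \<Longrightarrow> \<phi> z \<le> \<phi> z1"
    using continuous_attains_sup[of S \<phi>] by blast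
  have p1: "0 < Im z1" and mu1: "length2 A z1 \<le> 1/64" using z1(1) C by (auto simp: S_def)
  have max: "\<phi> z \<le> \<phi> z1" if z: "0 < Im z" "length2 A z \<le> 1/64" for z
  proof (cases "\<phi> z0 \<le> \<phi> z")
    case True
    obtain z' where "z' \<in> C" "length2 A z' \<le> 1/64" "\<phi> z' = \<phi> z" using rep[OF z True] by blast
    then show ?thesis using z1(2)[of z'] by (simp add: S_def)
  next
    case False
    then show ?thesis using z1(2)[OF S0] z0'(3) by linarith
  qed
  have ge: "\<phi> z0 \<le> \<phi> z1" using max z0 by simp
  have "length2 A z1 = 1/64"
  proof (rule ccontr)
    assume "length2 A z1 \<noteq> 1/64"
    then have "length2 A z1 < 1/64" using mu1 by simp
    then have "z1 \<in> UHP \<inter> length2 A -` {..<1/64}" using p1 by simp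
    moreover have "open (UHP \<inter> length2 A -` {..<1/64})"
      by (rule continuous_open_preimage[OF continuous_on_length2 open_halfspace_Im_gt open_lessThan])
    ultimately obtain e where e: "e > 0" "ball z1 e \<subseteq> UHP \<inter> length2 A -` {..<1/64}"
      using open_contains_ball by blast
    obtain w where "w \<in> ball z1 e" "\<phi> z1 < \<phi> w"
      using \<phi>_no_max[OF p1 _ e(1)] ge z0 by force
    then show False using e(2) max[of w] by force
  qed
  then have "z1 \<in> thick" using thick_boundary[OF A z0(1) min p1] by blast
  then show ?thesis using ge by blast
qed

context
  fixes \<sigma> :: "real^2^2"
  assumes det_\<sigma>: "det \<sigma> = 1"
begin

text \<open>
\<open>\<sigma>\<^sup>-\<^sup>1 G \<sigma>\<close>, for a \<open>\<sigma>\<close> that carries \<open>\<infinity>\<close> to a fixed point of interest.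
\<close>

definition conj_group :: "(real^2^2) set" where
  "conj_group = {B. \<sigma> ** B ** adjugate \<sigma> \<in> G}"

lemma conj_group_mult: "B \<in> conj_group \<Longrightarrow> C \<in> conj_group \<Longrightarrow> B ** C \<in> conj_group"
proof -
  assume "B \<in> conj_group" "C \<in> conj_group"
  then have "(\<sigma> ** B ** adjugate \<sigma>) ** (\<sigma> ** C ** adjugate \<sigma>) \<in> G"
    by (auto simp: conj_group_def intro: mult_G)
  moreover have "(\<sigma> ** B ** adjugate \<sigma>) ** (\<sigma> ** C ** adjugate \<sigma>)
      = \<sigma> ** B ** (adjugate \<sigma> ** \<sigma>) ** C ** adjugate \<sigma>" by (simp only: matrix_mul_assoc)
  ultimately show ?thesis by (simp add: conj_group_def mult_adjugate[OF det_\<sigma>] matrix_mul_assoc)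
qed

lemma conj_group_adjugate: "B \<in> conj_group \<Longrightarrow> adjugate B \<in> conj_group"
  using adjugate_G[of "\<sigma> ** B ** adjugate \<sigma>"]
  by (simp add: conj_group_def adjugate_mult matrix_mul_assoc)

lemma conj_group_neg: "B \<in> conj_group \<Longrightarrow> - B \<in> conj_group"
  using neg_G[of "\<sigma> ** B ** adjugate \<sigma>"]
  by (simp add: conj_group_def matrix_neg_mult_2)

lemma conj_group_one: "mat 1 \<in> conj_group"
  using one_G by (simp add: conj_group_def mult_adjugate[OF det_\<sigma>])

lemma conj_group_det: "B \<in> conj_group \<Longrightarrow> det B = 1"
  using det_G[of "\<sigma> ** B ** adjugate \<sigma>"] det_\<sigma> by (simp add: conj_group_def det_mul)

lemma conj_group_act:
  assumes "B \<in> conj_group" "0 < Im w"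
  shows "moebius (\<sigma> ** B ** adjugate \<sigma>) (moebius \<sigma> w) = moebius \<sigma> (moebius B w)"
  using assms conj_group_det[OF assms(1)] det_\<sigma>
  by (simp add: moebius_mult Im_moebius_pos det_mul moebius_adjugate)

lemma \<phi>_conj_group:
  assumes "B \<in> conj_group" "0 < Im w"
  shows "\<phi> (moebius \<sigma> (moebius B w)) = \<phi> (moebius \<sigma> w)"
  using \<phi>_invariant[of "\<sigma> ** B ** adjugate \<sigma>" "moebius \<sigma> w"] assms conj_group_act[OF assms]
    Im_moebius_pos[OF det_\<sigma> assms(2)] by (simp add: conj_group_def)

lemma conj_group_length2:
  assumes "B \<in> conj_group" "0 < Im w"
  shows "length2 (\<sigma> ** B ** adjugate \<sigma>) (moebius \<sigma> w) = length2 B w"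
  by (rule length2_conj[OF conj_group_det[OF assms(1)] det_\<sigma> assms(2)])

lemma compact_image_\<sigma>:
  assumes "compact C" "C \<subseteq> UHP"
  shows "compact (moebius \<sigma> ` C)" "moebius \<sigma> ` C \<subseteq> UHP"
proof -
  show "compact (moebius \<sigma> ` C)"
    by (intro compact_continuous_image continuous_on_subset[OF continuous_on_moebius[OF det_\<sigma>]] assms)
  show "moebius \<sigma> ` C \<subseteq> UHP" using assms(2) Im_moebius_pos[OF det_\<sigma>] by auto
qed

text \<open>
\<open>B\<close> fixes \<open>\<infinity>\<close> and a real point \<open>x0\<close>, and it acts as \<open>w \<mapsto> x0 + a\<^sup>2 (w - x0)\<close> with \<open>a\<^sup>2 \<noteq> 1\<close>. The region
where it is short is a sector with apex \<open>x0\<close>. Powers of \<open>B\<close> act on it by scaling and bring the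
imaginary part into a compact interval.
\<close>

lemma hyperbolic_representatives:
  assumes B: "B \<in> conj_group" "B$2$1 = 0" "B$1$1 \<noteq> B$2$2"
  shows "\<exists>C. compact C \<and> C \<subseteq> UHP \<and> (\<forall>w. 0 < Im w \<longrightarrow> length2 B w \<le> 1/64 \<longrightarrow>
    (\<exists>w'\<in>C. length2 B w' \<le> 1/64 \<and> \<phi> (moebius \<sigma> w') = \<phi> (moebius \<sigma> w)))"
proof -
  define a where "a = B$1$1"
  define d where "d = B$2$2 - B$1$1"
  define x0 where "x0 = B$1$2 / d"
  have ad: "a * B$2$2 = 1" using conj_group_det[OF B(1)] B(2) by (simp add: det_2 a_def)
  have d: "d \<noteq> 0" and a: "a \<noteq> 0" using B(3) ad by (auto simp: d_def)
  have q: "a\<^sup>2 > 0" "a\<^sup>2 \<noteq> 1"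
  proof -
    show "a\<^sup>2 > 0" using a by simp
    have "a * d = 1 - a\<^sup>2" using ad by (simp add: d_def a_def power2_eq_square algebra_simps)
    then show "a\<^sup>2 \<noteq> 1" using a d by auto
  qed
  let ?s = "\<lambda>t w. of_real x0 + of_real t * (w - of_real x0)"
  have Im_s: "Im (?s t w) = t * Im w" and Re_s: "Re (?s t w) = x0 + t * (Re w - x0)" for t w by auto
  have act: "moebius B w = ?s (a\<^sup>2) w" for w
  proof -
    have B22: "B$2$2 = 1 / a" using ad a by (simp add: field_simps)
    have "x0 * (1 - a\<^sup>2) = a * B$1$2"
    proof -
      have "1 - a\<^sup>2 = a * d" using ad by (simp add: d_def a_def power2_eq_square algebra_simps)
      then show ?thesis using d by (simp add: x0_def)
    qed
    then have x0: "of_real (a * B$1$2) = complex_of_real (x0 * (1 - a\<^sup>2))" by simp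
    have "moebius B w = of_real (a\<^sup>2) * w + of_real (a * B$1$2)"
      using a by (simp add: moebius_def B(2) B22 a_def[symmetric] field_simps power2_eq_square)
    then show ?thesis unfolding x0 by (simp add: algebra_simps)
  qed
  have mu_eq: "length2 B w = (d * (Re w - x0) / Im w)\<^sup>2 + d\<^sup>2 / 2" for w
  proof -
    have "B$1$2 = d * x0" using d by (simp add: x0_def)
    then show ?thesis by (simp add: length2_def B(2) d_def[symmetric] algebra_simps)
  qed
  \<comment> \<open>The factors of the homotheties about \<open>x0\<close> that preserve \<open>\<phi>\<close>; they form a multiplicative group.\<close>
  define M where "M = {t. 0 < t \<and> (\<forall>w. 0 < Im w \<longrightarrow> \<phi> (moebius \<sigma> (?s t w)) = \<phi> (moebius \<sigma> w))}"
  have M_mult: "t * u \<in> M" if t: "t \<in> M" and u: "u \<in> M" for t u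
  proof -
    have "\<phi> (moebius \<sigma> (?s (t * u) w)) = \<phi> (moebius \<sigma> w)" if w: "0 < Im w" for w
    proof -
      have "0 < Im (?s u w)" using u w by (simp add: M_def)
      then have "\<phi> (moebius \<sigma> (?s t (?s u w))) = \<phi> (moebius \<sigma> (?s u w))" using t unfolding M_def by blast
      moreover have "?s t (?s u w) = ?s (t * u) w" by simp
      ultimately show ?thesis using u w unfolding M_def by (simp only: mem_Collect_eq)
    qed
    then show ?thesis using t u unfolding M_def by simp
  qed
  have M_inv: "1 / t \<in> M" if t: "t \<in> M" for t
  proof -
    have t0: "0 < t" using t by (simp add: M_def)
    have "\<phi> (moebius \<sigma> (?s (1 / t) w)) = \<phi> (moebius \<sigma> w)" if w: "0 < Im w" for w
    proof -
      have v: "0 < Im (?s (1 / t) w)" using t0 w by simp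
      then have "\<phi> (moebius \<sigma> (?s t (?s (1 / t) w))) = \<phi> (moebius \<sigma> (?s (1 / t) w))" using t unfolding M_def by blast
      moreover have "?s t (?s (1 / t) w) = w" using t0 by simp
      ultimately show ?thesis by (simp only:)
    qed
    then show ?thesis using t0 unfolding M_def by simp
  qed
  have M_pow: "t ^ n \<in> M" if "t \<in> M" for t n
  proof (induction n)
    case 0
    show ?case by (simp add: M_def)
  next
    case (Suc n)
    then show ?case using M_mult[OF that] by simp
  qed
  have q_M: "a\<^sup>2 \<in> M" using \<phi>_conj_group[OF B(1)] q(1) unfolding M_def act by blast
  \<comment> \<open>Both \<open>a\<^sup>2\<close> and its inverse are available, and one of them exceeds 1.\<close>
  define p where "p = max (a\<^sup>2) (1 / a\<^sup>2)"
  have p: "p > 1"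
  proof (cases "a\<^sup>2 < 1")
    case True
    then have "1 < 1 / a\<^sup>2" using q(1) by simp
    then show ?thesis by (simp add: p_def)
  next
    case False
    then have "1 < a\<^sup>2" using q(2) by linarith
    then show ?thesis by (simp add: p_def)
  qed
  have p_M: "p \<in> M" using q_M M_inv[OF q_M] by (simp add: p_def max_def)
  have normalise: "\<exists>t\<in>M. 1 \<le> t * y \<and> t * y \<le> p" if y: "0 < y" for y
  proof (cases "1 \<le> y")
    case True
    then obtain n where n: "p ^ n \<le> y" "y < p ^ Suc n" using power_interval[OF p] by blast
    have "1 / p ^ n \<in> M" by (rule M_inv[OF M_pow[OF p_M]])
    moreover have "1 \<le> 1 / p ^ n * y" "1 / p ^ n * y \<le> p" using n p by (simp_all add: field_simps)
    ultimately show ?thesis by blast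
  next
    case False
    then have "1 \<le> 1 / y" using y by simp
    then obtain n where n: "p ^ n \<le> 1 / y" "1 / y < p ^ Suc n" using power_interval[OF p] by blast
    have "1 \<le> p ^ Suc n * y" using n(2) y by (simp add: field_simps)
    moreover have "p ^ n * y \<le> 1" using n(1) y by (simp add: field_simps)
    then have "p * (p ^ n * y) \<le> p * 1" using p by (intro mult_left_mono) auto
    then have "p ^ Suc n * y \<le> p" by (simp add: mult.assoc)
    ultimately show ?thesis using M_pow[OF p_M] by blast
  qed
  define r where "r = 1 / \<bar>d\<bar>"
  have r: "r > 0" using d by (simp add: r_def)
  let ?C = "cbox (Complex (x0 - r * p) 1) (Complex (x0 + r * p) p)"
  have C: "compact ?C" "?C \<subseteq> UHP" by (auto simp: in_cbox_complex_iff)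
  have "\<exists>w'\<in>?C. length2 B w' \<le> 1/64 \<and> \<phi> (moebius \<sigma> w') = \<phi> (moebius \<sigma> w)"
    if w: "0 < Im w" "length2 B w \<le> 1/64" for w
  proof -
    obtain t where t: "t \<in> M" "1 \<le> t * Im w" "t * Im w \<le> p" using normalise[OF w(1)] by blast
    have t0: "t > 0" using t(1) by (simp add: M_def)
    let ?w = "?s t w"
    have mu: "length2 B ?w = length2 B w" unfolding mu_eq Im_s Re_s using t0 by simp
    have pw: "0 < Im ?w" using t0 w(1) by simp
    have "(d * (Re ?w - x0) / Im ?w)\<^sup>2 + d\<^sup>2 / 2 \<le> 1/64"
      using w(2) mu mu_eq[of ?w] by linarith
    then have "(d * (Re ?w - x0) / Im ?w)\<^sup>2 \<le> 1" using zero_le_power2[of d] by linarith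
    then have "\<bar>d * (Re ?w - x0) / Im ?w\<bar> \<le> 1" by (simp add: abs_square_le_1)
    moreover have "\<bar>u\<bar> \<le> r * v" if "\<bar>d * u / v\<bar> \<le> 1" "0 < v" for u v :: real
      using that d by (simp add: r_def abs_mult field_simps)
    ultimately have "\<bar>Re ?w - x0\<bar> \<le> r * Im ?w" using pw by blast
    also have "\<dots> \<le> r * p" using t(3) r by (simp add: Im_s)
    finally have "\<bar>Re ?w - x0\<bar> \<le> r * p" .
    then have "?w \<in> ?C" using t(2,3) by (simp add: in_cbox_complex_iff abs_le_iff)
    moreover have "\<phi> (moebius \<sigma> ?w) = \<phi> (moebius \<sigma> w)" using t(1) w(1) unfolding M_def by blast
    ultimately show ?thesis using mu w(2) by (intro bexI[of _ ?w]) auto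
  qed
  then show ?thesis using C by blast
qed

text \<open>
If \<open>B = \<plusminus>translation t\<close> is shortest at \<open>w0\<close>, then no translation in the group is shorter than \<open>|t|\<close>.
An element \<open>E\<close> that fixes \<open>\<infinity>\<close> conjugates the translation by \<open>t\<close> into the one by \<open>a\<^sup>2 t\<close>, and its
inverse into the one by \<open>a\<^sup>-\<^sup>2 t\<close>, so \<open>a\<^sup>2 = 1\<close> and \<open>E\<close> is a translation up to sign. Division with
remainder makes \<open>|t|\<close> a generator.
\<close>

lemma parabolic_cusp:
  assumes B: "B \<in> conj_group" "B = translation t \<or> B = - translation t" "t \<noteq> 0"
    and w0: "0 < Im w0"
    and min: "\<And>C. C \<in> conj_group \<Longrightarrow> 0 < length2 C w0 \<Longrightarrow> length2 B w0 \<le> length2 C w0"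
    and E: "E$2$1 = 0"
  shows "E \<in> conj_group \<longleftrightarrow>
    E \<in> translation_group \<bar>t\<bar>"
proof
  let ?l = "\<bar>t\<bar>"
  have T: "translation t \<in> conj_group" using B conj_group_neg[OF B(1)] by auto
  then have Tl: "translation ?l \<in> conj_group"
    using conj_group_adjugate[OF T] by (simp add: abs_if adjugate_translation)
  have sub: "translation_group ?l \<subseteq> conj_group"
    by (rule translation_group_subset[OF Tl conj_group_one conj_group_mult conj_group_adjugate conj_group_neg])
  {
    assume "E \<in> translation_group ?l"
    then show "E \<in> conj_group" using sub by blast
  }
  assume E_in: "E \<in> conj_group"
  have mu_B: "length2 B w0 = (t / Im w0)\<^sup>2" using B(2) length2_neg by (auto simp: length2_translation)
  have shortest: "t\<^sup>2 \<le> x\<^sup>2" if x: "translation x \<in> conj_group" "x \<noteq> 0" for x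
  proof -
    have "(t / Im w0)\<^sup>2 \<le> (x / Im w0)\<^sup>2" using min[OF x(1)] mu_B x(2) w0 by (simp add: length2_translation)
    then show ?thesis using w0 by (simp add: power_divide divide_le_cancel)
  qed
  have conj_T: "C ** translation t ** adjugate C = translation ((C$1$1)\<^sup>2 * t)"
    if C: "det C = 1" "C$2$1 = 0" for C
  proof -
    have "C$1$1 * C$2$2 = 1" using C by (simp add: det_2)
    then show ?thesis using C(2)
      by (simp add: matrix_eq_2 matrix_mult_nth power2_eq_square algebra_simps)
  qed
  have stretch: "1 \<le> (C$1$1)\<^sup>2" if C: "C \<in> conj_group" "C$2$1 = 0" for C
  proof -
    have d: "det C = 1" by (rule conj_group_det[OF C(1)])
    then have c: "C$1$1 \<noteq> 0" using C(2) by (auto simp: det_2)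
    have "translation ((C$1$1)\<^sup>2 * t) \<in> conj_group"
      using conj_T[OF d C(2)] conj_group_mult[OF conj_group_mult[OF C(1) T] conj_group_adjugate[OF C(1)]]
      by simp
    then have "t\<^sup>2 \<le> ((C$1$1)\<^sup>2 * t)\<^sup>2" using shortest c B(3) by simp
    then have "1\<^sup>2 \<le> ((C$1$1)\<^sup>2)\<^sup>2" using B(3) by (simp add: power_mult_distrib)
    then show ?thesis by (rule power2_le_imp_le) simp
  qed
  have dE: "E$1$1 * E$2$2 = 1" using conj_group_det[OF E_in] E by (simp add: det_2)
  have "1 \<le> (E$1$1)\<^sup>2" "1 \<le> (E$2$2)\<^sup>2"
    using stretch[OF E_in E] stretch[OF conj_group_adjugate[OF E_in]] E by simp_all
  moreover have "(E$1$1)\<^sup>2 * (E$2$2)\<^sup>2 = 1" using dE by (simp add: power_mult_distrib[symmetric])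
  ultimately have "(E$1$1)\<^sup>2 = 1"
    using mult_left_mono[of 1 "(E$2$2)\<^sup>2" "(E$1$1)\<^sup>2"] by simp
  then have "E$1$1 = 1 \<or> E$1$1 = -1" by (simp add: power2_eq_1_iff)
  then obtain x where x: "E = translation x \<or> E = - translation x"
  proof
    assume 1: "E$1$1 = 1"
    then have "E = translation (E$1$2)" using dE E by (simp add: matrix_eq_2)
    then show ?thesis using that by blast
  next
    assume 1: "E$1$1 = -1"
    then have "E$2$2 = -1" using dE by simp
    then have "E = - translation (- E$1$2)" using 1 E by (simp add: matrix_eq_2)
    then show ?thesis using that by blast
  qed
  have Tx: "translation x \<in> conj_group"
    using x E_in conj_group_neg[OF E_in] by auto
  \<comment> \<open>The remainder \<open>y\<close> is a translation length in \<open>[0, |t|)\<close>, hence 0.\<close>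
  define n where "n = \<lfloor>x / ?l\<rfloor>"
  define y where "y = x - of_int n * ?l"
  have l: "?l > 0" using B(3) by simp
  have "translation (of_int (- n) * ?l) \<in> conj_group" using sub unfolding translation_group_def by blast
  from conj_group_mult[OF Tx this] have "translation y \<in> conj_group"
    by (simp add: translation_mult y_def)
  moreover have "0 \<le> y" "y < ?l"
  proof -
    have "of_int n \<le> x / ?l" "x / ?l < of_int n + 1" by (simp_all add: n_def)
    then show "0 \<le> y" "y < ?l" using l by (simp_all add: y_def pos_le_divide_eq pos_divide_less_eq distrib_right)
  qed
  then have "y\<^sup>2 < t\<^sup>2" using power_strict_mono[of y ?l 2] by simp
  ultimately have "y = 0" using shortest[of y] by force
  then have "x = of_int n * ?l" by (simp add: y_def)
  then show "E \<in> translation_group ?l"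
    using x unfolding translation_group_def by blast
qed

text \<open>
The region where \<open>B\<close> is short is a half-plane \<open>Im w \<ge> 8|t|\<close>. Decay at the cusp bounds the imaginary part
where \<open>\<phi> \<ge> \<eta>\<close>, and translations bound the real part.
\<close>

lemma parabolic_representatives:
  assumes B: "B \<in> conj_group" "B = translation t \<or> B = - translation t" "t \<noteq> 0"
    and w0: "0 < Im w0"
    and min: "\<And>C. C \<in> conj_group \<Longrightarrow> 0 < length2 C w0 \<Longrightarrow> length2 B w0 \<le> length2 C w0"
    and \<eta>: "0 < \<eta>"
  shows "\<exists>C. compact C \<and> C \<subseteq> UHP \<and> (\<forall>w. 0 < Im w \<longrightarrow> length2 B w \<le> 1/64 \<longrightarrow> \<eta> \<le> \<phi> (moebius \<sigma> w) \<longrightarrow>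
    (\<exists>w'\<in>C. length2 B w' \<le> 1/64 \<and> \<phi> (moebius \<sigma> w') = \<phi> (moebius \<sigma> w)))"
proof -
  let ?l = "\<bar>t\<bar>"
  have l: "?l > 0" using B(3) by simp
  have cusp: "\<sigma> ** E ** adjugate \<sigma> \<in> G \<longleftrightarrow>
      E \<in> translation_group ?l" if "E$2$1 = 0" for E
    using parabolic_cusp[OF B w0 min that] by (simp add: conj_group_def)
  obtain y0 where y0: "\<And>w. 0 < Im w \<Longrightarrow> y0 \<le> Im w \<Longrightarrow> \<phi> (moebius \<sigma> w) < \<eta>"
    using \<phi>_cusp[OF det_\<sigma> l cusp \<eta>] by blast
  have mu_B: "length2 B w = (t / Im w)\<^sup>2" for w using B(2) length2_neg by (auto simp: length2_translation)
  let ?C = "cbox (Complex 0 (8 * ?l)) (Complex ?l (max y0 (8 * ?l)))"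
  have C: "compact ?C" "?C \<subseteq> UHP" using l by (auto simp: in_cbox_complex_iff)
  have "\<exists>w'\<in>?C. length2 B w' \<le> 1/64 \<and> \<phi> (moebius \<sigma> w') = \<phi> (moebius \<sigma> w)"
    if w: "0 < Im w" "length2 B w \<le> 1/64" "\<eta> \<le> \<phi> (moebius \<sigma> w)" for w
  proof -
    have "\<bar>t / Im w\<bar>\<^sup>2 \<le> 1/64" using w(2) unfolding power2_abs mu_B .
    then have "\<bar>t / Im w\<bar> \<le> 1/8" by (rule le_eighth)
    then have y1: "8 * ?l \<le> Im w" using w(1) by (simp add: abs_divide pos_divide_le_eq)
    have y2: "Im w < y0" using y0[OF w(1)] w(3) by force
    define n where "n = \<lfloor>Re w / ?l\<rfloor>"
    let ?T = "translation (of_int (- n) * ?l)"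
    let ?w = "w + of_real (of_int (- n) * ?l)"
    have "?T$2$1 = 0" by simp
    then have T: "?T \<in> conj_group" using cusp[of ?T] unfolding conj_group_def translation_group_def by blast
    have "of_int n \<le> Re w / ?l" "Re w / ?l < of_int n + 1" by (simp_all add: n_def)
    then have "0 \<le> Re ?w" "Re ?w \<le> ?l"
      using l by (simp_all add: pos_le_divide_eq pos_divide_less_eq distrib_right)
    then have "?w \<in> ?C" using y1 y2 by (simp add: in_cbox_complex_iff)
    moreover have "length2 B ?w \<le> 1/64" using w(2) by (simp add: mu_B)
    moreover have "\<phi> (moebius \<sigma> ?w) = \<phi> (moebius \<sigma> w)"
      using \<phi>_conj_group[OF T w(1)] by (simp only: moebius_translation)
    ultimately show ?thesis by blast
  qed
  then show ?thesis using C by blast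
qed

end

lemma thin_representatives:
  assumes A: "A \<in> nontrivial" and z0: "0 < Im z0" "0 < \<phi> z0"
    and min: "\<And>B. B \<in> nontrivial \<Longrightarrow> length2 A z0 \<le> length2 B z0"
  shows "\<exists>C. compact C \<and> C \<subseteq> UHP \<and> (\<forall>z. 0 < Im z \<longrightarrow> length2 A z \<le> 1/64 \<longrightarrow> \<phi> z0 \<le> \<phi> z \<longrightarrow>
    (\<exists>z'\<in>C. length2 A z' \<le> 1/64 \<and> \<phi> z' = \<phi> z))"
proof (cases "(A$2$2 - A$1$1)\<^sup>2 + 4 * A$1$2 * A$2$1 < 0")
  case True
  then obtain C where C: "compact C" "C \<subseteq> UHP" "\<forall>z. 0 < Im z \<longrightarrow> length2 A z \<le> 1/64 \<longrightarrow> z \<in> C"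
    using elliptic_sublevel_compact by blast
  show ?thesis by (rule exI[of _ C]) (use C in blast)
next
  case False
  then obtain \<sigma> where \<sigma>: "det \<sigma> = 1" "(adjugate \<sigma> ** A ** \<sigma>)$2$1 = 0"
    using real_fixed_point_conjugate[of A] by force
  define B where "B = adjugate \<sigma> ** A ** \<sigma>"
  have AB: "\<sigma> ** B ** adjugate \<sigma> = A" unfolding B_def by (rule conj_adjugate_cancel(1)[OF \<sigma>(1)])
  have B: "B \<in> conj_group \<sigma>" using AB A by (simp add: conj_group_def[OF \<sigma>(1)] nontrivial_def)
  have B21: "B$2$1 = 0" using \<sigma>(2) by (simp add: B_def)
  define w0 where "w0 = moebius (adjugate \<sigma>) z0"
  have w0: "0 < Im w0" unfolding w0_def by (rule Im_moebius_pos) (use \<sigma> z0 in auto)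
  have z0w0: "moebius \<sigma> w0 = z0" unfolding w0_def by (rule moebius_adjugate(2)[OF \<sigma>(1) z0(1)])
  have B_A: "length2 B w0 = length2 A z0" using conj_group_length2[OF \<sigma>(1) B w0] by (simp add: AB z0w0)
  have minB: "length2 B w0 \<le> length2 C w0" if C: "C \<in> conj_group \<sigma>" "0 < length2 C w0" for C
  proof -
    let ?C = "\<sigma> ** C ** adjugate \<sigma>"
    have eq: "length2 ?C z0 = length2 C w0" using conj_group_length2[OF \<sigma>(1) C(1) w0] by (simp add: z0w0)
    then have "?C \<noteq> mat 1" "?C \<noteq> - mat 1" using C(2) length2_one by (auto simp: length2_neg)
    then have "?C \<in> nontrivial" using C(1) by (simp add: conj_group_def[OF \<sigma>(1)] nontrivial_def)
    from min[OF this] show ?thesis by (simp only: eq B_A)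
  qed
  have "\<exists>C. compact C \<and> C \<subseteq> UHP \<and> (\<forall>w. 0 < Im w \<longrightarrow> length2 B w \<le> 1/64 \<longrightarrow> \<phi> z0 \<le> \<phi> (moebius \<sigma> w) \<longrightarrow>
    (\<exists>w'\<in>C. length2 B w' \<le> 1/64 \<and> \<phi> (moebius \<sigma> w') = \<phi> (moebius \<sigma> w)))"
  proof (cases "B$1$1 = B$2$2")
    case False
    from hyperbolic_representatives[OF \<sigma>(1) B B21 this] show ?thesis by blast
  next
    case True
    have "B$1$1 * B$2$2 = 1" using conj_group_det[OF \<sigma>(1) B] B21 by (simp add: det_2)
    then have "(B$1$1)\<^sup>2 = 1" using True by (simp add: power2_eq_square)
    then have "B$1$1 = 1 \<or> B$1$1 = -1" by (simp add: power2_eq_1_iff)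
    then have "\<exists>t. B = translation t \<or> B = - translation t"
    proof
      assume "B$1$1 = 1"
      then have "B = translation (B$1$2)" using True B21 by (simp add: matrix_eq_2)
      then show ?thesis by blast
    next
      assume "B$1$1 = -1"
      then have "B = - translation (- B$1$2)" using True B21 by (simp add: matrix_eq_2)
      then show ?thesis by blast
    qed
    then obtain t where t: "B = translation t \<or> B = - translation t" by blast
    have "0 < length2 B w0" using nontrivial_length2_pos[OF A z0(1)] B_A by simp
    then have "t \<noteq> 0" using t by (auto simp: length2_neg length2_translation)
    from parabolic_representatives[OF \<sigma>(1) B t this w0 minB z0(2)] show ?thesis by blast
  qed
  then obtain C where C: "compact C" "C \<subseteq> UHP" and rep: "\<And>w. 0 < Im w \<Longrightarrow> length2 B w \<le> 1/64 \<Longrightarrow>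
      \<phi> z0 \<le> \<phi> (moebius \<sigma> w) \<Longrightarrow> \<exists>w'\<in>C. length2 B w' \<le> 1/64 \<and> \<phi> (moebius \<sigma> w') = \<phi> (moebius \<sigma> w)"
    by blast
  have "\<exists>z'\<in>moebius \<sigma> ` C. length2 A z' \<le> 1/64 \<and> \<phi> z' = \<phi> z"
    if z: "0 < Im z" "length2 A z \<le> 1/64" "\<phi> z0 \<le> \<phi> z" for z
  proof -
    define w where "w = moebius (adjugate \<sigma>) z"
    have w: "0 < Im w" unfolding w_def by (rule Im_moebius_pos) (use \<sigma> z in auto)
    have zw: "moebius \<sigma> w = z" unfolding w_def by (rule moebius_adjugate(2)[OF \<sigma>(1) z(1)])
    have "length2 B w \<le> 1/64" using conj_group_length2[OF \<sigma>(1) B w] z(2) by (simp add: AB zw)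
    then obtain w' where w': "w' \<in> C" "length2 B w' \<le> 1/64" "\<phi> (moebius \<sigma> w') = \<phi> z"
      using rep[OF w] z(3) zw by auto
    have "length2 A (moebius \<sigma> w') = length2 B w'"
      using conj_group_length2[OF \<sigma>(1) B, of w'] w'(1) C(2) AB by auto
    then have "length2 A (moebius \<sigma> w') \<le> 1/64" using w'(2) by simp
    then show ?thesis using w'(1,3) by blast
  qed
  then show ?thesis using compact_image_\<sigma>[OF \<sigma>(1) C] by blast
qed

text \<open>
Every positive value of \<open>\<phi>\<close> is at most a value at a thick point, hence at most a value on a compact set.
So if \<open>\<phi>\<close> were positive somewhere, it would have a global maximum.
\<close>

lemma \<phi>_nonpositive:
  assumes z0: "0 < Im z0"
  shows "\<phi> z0 \<le> 0"
proof (rule ccontr)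
  assume "\<not> \<phi> z0 \<le> 0"
  then have pos: "0 < \<phi> z0" by simp
  have above: "\<exists>w\<in>thick. \<phi> z \<le> \<phi> w" if z: "0 < Im z" "0 < \<phi> z" for z
  proof (cases "z \<in> thick")
    case False
    define S where "S = {B \<in> nontrivial. length2 B z \<le> 1/64}"
    have "finite S" unfolding S_def nontrivial_def
      by (rule finite_subset[OF _ finite_length2_bounded[OF z(1), of "1/64"]]) auto
    moreover have thin: "\<exists>B\<in>nontrivial. length2 B z < 1/64" using False z(1) by (auto simp: thick_def not_le)
    then have "S \<noteq> {}" by (auto simp: S_def)
    ultimately obtain A where A: "A \<in> S" "\<And>B. B \<in> S \<Longrightarrow> length2 A z \<le> length2 B z"
      using arg_min_if_finite[of S "\<lambda>B. length2 B z"] that[of "arg_min_on (\<lambda>B. length2 B z) S"]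
      by (meson linorder_not_less)
    have min: "length2 A z \<le> length2 B z" if "B \<in> nontrivial" for B
    proof (cases "length2 B z \<le> 1/64")
      case True
      then show ?thesis using A(2)[of B] that by (simp add: S_def)
    next
      case False
      then show ?thesis using A(1) by (simp add: S_def)
    qed
    have less: "length2 A z < 1/64" using thin min by force
    have nt: "A \<in> nontrivial" using A(1) by (simp add: S_def)
    obtain C where C: "compact C" "C \<subseteq> UHP" "\<And>u. 0 < Im u \<Longrightarrow> length2 A u \<le> 1/64 \<Longrightarrow> \<phi> z \<le> \<phi> u \<Longrightarrow>
        \<exists>z'\<in>C. length2 A z' \<le> 1/64 \<and> \<phi> z' = \<phi> u"
      using thin_representatives[OF nt z min] by blast
    show ?thesis by (rule thick_point_above[OF nt z less min C])
  qed auto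
  obtain C where C: "compact C" "C \<subseteq> UHP" "\<And>z. z \<in> thick \<Longrightarrow> \<exists>A\<in>G. moebius A z \<in> C"
    using thick_cocompact by blast
  have C_above: "\<exists>w\<in>C. \<phi> z \<le> \<phi> w" if z: "0 < Im z" "0 < \<phi> z" for z
  proof -
    obtain w where w: "w \<in> thick" "\<phi> z \<le> \<phi> w" using above[OF z] by blast
    obtain A where A: "A \<in> G" "moebius A w \<in> C" using C(3)[OF w(1)] by blast
    have "0 < Im w" using w(1) by (simp add: thick_def)
    then show ?thesis using \<phi>_invariant[OF A(1), of w] A(2) w(2) by (intro bexI[of _ "moebius A w"]) auto
  qed
  then have "C \<noteq> {}" using z0 pos by blast
  then obtain z1 where z1: "z1 \<in> C" "\<And>z. z \<in> C \<Longrightarrow> \<phi> z \<le> \<phi> z1"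
    using continuous_attains_sup[OF C(1) _ continuous_on_subset[OF \<phi>_continuous C(2)]] by blast
  have p1: "0 < Im z1" using z1(1) C(2) by auto
  have pos1: "0 < \<phi> z1" using C_above[OF z0 pos] z1(2) pos by force
  obtain w where w: "0 < Im w" "\<phi> z1 < \<phi> w" using \<phi>_no_max[OF p1 pos1, of 1] by auto
  then show False using C_above[of w] z1(2) pos1 by force
qed

end

section \<open>Matrix groups of Fuchsian groups\<close>

lemma SL2R_simps [simp]:
  "carrier SL2R = {A. det A = 1}" "A \<otimes>\<^bsub>SL2R\<^esub> B = A ** B" "\<one>\<^bsub>SL2R\<^esub> = mat 1"
  by (simp_all add: SL2R_def)

lemma group_SL2R: "group SL2R"
proof (rule groupI)
  show "\<exists>B\<in>carrier SL2R. B \<otimes>\<^bsub>SL2R\<^esub> A = \<one>\<^bsub>SL2R\<^esub>" if "A \<in> carrier SL2R" for A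
    using that mult_adjugate(2)[of A] by (intro bexI[of _ "adjugate A"]) simp_all
qed (simp_all add: det_mul matrix_mul_assoc)

lemma inv_SL2R: "det A = 1 \<Longrightarrow> inv\<^bsub>SL2R\<^esub> A = adjugate A"
  by (rule group.inv_equality[OF group_SL2R]) (simp_all add: mult_adjugate)

lemma normal_plus_minus_one: "{mat 1, - mat 1} \<lhd> SL2R"
proof -
  interpret group SL2R by (rule group_SL2R)
  have adj: "adjugate (mat 1) = mat 1" "adjugate (- mat 1) = - mat 1"
    by (simp_all add: matrix_eq_2)
  have "subgroup {mat 1, - mat 1} SL2R"
    by (rule subgroupI) (auto simp: inv_SL2R adj matrix_neg_mult_2)
  then show ?thesis
    unfolding normal_inv_iff by (auto simp: inv_SL2R mult_adjugate matrix_neg_mult_2)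
qed

lemma group_PSL2R: "group PSL2R"
  unfolding PSL2R_def by (rule normal.factorgroup_is_group[OF normal_plus_minus_one])

lemma carrier_PSL2R: "P \<in> carrier PSL2R \<Longrightarrow> \<exists>A. det A = 1 \<and> P = {A, - A}"
  by (auto simp: PSL2R_def FactGroup_def RCOSETS_def r_coset_def matrix_neg_mult_2)

lemma PSL2R_mult: "P \<otimes>\<^bsub>PSL2R\<^esub> Q = {A ** B | A B. A \<in> P \<and> B \<in> Q}"
  by (auto simp: PSL2R_def FactGroup_def set_mult_def)

lemma PSL2R_one: "\<one>\<^bsub>PSL2R\<^esub> = {mat 1, - mat 1}"
  by (simp add: PSL2R_def FactGroup_def)

text \<open>
The inverse in \<open>PSL2R\<close> of a coset \<open>{A, -A}\<close> is some coset \<open>{B, -B}\<close>, and \<open>A B = \<plusminus>1\<close> identifies it.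
\<close>

lemma discrete_matrix_group_preimage:
  assumes sub: "subgroup \<Gamma> PSL2R" and disc: "discrete (\<Union>\<Gamma>)"
  shows "discrete_matrix_group (\<Union>\<Gamma>)"
proof -
  interpret PSL: group PSL2R by (rule group_PSL2R)
  have coset: "P = {A, - A} \<and> det A = 1" if "P \<in> \<Gamma>" "A \<in> P" for P A
  proof -
    have "P \<in> carrier PSL2R" using that sub subgroup.subset by blast
    then obtain B where "det B = 1" "P = {B, - B}" using carrier_PSL2R by blast
    then show ?thesis using that(2) by auto
  qed
  have nonempty: "\<exists>A. A \<in> P" if "P \<in> \<Gamma>" for P
  proof -
    have "P \<in> carrier PSL2R" using that sub subgroup.subset by blast
    then show ?thesis using carrier_PSL2R by blast
  qed
  have mult: "A ** B \<in> \<Union>\<Gamma>" if A: "A \<in> P" "P \<in> \<Gamma>" and B: "B \<in> Q" "Q \<in> \<Gamma>" for A B P Q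
  proof -
    have "P \<otimes>\<^bsub>PSL2R\<^esub> Q \<in> \<Gamma>" using subgroup.m_closed[OF sub A(2) B(2)] .
    moreover have "A ** B \<in> P \<otimes>\<^bsub>PSL2R\<^esub> Q" using A(1) B(1) by (auto simp: PSL2R_mult)
    ultimately show ?thesis by blast
  qed
  show ?thesis
  proof
    show "det A = 1" if "A \<in> \<Union>\<Gamma>" for A using that coset by blast
    show one: "mat 1 \<in> \<Union>\<Gamma>" using subgroup.one_closed[OF sub] by (auto simp: PSL2R_one)
    show neg: "- A \<in> \<Union>\<Gamma>" if "A \<in> \<Union>\<Gamma>" for A using that coset by blast
    show "A ** B \<in> \<Union>\<Gamma>" if "A \<in> \<Union>\<Gamma>" "B \<in> \<Union>\<Gamma>" for A B using that mult by blast
    show "adjugate A \<in> \<Union>\<Gamma>" if A: "A \<in> \<Union>\<Gamma>" for A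
    proof -
      obtain P where P: "P \<in> \<Gamma>" "A \<in> P" using A by blast
      have d: "det A = 1" using coset P by blast
      define Q where "Q = inv\<^bsub>PSL2R\<^esub> P"
      have Q: "Q \<in> \<Gamma>" unfolding Q_def by (rule subgroup.m_inv_closed[OF sub P(1)])
      obtain B where B: "B \<in> Q" using nonempty[OF Q] by blast
      have "P \<in> carrier PSL2R" using P(1) sub subgroup.subset by blast
      then have "P \<otimes>\<^bsub>PSL2R\<^esub> Q = {mat 1, - mat 1}" using PSL.r_inv by (simp add: Q_def PSL2R_one)
      moreover have "A ** B \<in> P \<otimes>\<^bsub>PSL2R\<^esub> Q" using P B by (auto simp: PSL2R_mult)
      ultimately have AB: "A ** B = mat 1 \<or> A ** B = - mat 1" by simp
      have "B = (adjugate A ** A) ** B" by (simp add: mult_adjugate[OF d])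
      then have "B = adjugate A ** (A ** B)" by (simp only: matrix_mul_assoc)
      then have "B = adjugate A \<or> B = - adjugate A" using AB by (auto simp: matrix_neg_mult_2)
      then have "adjugate A = B \<or> adjugate A = - B" by auto
      moreover have "B \<in> \<Union>\<Gamma>" using B Q by blast
      ultimately show ?thesis using neg[of B] by (elim disjE) (simp_all only:)
    qed
    have "mat 1 isolated_in (\<Union>\<Gamma>)" using disc one by (auto dest: discreteD)
    then show "\<exists>e>0. \<forall>A\<in>\<Union>\<Gamma>. norm (A - mat 1) < e \<longrightarrow> A = mat 1"
      by (simp add: isolated_in_dist_Ex_iff dist_norm norm_minus_commute)
  qed
qed

lemma cofinite_matrix_group_preimage:
  assumes "fuchsian_first_kind \<Gamma>"
  shows "\<exists>D. cofinite_matrix_group (\<Union>\<Gamma>) D"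
proof -
  have disc: "discrete_matrix_group (\<Union>\<Gamma>)"
    using assms discrete_matrix_group_preimage by (auto simp: fuchsian_first_kind_def)
  obtain D where D: "D \<in> sets lborel" "D \<subseteq> UHP" "emeasure hyperbolic_area D < \<infinity>"
    "\<forall>\<tau>\<in>UHP. \<exists>!z. z \<in> D \<and> (\<exists>\<gamma>\<in>\<Union>\<Gamma>. z = moebius \<gamma> \<tau>)"
    using assms unfolding fuchsian_first_kind_def finite_covolume_def by blast
  have "\<exists>A\<in>\<Union>\<Gamma>. moebius A z \<in> D" if "0 < Im z" for z
  proof -
    have "z \<in> UHP" using that by simp
    then obtain u where "u \<in> D" "\<exists>\<gamma>\<in>\<Union>\<Gamma>. u = moebius \<gamma> z" using D(4) by blast
    then show ?thesis by blast
  qed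
  then have "cofinite_matrix_group (\<Union>\<Gamma>) D"
    using D(1-3) by (intro cofinite_matrix_group.intro[OF disc] cofinite_matrix_group_axioms.intro) auto
  then show ?thesis by blast
qed

lemma generate_translation:
  "generate SL2R {translation l, - mat 1}
    = translation_group l"
proof -
  interpret group SL2R by (rule group_SL2R)
  have T0: "translation 0 = mat 1" by (simp add: matrix_eq_2)
  show ?thesis
  proof (intro equalityI subsetI)
    fix B assume "B \<in> generate SL2R {translation l, - mat 1}"
    then have "\<exists>n::int. B = translation (of_int n * l) \<or> B = - translation (of_int n * l)"
    proof (induction rule: generate.induct)
      case one
      show ?case by (rule exI[of _ 0]) (simp add: T0)
    next
      case (incl h)
      then consider "h = translation l" | "h = - mat 1" by blast
      then show ?case
      proof cases
        case 1
        then show ?thesis by (intro exI[of _ 1]) simp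
      next
        case 2
        then show ?thesis by (intro exI[of _ 0]) (simp add: T0)
      qed
    next
      case (inv h)
      then consider "h = translation l" | "h = - mat 1" by blast
      then show ?case
      proof cases
        case 1
        then show ?thesis by (intro exI[of _ "-1"]) (simp add: inv_SL2R adjugate_translation)
      next
        case 2
        have "adjugate (- mat 1) = - mat 1" by (simp add: matrix_eq_2)
        then show ?thesis using 2 by (intro exI[of _ 0]) (simp add: T0 inv_SL2R)
      qed
    next
      case (eng g h)
      then obtain m n :: int where
        "g = translation (of_int m * l) \<or> g = - translation (of_int m * l)"
        "h = translation (of_int n * l) \<or> h = - translation (of_int n * l)" by blast
      then show ?case
        by (intro exI[of _ "m + n"]) (auto simp: translation_mult matrix_neg_mult_2 distrib_right)
    qed
    then show "B \<in> translation_group l" by (simp add: translation_group_def)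
  next
    let ?H = "generate SL2R {translation l, - mat 1}"
    have H: "subgroup ?H SL2R" by (rule generate_is_subgroup) auto
    have inv: "adjugate B \<in> ?H" if "B \<in> ?H" for B
      using subgroup.m_inv_closed[OF H that] subgroup.mem_carrier[OF H that] by (simp add: inv_SL2R)
    have neg: "- B \<in> ?H" if "B \<in> ?H" for B
      using subgroup.m_closed[OF H generate.incl that, of "- mat 1"] by (simp add: matrix_neg_mult_2)
    fix B assume "B \<in> translation_group l"
    then show "B \<in> ?H"
      using translation_group_subset[of l ?H] subgroup.m_closed[OF H] subgroup.one_closed[OF H] inv neg
      by (auto intro: generate.incl)
  qed
qed

lemma cusp_widthI:
  assumes det: "det \<sigma> = 1" and l: "0 < l"
    and stab: "\<And>B. B$2$1 = 0 \<Longrightarrow> \<sigma> ** B ** adjugate \<sigma> \<in> \<Union>\<Gamma> \<longleftrightarrow>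
        B \<in> translation_group l"
  shows "cusp_width \<Gamma> \<sigma> l"
proof -
  have 1: "matrix_inv \<sigma> ** \<gamma> ** \<sigma> = B \<longleftrightarrow> \<gamma> = \<sigma> ** B ** adjugate \<sigma>" for \<gamma> B
  proof -
    show ?thesis
      using conj_adjugate_cancel[OF det, of \<gamma>] conj_adjugate_cancel[OF det, of B]
      unfolding matrix_inv_eq_adjugate[OF det] by metis
  qed
  have "{\<delta> \<in> (\<lambda>\<gamma>. matrix_inv \<sigma> ** \<gamma> ** \<sigma>) ` \<Union>\<Gamma>. \<delta>$2$1 = 0}
      = {B. B$2$1 = 0 \<and> \<sigma> ** B ** adjugate \<sigma> \<in> \<Union>\<Gamma>}"
  proof -
    have "\<delta> \<in> (\<lambda>\<gamma>. matrix_inv \<sigma> ** \<gamma> ** \<sigma>) ` \<Union>\<Gamma> \<longleftrightarrow> \<sigma> ** \<delta> ** adjugate \<sigma> \<in> \<Union>\<Gamma>" for \<delta>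
      using 1[of _ \<delta>] by (metis (no_types, lifting) image_iff)
    then show ?thesis by blast
  qed
  also have "\<dots> = translation_group l"
    using stab by (auto simp: translation_group_def)
  finally show ?thesis using det l by (simp add: cusp_width_def generate_translation)
qed

section \<open>Modular forms of negative weight\<close>

definition invariant_modulus :: "nat \<Rightarrow> (complex \<Rightarrow> complex) \<Rightarrow> complex \<Rightarrow> real" where
  "invariant_modulus m f z = (cmod (f z))\<^sup>2 / Im z ^ m"

lemma invariant_modulus_slash:
  assumes d: "det A = 1" and z: "0 < Im z"
  shows "invariant_modulus m f (moebius A z) = invariant_modulus m (slash (- int m) A f) z"
proof -
  have j: "autj A z \<noteq> 0" by (rule autj_nonzero[OF d z])
  show ?thesis
    using j z by (simp add: invariant_modulus_def slash_def Im_moebius[OF d z] norm_mult norm_power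
        power_mult_distrib power_divide power_mult[symmetric] mult.commute)
qed

lemma cmod_diff_cnj: "(cmod (w - cnj z))\<^sup>2 = (Re w - Re z)\<^sup>2 + (Im w + Im z)\<^sup>2"
  by (simp add: cmod_power2)

text \<open>
At a local maximum \<open>z\<close>, compare the height with \<open>|w - cnj z|\<^sup>2 \<ge> 4 Im w Im z\<close>, where equality holds only
at \<open>w = z\<close>. The holomorphic function \<open>f(w) / (w - cnj z)\<^sup>m\<close> then has its largest modulus at \<open>z\<close>, so it is
constant nearby; but then \<open>|f(w)|\<^sup>2 / (Im w)\<^sup>m\<close> increases in horizontal directions.
\<close>

lemma invariant_modulus_no_max:
  assumes f: "f holomorphic_on UHP" and z: "0 < Im z" and pos: "0 < invariant_modulus m f z"
    and m: "0 < m" and e: "0 < e"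
  shows "\<exists>w\<in>ball z e. 0 < Im w \<and> invariant_modulus m f z < invariant_modulus m f w"
proof (rule ccontr)
  assume no: "\<not> ?thesis"
  define r where "r = min e (Im z)"
  have r: "0 < r" using e z by (simp add: r_def)
  have ball: "0 < Im w" if "w \<in> ball z r" for w
  proof -
    have "\<bar>Im (z - w)\<bar> < Im z"
      using that abs_Im_le_cmod[of "z - w"] by (simp add: r_def dist_norm)
    then show ?thesis by simp
  qed
  let ?p = "invariant_modulus m f z"
  have le: "invariant_modulus m f w \<le> ?p" if "w \<in> ball z r" for w
    using no ball[OF that] that by (force simp: r_def)
  \<comment> \<open>The denominator has no zero in the upper half-plane.\<close>
  define g where "g w = f w / (w - cnj z) ^ m" for w
  have ne: "w - cnj z \<noteq> 0" if "0 < Im w" for w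
  proof
    assume "w - cnj z = 0"
    then have "Im (w - cnj z) = 0" by simp
    then show False using that z by simp
  qed
  have g2: "(cmod (g w))\<^sup>2 = invariant_modulus m f w * (Im w / (cmod (w - cnj z))\<^sup>2) ^ m" if "0 < Im w" for w
    using that ne[OF that]
    by (simp add: g_def invariant_modulus_def norm_divide norm_power power_divide power_mult[symmetric] mult.commute)
  have amgm: "Im w / (cmod (w - cnj z))\<^sup>2 \<le> 1 / (4 * Im z)" if w: "0 < Im w" for w
  proof -
    have "4 * Im w * Im z \<le> (cmod (w - cnj z))\<^sup>2"
      using zero_le_power2[of "Re w - Re z"] zero_le_power2[of "Im w - Im z"]
      unfolding cmod_diff_cnj by (simp add: power2_eq_square algebra_simps)
    then show ?thesis using ne[OF w] z by (simp add: field_simps)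
  qed
  have at_z: "Im z / (cmod (z - cnj z))\<^sup>2 = 1 / (4 * Im z)"
    unfolding cmod_diff_cnj using z by (simp add: power2_eq_square field_simps)
  have g_max: "cmod (g w) \<le> cmod (g z)" if w: "w \<in> ball z r" for w
  proof (rule power2_le_imp_le)
    have "(cmod (g w))\<^sup>2 \<le> ?p * (1 / (4 * Im z)) ^ m"
      unfolding g2[OF ball[OF w]]
      using le[OF w] amgm[OF ball[OF w]] ball[OF w] pos z by (intro mult_mono power_mono) auto
    also have "\<dots> = (cmod (g z))\<^sup>2" unfolding g2[OF z] at_z ..
    finally show "(cmod (g w))\<^sup>2 \<le> (cmod (g z))\<^sup>2" .
  qed simp
  have "g holomorphic_on ball z r"
    unfolding g_def using ne ball by (intro holomorphic_intros holomorphic_on_subset[OF f]) auto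
  then have "g constant_on ball z r"
    using g_max r by (intro maximum_modulus_principle[of g "ball z r" "ball z r" z]) auto
  then obtain c where c: "\<And>w. w \<in> ball z r \<Longrightarrow> g w = c" by (auto simp: constant_on_def)
  \<comment> \<open>A point of the same height, where the comparison of heights is strict.\<close>
  define w where "w = z + of_real (r / 2)"
  have w: "w \<in> ball z r" using r by (simp add: w_def dist_norm)
  have Iw: "Im w = Im z" by (simp add: w_def)
  have "g w = g z" using c[OF w] c[of z] r by simp
  then have eq: "invariant_modulus m f w * (Im z / (cmod (w - cnj z))\<^sup>2) ^ m = ?p * (1 / (4 * Im z)) ^ m"
    using g2[OF ball[OF w]] g2[OF z] at_z by (simp only: Iw)
  have "(cmod (w - cnj z))\<^sup>2 = r\<^sup>2 / 4 + 4 * (Im z)\<^sup>2"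
    unfolding cmod_diff_cnj by (simp add: w_def power2_eq_square)
  then have "4 * (Im z)\<^sup>2 < (cmod (w - cnj z))\<^sup>2" using r by simp
  then have "Im z / (cmod (w - cnj z))\<^sup>2 < 1 / (4 * Im z)"
    using z ne[OF ball[OF w]] by (simp add: field_simps power2_eq_square)
  then have "(Im z / (cmod (w - cnj z))\<^sup>2) ^ m < (1 / (4 * Im z)) ^ m"
    using z m by (intro power_strict_mono) auto
  then have "?p * (Im z / (cmod (w - cnj z))\<^sup>2) ^ m < ?p * (1 / (4 * Im z)) ^ m"
    using pos by (rule mult_strict_left_mono)
  moreover have "invariant_modulus m f w * (Im z / (cmod (w - cnj z))\<^sup>2) ^ m
      \<le> ?p * (Im z / (cmod (w - cnj z))\<^sup>2) ^ m"
    using le[OF w] z by (intro mult_right_mono) auto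
  ultimately show False using eq by linarith
qed

text \<open>
On \<open>Im w \<ge> 1\<close> the \<open>q\<close>-expansion is bounded, because \<open>|q|\<close> stays below a radius at which the series
converges absolutely; the factor \<open>1/y\<^sup>m\<close> tends to 0.
\<close>

lemma invariant_modulus_cusp_decay:
  assumes det: "det \<sigma> = 1" and l: "0 < l" and m: "0 < m" and \<eta>: "0 < \<eta>"
    and sums: "\<And>\<tau>. 0 < Im \<tau> \<Longrightarrow> (\<lambda>n. a n * qpar l \<tau> ^ n) sums slash (- int m) \<sigma> f \<tau>"
  shows "\<exists>y0. \<forall>w. 0 < Im w \<longrightarrow> y0 \<le> Im w \<longrightarrow> invariant_modulus m f (moebius \<sigma> w) < \<eta>"
proof -
  have q: "cmod (qpar l \<tau>) = exp (- (2 * pi * Im \<tau> / l))" for \<tau>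
    by (simp add: qpar_def norm_exp_eq_Re)
  define r where "r = exp (- (2 * pi / l))"
  \<comment> \<open>Convergence at \<open>\<i>/2\<close> gives absolute convergence at the smaller radius \<open>r\<close>, the value of \<open>|q|\<close> at \<open>\<i>\<close>.\<close>
  have half: "0 < Im (\<i> / 2)" by simp
  have "summable (\<lambda>n. a n * qpar l (\<i> / 2) ^ n)" using sums[OF half] by (rule sums_summable)
  moreover have "norm (complex_of_real r) < norm (qpar l (\<i> / 2))"
    unfolding q using l by (simp add: r_def field_simps)
  ultimately have "summable (\<lambda>n. norm (a n * complex_of_real r ^ n))" by (rule powser_insidea)
  then have sm: "summable (\<lambda>n. cmod (a n) * r ^ n)"
    by (simp add: norm_mult norm_power r_def)
  define c where "c = suminf (\<lambda>n. cmod (a n) * r ^ n)"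
  have bound: "cmod (slash (- int m) \<sigma> f w) \<le> c" if w: "1 \<le> Im w" for w
  proof -
    have "cmod (qpar l w) \<le> r" unfolding q r_def using w l by (simp add: field_simps)
    then have le: "norm (a n * qpar l w ^ n) \<le> cmod (a n) * r ^ n" for n
      by (simp add: norm_mult norm_power mult_left_mono power_mono)
    have "norm (suminf (\<lambda>n. a n * qpar l w ^ n)) \<le> c"
      unfolding c_def by (rule norm_suminf_le[OF le sm])
    moreover have "suminf (\<lambda>n. a n * qpar l w ^ n) = slash (- int m) \<sigma> f w"
      using sums[of w] w by (simp add: sums_iff)
    ultimately show ?thesis by simp
  qed
  show ?thesis
  proof (intro exI[of _ "max 1 (c\<^sup>2 / \<eta> + 1)"] allI impI)
    fix w assume w: "0 < Im w" "max 1 (c\<^sup>2 / \<eta> + 1) \<le> Im w"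
    then have w1: "1 \<le> Im w" "c\<^sup>2 / \<eta> < Im w" by auto
    have "invariant_modulus m f (moebius \<sigma> w) = (cmod (slash (- int m) \<sigma> f w))\<^sup>2 / Im w ^ m"
      unfolding invariant_modulus_slash[OF det w(1)] by (simp add: invariant_modulus_def)
    also have "\<dots> \<le> c\<^sup>2 / Im w ^ m"
      using bound[OF w1(1)] w(1) by (intro divide_right_mono power_mono) auto
    also have "\<dots> \<le> c\<^sup>2 / Im w"
      using w1(1) m self_le_power[of "Im w" m] by (intro divide_left_mono) auto
    also have "\<dots> < \<eta>" using w1(2) \<eta> w(1) by (simp add: field_simps)
    finally show "invariant_modulus m f (moebius \<sigma> w) < \<eta>" .
  qed
qed

lemma no_modular_forms_of_negative_weight:
  assumes \<Gamma>: "fuchsian_first_kind \<Gamma>" and k: "k < 0" and f: "f \<in> modular_forms k \<Gamma>"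
  shows "f = 0"
proof -
  obtain D where "cofinite_matrix_group (\<Union>\<Gamma>) D" using cofinite_matrix_group_preimage[OF \<Gamma>] by blast
  then interpret cofinite_matrix_group "\<Union>\<Gamma>" D .
  define m where "m = nat (- k)"
  have m: "0 < m" and km: "k = - int m" using k by (auto simp: m_def)
  have f0: "\<And>\<tau>. \<tau> \<notin> UHP \<Longrightarrow> f \<tau> = 0" and hol: "f holomorphic_on UHP"
    and inv: "\<And>\<gamma> \<tau>. \<gamma> \<in> \<Union>\<Gamma> \<Longrightarrow> 0 < Im \<tau> \<Longrightarrow> slash (- int m) \<gamma> f \<tau> = f \<tau>"
    and cusp: "\<And>\<sigma> l. cusp_width \<Gamma> \<sigma> l \<Longrightarrow>
      \<exists>a. \<forall>\<tau>\<in>UHP. (\<lambda>n. a n * qpar l \<tau> ^ n) sums slash (- int m) \<sigma> f \<tau>"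
    using f unfolding modular_forms_def km by auto
  interpret automorphic_modulus "\<Union>\<Gamma>" D "invariant_modulus m f"
  proof
    show "continuous_on UHP (invariant_modulus m f)"
      unfolding invariant_modulus_def
      by (intro continuous_intros holomorphic_on_imp_continuous_on[OF hol]) auto
    show "invariant_modulus m f (moebius A z) = invariant_modulus m f z"
      if "A \<in> \<Union>\<Gamma>" "0 < Im z" for A z
      unfolding invariant_modulus_slash[OF det_G[OF that(1)] that(2)]
      using inv[OF that] by (simp add: invariant_modulus_def)
    show "\<exists>w\<in>ball z e. 0 < Im w \<and> invariant_modulus m f z < invariant_modulus m f w"
      if "0 < Im z" "0 < invariant_modulus m f z" "0 < e" for z e
      using invariant_modulus_no_max[OF hol that(1,2) m that(3)] .
    show "\<exists>y0. \<forall>w. 0 < Im w \<longrightarrow> y0 \<le> Im w \<longrightarrow> invariant_modulus m f (moebius \<sigma> w) < \<eta>"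
      if \<sigma>: "det \<sigma> = 1" and l: "0 < l"
        and stab: "\<And>B. B$2$1 = 0 \<Longrightarrow> \<sigma> ** B ** adjugate \<sigma> \<in> \<Union>\<Gamma> \<longleftrightarrow>
          B \<in> translation_group l"
        and \<eta>: "0 < \<eta>" for \<sigma> l \<eta>
    proof -
      obtain a where "\<forall>\<tau>\<in>UHP. (\<lambda>n. a n * qpar l \<tau> ^ n) sums slash (- int m) \<sigma> f \<tau>"
        using cusp[OF cusp_widthI[OF \<sigma> l stab]] by blast
      then show ?thesis by (intro invariant_modulus_cusp_decay[OF \<sigma> l m \<eta>, of a]) auto
    qed
  qed
  have "f z = 0" for z
  proof (cases "0 < Im z")
    case True
    have "(cmod (f z))\<^sup>2 / Im z ^ m \<le> 0" using \<phi>_nonpositive[OF True] by (simp add: invariant_modulus_def)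
    moreover have "0 < Im z ^ m" using True by simp
    ultimately have "(cmod (f z))\<^sup>2 \<le> 0" by (simp only: pos_divide_le_eq mult_zero_left)
    then show ?thesis by simp
  next
    case False
    then show ?thesis using f0 by simp
  qed
  then show ?thesis by (auto simp: fun_eq_iff)
qed

section \<open>Dimensions\<close>

lemma edim_le_card:
  fixes s :: "complex \<Rightarrow> 'a::ab_group_add \<Rightarrow> 'a"
  assumes "vector_space s" "finite B" "S \<subseteq> module.span s B"
  shows "edim s S \<le> enat (card B)"
proof -
  interpret vector_space s by fact
  have "edim s S = enat (dim S)" unfolding edim_def using assms by auto
  then show ?thesis using dim_le_card[OF assms(3,2)] by simp
qed

lemma edim_finite_obtains_basis:
  fixes s :: "complex \<Rightarrow> 'a::ab_group_add \<Rightarrow> 'a"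
  assumes "vector_space s" "edim s S = enat n"
  obtains B where "B \<subseteq> S" "finite B" "module.independent s B" "S \<subseteq> module.span s B" "card B = n"
proof -
  interpret vector_space s by fact
  obtain B0 where B0: "finite B0" "S \<subseteq> span B0" and n: "n = dim S"
    using assms unfolding edim_def by (auto split: if_splits)
  obtain B where B: "B \<subseteq> S" "independent B" "S \<subseteq> span B" "card B = dim S"
    using basis_exists by blast
  have "finite B"
    using independent_span_bound[OF B0(1) B(2)] B(1) B0(2) by auto
  then show ?thesis using that B n by auto
qed

lemma edim_mono:
  fixes s :: "complex \<Rightarrow> 'a::ab_group_add \<Rightarrow> 'a"
  assumes "vector_space s" "S \<subseteq> T"
  shows "edim s S \<le> edim s T"
proof (cases "edim s T")
  case (enat n)
  then obtain B where "finite B" "T \<subseteq> module.span s B" "card B = n"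
    using edim_finite_obtains_basis assms(1) by metis
  then show ?thesis using edim_le_card[of s B S] assms enat by auto
qed auto

lemma edim_rank_nullity:
  assumes lin: "Vector_Spaces.linear s1 s2 h" and sub: "module.subspace s1 S"
  shows "edim s1 S \<le> edim s1 {x \<in> S. h x = 0} + edim s2 (h ` S)"
proof (cases "edim s1 {x \<in> S. h x = 0}")
  case m: (enat m)
  interpret Vector_Spaces.linear s1 s2 h by (rule lin)
  show ?thesis
  proof (cases "edim s2 (h ` S)")
    case n: (enat n)
    obtain B where B: "B \<subseteq> {x \<in> S. h x = 0}" "finite B" "{x \<in> S. h x = 0} \<subseteq> vs1.span B" "card B = m"
      by (rule edim_finite_obtains_basis[OF vs1.vector_space_axioms m])
    obtain C where C: "C \<subseteq> h ` S" "finite C" "h ` S \<subseteq> vs2.span C" "card C = n"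
      by (rule edim_finite_obtains_basis[OF vs2.vector_space_axioms n])
    obtain D where D: "D \<subseteq> S" "finite D" "h ` D = C" "card D = n"
    proof -
      obtain D where D: "D \<subseteq> S" "inj_on h D" "C = h ` D"
        using C(1) by (auto simp: subset_image_inj)
      then show ?thesis using that C by (auto simp: card_image finite_image_iff)
    qed
    have "S \<subseteq> vs1.span (B \<union> D)"
    proof
      fix x assume x: "x \<in> S"
      have "h x \<in> vs2.span (h ` D)" using C(3) D(3) x by auto
      also have "vs2.span (h ` D) = h ` vs1.span D" by (rule span_image)
      finally obtain y where y: "y \<in> vs1.span D" "h x = h y" by auto
      have "y \<in> S" using y(1) vs1.span_minimal[OF D(1) sub] by blast
      then have "x - y \<in> {x \<in> S. h x = 0}"
        using x y(2) vs1.subspace_diff[OF sub] by (simp add: diff)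
      then have "x - y \<in> vs1.span (B \<union> D)" using B(3) vs1.span_mono[of B "B \<union> D"] by blast
      moreover have "y \<in> vs1.span (B \<union> D)" using y(1) vs1.span_mono[of D "B \<union> D"] by blast
      ultimately have "x - y + y \<in> vs1.span (B \<union> D)" by (rule vs1.span_add)
      then show "x \<in> vs1.span (B \<union> D)" by simp
    qed
    then have "edim s1 S \<le> enat (card (B \<union> D))" using edim_le_card[OF vs1.vector_space_axioms] B D by auto
    also have "\<dots> \<le> enat (card B + card D)" by (simp add: card_Un_le)
    finally show ?thesis using B D m n by simp
  qed auto
qed auto

text \<open>
Restrict to the kernels of the maps one after the other. The inequality holds for infinite
dimensions, and for \<open>card I = 0\<close> the product is 0 whatever the dimension of \<open>M\<close>.
\<close>

lemma edim_joint_kernel: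
  assumes "finite I"
    and lin: "\<And>i. i \<in> I \<Longrightarrow> Vector_Spaces.linear s1 s2 (h i)"
    and vs: "vector_space s1" and vs2: "vector_space s2" and sub: "module.subspace s1 S"
    and im: "\<And>i x. i \<in> I \<Longrightarrow> x \<in> S \<Longrightarrow> h i x \<in> M"
  shows "edim s1 S \<le> edim s1 {x \<in> S. \<forall>i\<in>I. h i x = 0} + edim s2 M * enat (card I)"
  using assms(1,2) im
proof (induction I rule: finite_induct)
  case empty
  then show ?case by (simp add: zero_enat_def[symmetric])
next
  case (insert j I)
  interpret v1: vector_space s1 by (rule vs)
  interpret v2: vector_space s2 by (rule vs2)
  let ?T = "{x \<in> S. \<forall>i\<in>I. h i x = 0}"
  have subT: "v1.subspace ?T"
  proof (rule v1.subspaceI)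
    have hom: "module_hom s1 s2 (h i)" if "i \<in> I" for i
      using that insert.prems(1)[of i] by (auto dest: Vector_Spaces.linear.axioms(3))
    show "0 \<in> ?T" using v1.subspace_0[OF sub] hom by (auto intro: module_hom.zero)
    show "x + y \<in> ?T" if "x \<in> ?T" "y \<in> ?T" for x y
      using that hom v1.subspace_add[OF sub, of x y] by (auto simp: module_hom.add[OF hom])
    show "s1 c x \<in> ?T" if "x \<in> ?T" for x c
      using that hom v1.subspace_scale[OF sub, of x c] by (auto simp: module_hom.scale[OF hom])
  qed
  have "edim s1 S \<le> edim s1 ?T + edim s2 M * enat (card I)"
    using insert by auto
  also have "edim s1 ?T \<le> edim s1 {x \<in> ?T. h j x = 0} + edim s2 (h j ` ?T)"
    using insert.prems(1) subT by (intro edim_rank_nullity) auto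
  also have "edim s2 (h j ` ?T) \<le> edim s2 M" using insert.prems(2) by (intro edim_mono vs2) auto
  also have "{x \<in> ?T. h j x = 0} = {x \<in> S. \<forall>i\<in>insert j I. h i x = 0}" by auto
  finally have "edim s1 S \<le> edim s1 {x \<in> S. \<forall>i\<in>insert j I. h i x = 0} + edim s2 M
      + edim s2 M * enat (card I)" by (simp add: add_right_mono add_left_mono)
  moreover have "enat (card (insert j I)) = 1 + enat (card I)"
    using insert.hyps by (simp add: one_enat_def)
  ultimately show ?case by (simp add: distrib_left add.assoc)
qed

section \<open>The degree filtration of a vertex operator algebra\<close>

lemma supp_sum_eq_sum:
  assumes "finite A" "\<And>i. i \<notin> A \<Longrightarrow> t i = 0"
  shows "supp_sum t = sum t A"
  unfolding supp_sum_def using assms by (intro sum.mono_neutral_left) auto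

context vertex_operator_algebra
begin

abbreviation linear_op :: "('v \<Rightarrow> 'v) \<Rightarrow> bool" where
  "linear_op T \<equiv> Vector_Spaces.linear scale scale T"

lemma component_decomposition:
  shows component_in: "component v n \<in> V n"
    and finite_component: "finite {n. component v n \<noteq> 0}"
    and supp_sum_component: "supp_sum (component v) = v"
proof -
  have "(\<forall>n. component v n \<in> V n) \<and> finite {n. component v n \<noteq> 0} \<and> supp_sum (component v) = v"
    unfolding component_def by (rule theI'[OF direct_sum])
  then show "component v n \<in> V n" "finite {n. component v n \<noteq> 0}" "supp_sum (component v) = v"
    by auto
qed

lemma component_eqI:
  assumes "\<And>n. d n \<in> V n" "finite {n. d n \<noteq> 0}" "supp_sum d = v"
  shows "component v = d"
  unfolding component_def using assms direct_sum[of v] by (intro the1_equality) auto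

lemma component_sum_eqI:
  assumes "finite A" "\<And>n. d n \<in> V n" "\<And>n. n \<notin> A \<Longrightarrow> d n = 0" "v = sum d A"
  shows "component v = d"
proof (rule component_eqI)
  show "finite {n. d n \<noteq> 0}" using assms by (metis (mono_tags, lifting) finite_subset mem_Collect_eq subsetI)
  show "supp_sum d = v" using assms supp_sum_eq_sum[of A d] by simp
qed (use assms in auto)

lemma eq_sum_component:
  assumes "finite A" "\<And>n. n \<notin> A \<Longrightarrow> component v n = 0"
  shows "v = (\<Sum>n\<in>A. component v n)"
  using supp_sum_component[of v] supp_sum_eq_sum[OF assms] by simp

lemma linear_component: "linear_op (\<lambda>v. component v n)"
proof -
  have "component (v + w) = (\<lambda>n. component v n + component w n)" for v w
  proof (rule component_sum_eqI)
    let ?A = "{n. component v n \<noteq> 0} \<union> {n. component w n \<noteq> 0}"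
    show f: "finite ?A" using finite_component by auto
    show "v + w = (\<Sum>n\<in>?A. component v n + component w n)"
      using eq_sum_component[OF f, of v] eq_sum_component[OF f, of w] by (simp add: sum.distrib)
  qed (auto intro: subspace_add subspace_V component_in)
  moreover have "component (scale c v) = (\<lambda>n. scale c (component v n))" for c v
  proof (rule component_sum_eqI[OF finite_component[of v]])
    show "scale c v = (\<Sum>n\<in>{n. component v n \<noteq> 0}. scale c (component v n))"
      using eq_sum_component[OF finite_component[of v], of v] by (simp add: scale_sum_right[symmetric])
  qed (auto intro: subspace_scale subspace_V component_in)
  ultimately show ?thesis
    by unfold_locales auto
qed

interpretation comp: Vector_Spaces.linear scale scale "\<lambda>v. component v n" for n
  by (rule linear_component)

lemma component_homogeneous:
  assumes "v \<in> V n"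
  shows "component v = (\<lambda>m. if m = n then v else 0)"
  by (rule component_sum_eqI[of "{n}"]) (use assms subspace_0[OF subspace_V] in auto)

lemma F_iff: "v \<in> F N \<longleftrightarrow> (\<forall>n>N. component v n = 0)"
proof
  assume "v \<in> F N"
  then show "\<forall>n>N. component v n = 0"
    unfolding F_def
  proof (induction rule: span_induct)
    case base
    show ?case
      by (rule subspaceI) (auto simp: comp.add comp.scale)
  next
    case (step x)
    then show ?case by (auto simp: component_homogeneous)
  qed
next
  assume *: "\<forall>n>N. component v n = 0"
  have "v = (\<Sum>n\<in>{n. component v n \<noteq> 0}. component v n)"
    by (rule eq_sum_component) (auto simp: finite_component)
  also have "\<dots> \<in> F N"
    unfolding F_def using * component_in
    by (intro span_sum span_base) (force simp: not_less[symmetric])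
  finally show "v \<in> F N" .
qed

lemma subspace_F: "subspace (F N)"
  unfolding F_def by (rule subspace_span)

lemma F_mono: "M \<le> N \<Longrightarrow> F M \<subseteq> F N"
  by (auto simp: F_iff)

lemma F_negative: "N < 0 \<Longrightarrow> F N = {0}"
proof -
  assume N: "N < 0"
  have "v = 0" if "v \<in> F N" for v
  proof -
    have "component v n = 0" for n
      using that N component_in[of v n] V_negative[of n] by (cases "n > N") (auto simp: F_iff)
    then show "v = 0" using eq_sum_component[of "{}" v] by simp
  qed
  then show ?thesis using subspace_0[OF subspace_F] by auto
qed

lemma F_step: "v \<in> F (n - 1) \<longleftrightarrow> v \<in> F n \<and> component v n = 0"
proof -
  have "(m > n - 1) \<longleftrightarrow> m = n \<or> m > n" for m by auto
  then show ?thesis by (auto simp: F_iff)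
qed

lemma ex_F: "\<exists>N\<ge>0. v \<in> F N"
proof -
  obtain N where "\<forall>n\<in>{n. component v n \<noteq> 0}. n \<le> N"
    using bdd_above_finite[OF finite_component[of v]] by (auto simp: bdd_above_def)
  then have "v \<in> F (max 0 N)" by (fastforce simp: F_iff)
  then show ?thesis by (metis max.cobounded1)
qed

lemma V_subset_F: "V n \<subseteq> F n"
  by (auto simp: F_iff component_homogeneous)

lemma linear_L: "linear_op (L n)"
  unfolding L_def by (rule linear_right)

lemma component_L0: "component (L 0 v) n = scale (of_int n) (component v n)"
proof -
  interpret L0: Vector_Spaces.linear scale scale "L 0" by (rule linear_L)
  let ?A = "{n. component v n \<noteq> 0}"
  have "component (L 0 v) = (\<lambda>n. scale (of_int n) (component v n))"
  proof (rule component_sum_eqI[OF finite_component])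
    have "L 0 v = L 0 (\<Sum>n\<in>?A. component v n)"
      using eq_sum_component[OF finite_component[of v], of v] by simp
    also have "\<dots> = (\<Sum>n\<in>?A. scale (of_int n) (component v n))"
      unfolding L0.sum using L0_grading[OF component_in] by (simp add: L_def)
    finally show "L 0 v = (\<Sum>n\<in>?A. scale (of_int n) (component v n))" .
  qed (auto intro: subspace_scale subspace_V component_in)
  then show ?thesis by simp
qed

text \<open>
By the commutation relation \<open>[L(0), L(1)] = -L(1)\<close>, \<open>L 1 v\<close> is an eigenvector of \<open>L 0\<close> with eigenvalue
\<open>n - 1\<close>, and the eigenspaces of \<open>L 0\<close> are the homogeneous subspaces.
\<close>

lemma L1_lowers: "v \<in> V n \<Longrightarrow> L 1 v \<in> V (n - 1)"
proof -
  assume v: "v \<in> V n"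
  interpret L1: Vector_Spaces.linear scale scale "L 1" by (rule linear_L)
  have "L 0 v = scale (of_int n) v" using L0_grading[OF v] by (simp add: L_def)
  moreover have "L 0 (L 1 v) - L 1 (L 0 v) = scale (-1) (L 1 v)"
    using virasoro[of 0 1 v] by (simp add: L_def)
  ultimately have "L 0 (L 1 v) = scale (of_int (n - 1)) (L 1 v)"
    by (simp add: L1.scale scale_left_diff_distrib algebra_simps)
  then have "scale (of_int m) (component (L 1 v) m) = scale (of_int (n - 1)) (component (L 1 v) m)" for m
    using component_L0[of "L 1 v" m] by (simp only: comp.scale)
  then have zero: "component (L 1 v) m = 0" if "m \<noteq> n - 1" for m
    using that by (metis of_int_eq_iff scale_cancel_right)
  have "L 1 v = component (L 1 v) (n - 1)"
    using eq_sum_component[of "{n-1}" "L 1 v"] zero by simp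
  then show "L 1 v \<in> V (n - 1)" using component_in by metis
qed

lemma L1_F: "v \<in> F n \<Longrightarrow> L 1 v \<in> F (n - 1)"
proof -
  assume v: "v \<in> F n"
  interpret L1: Vector_Spaces.linear scale scale "L 1" by (rule linear_L)
  show "L 1 v \<in> F (n - 1)"
    using v unfolding F_def[of n]
  proof (induction rule: span_induct)
    case base
    show ?case using subspace_0[OF subspace_F] subspace_add[OF subspace_F] subspace_scale[OF subspace_F]
      by (intro subspaceI) (auto simp: L1.add L1.scale)
  next
    case (step x)
    then obtain m where "m \<le> n" "x \<in> V m" by auto
    then have "L 1 x \<in> F (m - 1)" using L1_lowers V_subset_F by blast
    then show ?case using F_mono[of "m - 1" "n - 1"] \<open>m \<le> n\<close> by auto
  qed
qed

lemma linear_x_pow_L0: "linear_op (x_pow_L0 x e)"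
  and component_x_pow_L0: "component (x_pow_L0 x e v) n = scale (x powi (e * n)) (component v n)"
proof -
  have fin: "finite {n. scale (x powi (e * n)) (component v n) \<noteq> 0}" for v
    using finite_component[of v] by (rule rev_finite_subset) auto
  have comp: "component (x_pow_L0 x e v) = (\<lambda>n. scale (x powi (e * n)) (component v n))" for v
    by (rule component_eqI[OF _ fin]) (auto simp: x_pow_L0_def intro: subspace_scale subspace_V component_in)
  then show "component (x_pow_L0 x e v) n = scale (x powi (e * n)) (component v n)" by simp
  have eqI: "v = w" if "component v = component w" for v w
    using that supp_sum_component by metis
  show "linear_op (x_pow_L0 x e)"
  proof unfold_locales
    show "x_pow_L0 x e (v + w) = x_pow_L0 x e v + x_pow_L0 x e w" for v w
      by (rule eqI) (auto simp: fun_eq_iff comp comp.add scale_right_distrib)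
    show "x_pow_L0 x e (scale c v) = scale c (x_pow_L0 x e v)" for c v
      by (rule eqI) (auto simp: fun_eq_iff comp comp.scale mult.commute)
  qed
qed

context
  fixes T :: "'v \<Rightarrow> 'v"
  assumes linT: "linear_op T"
    and lowers: "\<And>v n. v \<in> F n \<Longrightarrow> T v \<in> F (n - 1)"
begin

interpretation T: Vector_Spaces.linear scale scale T by (rule linT)

lemma power_lowers: "v \<in> F n \<Longrightarrow> (T ^^ m) v \<in> F (n - int m)"
proof (induction m)
  case (Suc m)
  then show ?case using lowers[of "(T ^^ m) v" "n - int m"] by (simp add: algebra_simps)
qed simp

text \<open>
Nothing has negative degree, so every power of \<open>T\<close> beyond the \<open>N\<close>-th kills \<open>F N\<close>.
\<close>

lemma exp_op_eq_sum:
  assumes "v \<in> F (int N)"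
  shows "exp_op T v = (\<Sum>m\<le>N. scale (1 / fact m) ((T ^^ m) v))"
  unfolding exp_op_def
proof (rule supp_sum_eq_sum)
  fix m assume "m \<notin> {..N}"
  then have "(T ^^ m) v = 0"
    using power_lowers[OF assms, of m] F_negative[of "int N - int m"] by auto
  then show "scale (1 / fact m) ((T ^^ m) v) = 0" by simp
qed simp

lemma linear_exp_op: "linear_op (exp_op T)"
proof unfold_locales
  have pow_add: "(T ^^ m) (v + w) = (T ^^ m) v + (T ^^ m) w" for m v w
    by (induction m) (auto simp: T.add)
  have pow_scale: "(T ^^ m) (scale c v) = scale c ((T ^^ m) v)" for m c v
    by (induction m) (auto simp: T.scale)
  show "exp_op T (v + w) = exp_op T v + exp_op T w" for v w
  proof -
    obtain M N where MN: "M \<ge> 0" "N \<ge> 0" "v \<in> F M" "w \<in> F N" using ex_F by meson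
    define Q where "Q = nat (max M N)"
    have vw: "v \<in> F (int Q)" "w \<in> F (int Q)"
      using MN F_mono[of M "int Q"] F_mono[of N "int Q"] by (auto simp: Q_def)
    have "v + w \<in> F (int Q)" by (rule subspace_add[OF subspace_F vw])
    with vw show ?thesis
      by (simp add: exp_op_eq_sum pow_add scale_right_distrib sum.distrib)
  qed
  show "exp_op T (scale c v) = scale c (exp_op T v)" for c v
  proof -
    obtain M where M: "M \<ge> 0" "v \<in> F M" using ex_F by meson
    define Q where "Q = nat M"
    have v: "v \<in> F (int Q)" using M by (auto simp: Q_def)
    have "scale c v \<in> F (int Q)" by (rule subspace_scale[OF subspace_F v])
    with v show ?thesis
      by (simp add: exp_op_eq_sum pow_scale scale_sum_right mult.commute)
  qed
qed

lemma exp_op_unipotent: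
  assumes v: "v \<in> F n"
  shows "exp_op T v - v \<in> F (n - 1)"
proof -
  define N where "N = nat (max n 0)"
  have "v \<in> F (int N)" using v F_mono[of n "int N"] by (auto simp: N_def)
  then have "exp_op T v = (\<Sum>m\<le>N. scale (1 / fact m) ((T ^^ m) v))" by (rule exp_op_eq_sum)
  also have "\<dots> = v + (\<Sum>m\<in>{1..N}. scale (1 / fact m) ((T ^^ m) v))"
  proof -
    have "{..N} = insert 0 {1..N}" by auto
    then show ?thesis by simp
  qed
  finally have "exp_op T v - v = (\<Sum>m\<in>{1..N}. scale (1 / fact m) ((T ^^ m) v))" by simp
  also have "\<dots> \<in> F (n - 1)"
  proof (intro subspace_sum[OF subspace_F] subspace_scale[OF subspace_F])
    fix m assume "m \<in> {1..N}"
    then show "(T ^^ m) v \<in> F (n - 1)"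
      using power_lowers[OF v, of m] F_mono[of "n - int m" "n - 1"] by auto
  qed
  finally show ?thesis .
qed

end

lemma
  shows linear_scaled_L1: "linear_op (\<lambda>w. scale c (L 1 w))"
    and scaled_L1_F: "v \<in> F n \<Longrightarrow> scale c (L 1 v) \<in> F (n - 1)"
proof -
  interpret L1: Vector_Spaces.linear scale scale "L 1" by (rule linear_L)
  show "linear_op (\<lambda>w. scale c (L 1 w))"
    by unfold_locales (auto simp: L1.add L1.scale scale_right_distrib mult.commute)
  show "v \<in> F n \<Longrightarrow> scale c (L 1 v) \<in> F (n - 1)"
    by (intro subspace_scale[OF subspace_F] L1_F)
qed

lemma linear_K: "linear_op (K \<gamma> \<tau>)"
proof -
  have "K \<gamma> \<tau> = exp_op (\<lambda>w. scale (- (of_real (\<gamma>$2$1) * autj \<gamma> \<tau>)) (L 1 w))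
      \<circ> x_pow_L0 (autj \<gamma> \<tau>) (- 2)" by (auto simp: K_def)
  then show ?thesis
    using Vector_Spaces.linear_compose[OF linear_x_pow_L0 linear_exp_op[OF linear_scaled_L1 scaled_L1_F]]
    by metis
qed

lemma K_F: "v \<in> F n \<Longrightarrow> K \<gamma> \<tau> v \<in> F n"
  and component_K: "v \<in> F n \<Longrightarrow> component (K \<gamma> \<tau> v) n = scale (autj \<gamma> \<tau> powi (- 2 * n)) (component v n)"
proof -
  assume v: "v \<in> F n"
  let ?w = "x_pow_L0 (autj \<gamma> \<tau>) (- 2) v"
  have w: "?w \<in> F n" using v by (auto simp: F_iff component_x_pow_L0)
  have d: "K \<gamma> \<tau> v - ?w \<in> F (n - 1)"
    unfolding K_def by (rule exp_op_unipotent[OF linear_scaled_L1 scaled_L1_F w])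
  then have "K \<gamma> \<tau> v - ?w + ?w \<in> F n" using w F_step by (intro subspace_add[OF subspace_F]) auto
  then show "K \<gamma> \<tau> v \<in> F n" by simp
  have "component (K \<gamma> \<tau> v - ?w) n = 0" using d F_step by auto
  then show "component (K \<gamma> \<tau> v) n = scale (autj \<gamma> \<tau> powi (- 2 * n)) (component v n)"
    by (simp add: comp.diff component_x_pow_L0)
qed

interpretation K: Vector_Spaces.linear scale scale "K \<gamma> \<tau>" for \<gamma> \<tau>
  by (rule linear_K)

text \<open>
The top component of \<open>v\<close> is multiplied by a nonzero scalar, so it cannot disappear from \<open>K \<gamma> \<tau> v\<close>.
\<close>

lemma K_reflects_F:
  assumes j: "autj \<gamma> \<tau> \<noteq> 0" and Kv: "K \<gamma> \<tau> v \<in> F n"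
  shows "v \<in> F n"
proof -
  have "v \<in> F (n + int m) \<Longrightarrow> v \<in> F n" for m
  proof (induction m)
    case (Suc m)
    have "component (K \<gamma> \<tau> v) (n + int (Suc m)) = 0" using Kv by (auto simp: F_iff)
    then have "component v (n + int (Suc m)) = 0"
      using component_K[OF Suc.prems, of \<gamma> \<tau>] j by simp
    then have "v \<in> F (n + int (Suc m) - 1)" using Suc.prems F_step by blast
    then show ?case using Suc.IH by (simp add: algebra_simps)
  qed simp
  moreover obtain N where "v \<in> F N" using ex_F by blast
  then have "v \<in> F (n + int (nat (N - n)))" using F_mono[of N "n + int (nat (N - n))"] by auto
  ultimately show ?thesis by blast
qed

text \<open>
An operator that is triangular for the filtration with nonzero scalars on the graded pieces is
invertible: a preimage is found by correcting the top component and descending.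
\<close>

lemma bij_K:
  assumes j: "autj \<gamma> \<tau> \<noteq> 0"
  shows "bij (K \<gamma> \<tau>)"
proof (rule bijI)
  show "inj (K \<gamma> \<tau>)"
  proof (rule injI)
    fix v w assume "K \<gamma> \<tau> v = K \<gamma> \<tau> w"
    then have "K \<gamma> \<tau> (v - w) \<in> F (-1)" using subspace_0[OF subspace_F] by (simp add: K.diff)
    then have "v - w \<in> F (-1)" by (rule K_reflects_F[OF j])
    then show "v = w" using F_negative by auto
  qed
  have "w \<in> F (int n - 1) \<Longrightarrow> w \<in> range (K \<gamma> \<tau>)" for n w
  proof (induction n arbitrary: w)
    case 0
    then have "w = K \<gamma> \<tau> 0" using F_negative[of "-1"] by (simp add: K.zero)
    then show ?case by blast
  next
    case (Suc n)
    let ?v = "scale (autj \<gamma> \<tau> powi (2 * int n)) (component w (int n))"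
    have w: "w \<in> F (int n)" using Suc.prems by simp
    have v: "?v \<in> F (int n)" by (intro subspace_scale[OF subspace_F]) (use component_in V_subset_F in blast)
    have "component (K \<gamma> \<tau> ?v) (int n) = component w (int n)"
      using component_K[OF v, of \<gamma> \<tau>] j component_homogeneous[OF component_in[of w "int n"]]
      by (simp add: comp.scale power_int_minus)
    then have "w - K \<gamma> \<tau> ?v \<in> F (int n - 1)"
      using w K_F[OF v] subspace_diff[OF subspace_F] by (auto simp: F_step comp.diff)
    then obtain u where "w - K \<gamma> \<tau> ?v = K \<gamma> \<tau> u" using Suc.IH by blast
    then have "w = K \<gamma> \<tau> (u + ?v)" by (simp add: K.add algebra_simps)
    then show ?case by blast
  qed
  then have "w \<in> range (K \<gamma> \<tau>)" for w
  proof -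
    obtain N where N: "0 \<le> N" "w \<in> F N" using ex_F by blast
    then have "w \<in> F (int (Suc (nat N)) - 1)" by simp
    then show ?thesis using \<open>\<And>w n. w \<in> F (int n - 1) \<Longrightarrow> w \<in> range (K \<gamma> \<tau>)\<close> by blast
  qed
  then show "surj (K \<gamma> \<tau>)" by auto
qed

end

section \<open>Forms with values in a vertex operator algebra\<close>

lemma vector_space_functions:
  assumes "vector_space (s :: complex \<Rightarrow> 'a::ab_group_add \<Rightarrow> 'a)"
  shows "vector_space (\<lambda>c (f :: complex \<Rightarrow> 'a) \<tau>. s c (f \<tau>))"
proof -
  interpret vector_space s by fact
  show ?thesis
    by unfold_locales (auto simp: fun_eq_iff plus_fun_def scale_right_distrib scale_left_distrib)
qed

context vertex_operator_algebra
begin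

interpretation K: Vector_Spaces.linear scale scale "K \<gamma> \<tau>" for \<gamma> \<tau>
  by (rule linear_K)

interpretation comp: Vector_Spaces.linear scale scale "\<lambda>v. component v n" for n
  by (rule linear_component)

lemma slashV_linear:
  assumes "autj \<gamma> \<tau> \<noteq> 0"
  shows "slashV k \<gamma> (\<lambda>\<tau>. scale c (f \<tau>) + g \<tau>) \<tau> = scale c (slashV k \<gamma> f \<tau>) + slashV k \<gamma> g \<tau>"
proof -
  note bij = bij_K[OF assms]
  have "inv_into UNIV (K \<gamma> \<tau>) (scale c v + w)
      = scale c (inv_into UNIV (K \<gamma> \<tau>) v) + inv_into UNIV (K \<gamma> \<tau>) w" for v w
    by (rule inv_f_eq[OF bij_is_inj[OF bij]]) (simp add: K.add K.scale bij_is_surj[OF bij] surj_f_inv_f)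
  then show ?thesis
    by (simp add: slashV_def scale_right_distrib mult.commute)
qed

text \<open>
On top components, inverting \<open>K\<close> is division by \<open>j\<^sup>-\<^sup>2\<^sup>n\<close>, which changes the weight from \<open>k\<close> to \<open>k - 2n\<close>.
\<close>

lemma component_slashV:
  assumes j: "autj \<gamma> \<tau> \<noteq> 0" and f: "f (moebius \<gamma> \<tau>) \<in> F n"
  shows "component (slashV k \<gamma> f \<tau>) n
    = scale (autj \<gamma> \<tau> powi (- (k - 2 * n))) (component (f (moebius \<gamma> \<tau>)) n)"
proof -
  define v where "v = inv_into UNIV (K \<gamma> \<tau>) (f (moebius \<gamma> \<tau>))"
  have Kv: "K \<gamma> \<tau> v = f (moebius \<gamma> \<tau>)"
    unfolding v_def using bij_is_surj[OF bij_K[OF j]] by (rule surj_f_inv_f)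
  have v: "v \<in> F n" using f Kv by (simp add: K_reflects_F[OF j])
  have "component (f (moebius \<gamma> \<tau>)) n = scale (autj \<gamma> \<tau> powi (- 2 * n)) (component v n)"
    using component_K[OF v, of \<gamma> \<tau>] Kv by simp
  moreover have "- (k - 2 * n) + - 2 * n = - k" by simp
  then have "autj \<gamma> \<tau> powi (- (k - 2 * n)) * autj \<gamma> \<tau> powi (- 2 * n) = autj \<gamma> \<tau> powi (- k)"
    using j by (metis power_int_add)
  ultimately show ?thesis
    unfolding slashV_def v_def[symmetric] by (simp add: comp.scale)
qed

text \<open>
The conditions that pass to the coordinates of the top component, for forms with values in a fixed
\<open>F n\<close>; the forms killed by all these coordinates are those of the next smaller degree.
\<close>

definition filtered_forms :: "int \<Rightarrow> (real^2^2) set set \<Rightarrow> int \<Rightarrow> (complex \<Rightarrow> 'v) set" where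
  "filtered_forms k \<Gamma> n = {f.
     (\<forall>\<tau>. \<tau> \<notin> UHP \<longrightarrow> f \<tau> = 0) \<and> (\<forall>\<tau>. f \<tau> \<in> F n) \<and>
     holomorphicV f UHP \<and>
     (\<forall>\<gamma>\<in>\<Union>\<Gamma>. \<forall>\<tau>\<in>UHP. slashV k \<gamma> f \<tau> = f \<tau>) \<and>
     (\<forall>\<sigma> l. cusp_width \<Gamma> \<sigma> l \<longrightarrow>
        (\<exists>a. \<forall>\<tau>\<in>UHP. sumsV (\<lambda>n. scale (qpar l \<tau> ^ n) (a n)) (slashV k \<sigma> f \<tau>)))}"

lemma modular_formsV_in_filtered_forms:
  assumes "f \<in> modular_formsV k \<Gamma>"
  shows "\<exists>N. f \<in> filtered_forms k \<Gamma> N"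
proof -
  from assms obtain N where N: "(\<forall>\<tau>\<in>UHP. f \<tau> \<in> F N) \<and>
        holomorphicV f UHP \<and>
        (\<forall>\<gamma>\<in>\<Union>\<Gamma>. \<forall>\<tau>\<in>UHP. slashV k \<gamma> f \<tau> = f \<tau>) \<and>
        (\<forall>\<sigma> l. cusp_width \<Gamma> \<sigma> l \<longrightarrow>
           (\<exists>a. (\<forall>n. a n \<in> F N) \<and>
              (\<forall>\<tau>\<in>UHP. sumsV (\<lambda>n. scale (qpar l \<tau> ^ n) (a n)) (slashV k \<sigma> f \<tau>))))"
     and 0: "\<forall>\<tau>. \<tau> \<notin> UHP \<longrightarrow> f \<tau> = 0"
    unfolding modular_formsV_def by blast
  have "f \<tau> \<in> F N" for \<tau> using N 0 subspace_0[OF subspace_F] by (cases "\<tau> \<in> UHP") auto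
  then have "f \<in> filtered_forms k \<Gamma> N" unfolding filtered_forms_def using N 0 by blast
  then show ?thesis ..
qed

lemma sumsV_linear:
  assumes "sumsV a v" "sumsV b w"
  shows "sumsV (\<lambda>n. scale c (a n) + b n) (scale c v + w)"
  unfolding sumsV_def
proof safe
  fix \<phi> assume \<phi>: "Vector_Spaces.linear scale (*) \<phi>"
  interpret \<phi>: Vector_Spaces.linear scale "(*)" \<phi> by fact
  have "(\<lambda>n. \<phi> (a n)) sums \<phi> v" "(\<lambda>n. \<phi> (b n)) sums \<phi> w"
    using assms \<phi> unfolding sumsV_def by blast+
  then show "(\<lambda>n. \<phi> (scale c (a n) + b n)) sums \<phi> (scale c v + w)"
    by (simp add: \<phi>.add \<phi>.scale sums_add sums_mult)
qed

context
  fixes \<Gamma> :: "(real^2^2) set set"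
  assumes det_1: "\<And>\<gamma>. \<gamma> \<in> \<Union>\<Gamma> \<Longrightarrow> det \<gamma> = 1"
begin

lemma subspace_filtered_forms: "module.subspace (\<lambda>c f \<tau>. scale c (f \<tau>)) (filtered_forms k \<Gamma> n)"
proof -
  interpret fn: vector_space "\<lambda>c (f::complex\<Rightarrow>'v) \<tau>. scale c (f \<tau>)"
    by (rule vector_space_functions) unfold_locales
  have j\<Gamma>: "autj \<gamma> \<tau> \<noteq> 0" if "\<gamma> \<in> \<Union>\<Gamma>" "\<tau> \<in> UHP" for \<gamma> \<tau>
    using autj_nonzero[OF det_1[OF that(1)]] that(2) by simp
  have j\<sigma>: "autj \<sigma> \<tau> \<noteq> 0" if "cusp_width \<Gamma> \<sigma> l" "\<tau> \<in> UHP" for \<sigma> l \<tau>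
    using that by (intro autj_nonzero) (auto simp: cusp_width_def SL2R_def)
  have comb: "(\<lambda>\<tau>. scale c (f \<tau>) + g \<tau>) \<in> filtered_forms k \<Gamma> n"
    if f: "f \<in> filtered_forms k \<Gamma> n" and g: "g \<in> filtered_forms k \<Gamma> n" for c f g
    unfolding filtered_forms_def
  proof (rule CollectI, intro conjI allI impI ballI)
    fix \<tau> :: complex
    show "scale c (f \<tau>) + g \<tau> = 0" if "\<tau> \<notin> UHP" using f g that by (simp add: filtered_forms_def)
    show "scale c (f \<tau>) + g \<tau> \<in> F n"
      using f g by (simp add: filtered_forms_def subspace_add[OF subspace_F] subspace_scale[OF subspace_F])
    show "holomorphicV (\<lambda>\<tau>. scale c (f \<tau>) + g \<tau>) UHP"
      unfolding holomorphicV_def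
    proof safe
      fix \<phi> assume \<phi>: "Vector_Spaces.linear scale (*) \<phi>"
      interpret \<phi>: Vector_Spaces.linear scale "(*)" \<phi> by fact
      have "(\<lambda>\<tau>. \<phi> (f \<tau>)) holomorphic_on UHP" "(\<lambda>\<tau>. \<phi> (g \<tau>)) holomorphic_on UHP"
        using f g \<phi> unfolding filtered_forms_def holomorphicV_def by blast+
      then show "(\<lambda>\<tau>. \<phi> (scale c (f \<tau>) + g \<tau>)) holomorphic_on UHP"
        by (simp add: \<phi>.add \<phi>.scale holomorphic_on_add holomorphic_on_mult)
    qed
    show "slashV k \<gamma> (\<lambda>\<tau>. scale c (f \<tau>) + g \<tau>) \<tau> = scale c (f \<tau>) + g \<tau>"
      if "\<gamma> \<in> \<Union>\<Gamma>" "\<tau> \<in> UHP" for \<gamma>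
    proof -
      have "slashV k \<gamma> f \<tau> = f \<tau>" "slashV k \<gamma> g \<tau> = g \<tau>" using f g that unfolding filtered_forms_def by blast+
      then show ?thesis using slashV_linear[OF j\<Gamma>[OF that]] by simp
    qed
    fix \<sigma> l assume cw: "cusp_width \<Gamma> \<sigma> l"
    obtain a where a: "\<forall>\<tau>\<in>UHP. sumsV (\<lambda>n. scale (qpar l \<tau> ^ n) (a n)) (slashV k \<sigma> f \<tau>)"
      using f cw unfolding filtered_forms_def by blast
    obtain b where b: "\<forall>\<tau>\<in>UHP. sumsV (\<lambda>n. scale (qpar l \<tau> ^ n) (b n)) (slashV k \<sigma> g \<tau>)"
      using g cw unfolding filtered_forms_def by blast
    show "\<exists>a. \<forall>\<tau>\<in>UHP. sumsV (\<lambda>n. scale (qpar l \<tau> ^ n) (a n)) (slashV k \<sigma> (\<lambda>\<tau>. scale c (f \<tau>) + g \<tau>) \<tau>)"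
    proof (intro exI[of _ "\<lambda>n. scale c (a n) + b n"] ballI)
      fix \<tau> assume \<tau>: "\<tau> \<in> UHP"
      show "sumsV (\<lambda>n. scale (qpar l \<tau> ^ n) (scale c (a n) + b n)) (slashV k \<sigma> (\<lambda>\<tau>. scale c (f \<tau>) + g \<tau>) \<tau>)"
        using sumsV_linear[OF bspec[OF a \<tau>] bspec[OF b \<tau>], of c] slashV_linear[OF j\<sigma>[OF cw \<tau>]]
        by (simp add: scale_right_distrib mult.commute)
    qed
  qed
  have "0 \<in> filtered_forms k \<Gamma> n"
    unfolding filtered_forms_def
  proof (rule CollectI, intro conjI allI impI ballI)
    fix \<tau> :: complex
    show "0 \<tau> = (0::'v)" by simp
    show "0 \<tau> \<in> F n" using subspace_0[OF subspace_F] by simp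
    show "holomorphicV 0 UHP" by (simp add: holomorphicV_def)
    have z: "slashV k \<gamma> 0 \<tau> = 0" if "autj \<gamma> \<tau> \<noteq> 0" for \<gamma> \<tau>
      using slashV_linear[OF that, of k 1 0 0] by (simp add: zero_fun_def)
    show "slashV k \<gamma> 0 \<tau> = 0 \<tau>" if "\<gamma> \<in> \<Union>\<Gamma>" "\<tau> \<in> UHP" for \<gamma>
      using z j\<Gamma>[OF that] by simp
    fix \<sigma> l assume cw: "cusp_width \<Gamma> \<sigma> l"
    show "\<exists>a. \<forall>\<tau>\<in>UHP. sumsV (\<lambda>n. scale (qpar l \<tau> ^ n) (a n)) (slashV k \<sigma> 0 \<tau>)"
    proof (intro exI[of _ "\<lambda>_. 0"] ballI)
      fix \<tau> assume \<tau>: "\<tau> \<in> UHP"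
      show "sumsV (\<lambda>n. scale (qpar l \<tau> ^ n) 0) (slashV k \<sigma> 0 \<tau>)"
        unfolding sumsV_def z[OF j\<sigma>[OF cw \<tau>]]
      proof safe
        fix \<phi> assume "Vector_Spaces.linear scale (*) \<phi>"
        then interpret \<phi>: Vector_Spaces.linear scale "(*)" \<phi> .
        show "(\<lambda>n. \<phi> (scale (qpar l \<tau> ^ n) 0)) sums \<phi> 0" by (simp add: \<phi>.zero)
      qed
    qed
  qed
  then show ?thesis
    using comb[where g = 0] comb[where c = 1]
    by (intro fn.subspaceI) (auto simp: plus_fun_def)
qed

lemma top_coordinate_modular:
  assumes f: "f \<in> filtered_forms k \<Gamma> n" and \<phi>: "Vector_Spaces.linear scale (*) \<phi>"
  shows "(\<lambda>\<tau>. \<phi> (component (f \<tau>) n)) \<in> modular_forms (k - 2 * n) \<Gamma>"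
proof -
  interpret \<phi>: Vector_Spaces.linear scale "(*)" \<phi> by fact
  let ?\<psi> = "\<lambda>v. \<phi> (component v n)"
  have \<psi>: "Vector_Spaces.linear scale (*) ?\<psi>"
    using Vector_Spaces.linear_compose[OF linear_component \<phi>] by (simp add: o_def)
  interpret \<psi>: Vector_Spaces.linear scale "(*)" ?\<psi> by fact
  have slash: "slash (k - 2 * n) \<gamma> (\<lambda>\<tau>. ?\<psi> (f \<tau>)) \<tau> = ?\<psi> (slashV k \<gamma> f \<tau>)"
    if "autj \<gamma> \<tau> \<noteq> 0" for \<gamma> \<tau>
  proof -
    have "f (moebius \<gamma> \<tau>) \<in> F n" using f by (auto simp: filtered_forms_def)
    from component_slashV[where f=f, OF that this, of k] show ?thesis
      by (simp add: slash_def \<phi>.scale)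
  qed
  show ?thesis
    unfolding modular_forms_def
  proof (rule CollectI, intro conjI allI impI ballI)
    show "?\<psi> (f \<tau>) = 0" if "\<tau> \<notin> UHP" for \<tau> using f that by (auto simp: filtered_forms_def \<psi>.zero)
    show "(\<lambda>\<tau>. ?\<psi> (f \<tau>)) holomorphic_on UHP"
      using f \<psi> unfolding filtered_forms_def holomorphicV_def by blast
    show "slash (k - 2 * n) \<gamma> (\<lambda>\<tau>. ?\<psi> (f \<tau>)) \<tau> = ?\<psi> (f \<tau>)" if "\<gamma> \<in> \<Union>\<Gamma>" "\<tau> \<in> UHP" for \<gamma> \<tau>
    proof -
      have "slashV k \<gamma> f \<tau> = f \<tau>" using f that unfolding filtered_forms_def by blast
      then show ?thesis using slash[OF autj_nonzero[OF det_1[OF that(1)]]] that(2) by simp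
    qed
    fix \<sigma> l assume cw: "cusp_width \<Gamma> \<sigma> l"
    then have d: "det \<sigma> = 1" by (auto simp: cusp_width_def SL2R_def)
    obtain a where a: "\<forall>\<tau>\<in>UHP. sumsV (\<lambda>n. scale (qpar l \<tau> ^ n) (a n)) (slashV k \<sigma> f \<tau>)"
      using f cw unfolding filtered_forms_def by blast
    show "\<exists>a. \<forall>\<tau>\<in>UHP. (\<lambda>m. a m * qpar l \<tau> ^ m) sums slash (k - 2 * n) \<sigma> (\<lambda>\<tau>. ?\<psi> (f \<tau>)) \<tau>"
    proof (intro exI[of _ "\<lambda>m. ?\<psi> (a m)"] ballI)
      fix \<tau> assume \<tau>: "\<tau> \<in> UHP"
      then have j: "autj \<sigma> \<tau> \<noteq> 0" using autj_nonzero[OF d] by simp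
      have "(\<lambda>m. ?\<psi> (scale (qpar l \<tau> ^ m) (a m))) sums ?\<psi> (slashV k \<sigma> f \<tau>)"
        using bspec[OF a \<tau>] \<psi> unfolding sumsV_def by blast
      then show "(\<lambda>m. ?\<psi> (a m) * qpar l \<tau> ^ m) sums slash (k - 2 * n) \<sigma> (\<lambda>\<tau>. ?\<psi> (f \<tau>)) \<tau>"
        unfolding slash[OF j] by (simp add: \<psi>.scale mult.commute)
    qed
  qed
qed

lemma filtered_forms_step:
  "filtered_forms k \<Gamma> (n - 1) = {f \<in> filtered_forms k \<Gamma> n. \<forall>\<tau>. component (f \<tau>) n = 0}"
  unfolding filtered_forms_def by (auto simp: F_step)

lemma coordinates_on_V:
  "\<exists>B. finite B \<and> edim scale (V n) = enat (card B) \<and>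
    (\<forall>b\<in>B. Vector_Spaces.linear scale (*) (\<lambda>v. representation B (component v n) b)) \<and>
    (\<forall>v. (\<forall>b\<in>B. representation B (component v n) b = 0) \<longleftrightarrow> component v n = 0)"
proof -
  obtain B0 where B0: "finite B0" "V n \<subseteq> span B0" using finite_dim_V by blast
  then obtain d where d: "edim scale (V n) = enat d" unfolding edim_def by (cases "\<exists>B. finite B \<and> V n \<subseteq> span B") auto
  obtain B where B: "B \<subseteq> V n" "finite B" "independent B" "V n \<subseteq> span B" "card B = d"
    by (rule edim_finite_obtains_basis[OF vector_space_axioms d])
  have in_span: "component v n \<in> span B" for v using component_in B by blast
  show ?thesis
  proof (intro exI[of _ B] conjI ballI allI)
    show "Vector_Spaces.linear scale (*) (\<lambda>v. representation B (component v n) b)" for b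
    proof -
      interpret prod: vector_space "(*) :: complex \<Rightarrow> complex \<Rightarrow> complex"
        by unfold_locales (auto simp: algebra_simps)
      show ?thesis
        by unfold_locales
          (auto simp: comp.add comp.scale representation_add[OF B(3)] representation_scale[OF B(3)] in_span)
    qed
    show "(\<forall>b\<in>B. representation B (component v n) b = 0) \<longleftrightarrow> component v n = 0" for v
      using sum_representation_eq[OF B(3) in_span B(2) order_refl, of v]
      by (auto simp: representation_zero)
  qed (use B d in auto)
qed

text \<open>
Rank-nullity for the coordinates of the degree \<open>n\<close> component, one for each basis vector of \<open>V n\<close>.
\<close>

lemma edim_filtered_forms_step:
  "edim (\<lambda>c f \<tau>. scale c (f \<tau>)) (filtered_forms k \<Gamma> n)
   \<le> edim (\<lambda>c f \<tau>. scale c (f \<tau>)) (filtered_forms k \<Gamma> (n - 1))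
     + edim (\<lambda>c f \<tau>. c * f \<tau>) (modular_forms (k - 2 * n) \<Gamma>) * edim scale (V n)"
proof -
  obtain B where B: "finite B" "edim scale (V n) = enat (card B)"
    and lin: "\<And>b. b \<in> B \<Longrightarrow> Vector_Spaces.linear scale (*) (\<lambda>v. representation B (component v n) b)"
    and ker: "\<And>v. (\<forall>b\<in>B. representation B (component v n) b = 0) \<longleftrightarrow> component v n = 0"
    using coordinates_on_V[of n] by blast
  interpret fn: vector_space "\<lambda>c (f::complex\<Rightarrow>'v) \<tau>. scale c (f \<tau>)"
    by (rule vector_space_functions) unfold_locales
  have cvs: "vector_space ((*) :: complex \<Rightarrow> complex \<Rightarrow> complex)"
    by unfold_locales (auto simp: algebra_simps)
  interpret cfn: vector_space "\<lambda>c (f::complex\<Rightarrow>complex) \<tau>. c * f \<tau>"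
    by (rule vector_space_functions[OF cvs])
  let ?h = "\<lambda>b (f::complex\<Rightarrow>'v) \<tau>. representation B (component (f \<tau>) n) b"
  have linh: "Vector_Spaces.linear (\<lambda>c f \<tau>. scale c (f \<tau>)) (\<lambda>c f \<tau>. c * f \<tau>) (?h b)" if b: "b \<in> B" for b
  proof -
    interpret b: Vector_Spaces.linear scale "(*)" "\<lambda>v. representation B (component v n) b" by (rule lin[OF b])
    show ?thesis by unfold_locales (auto simp: fun_eq_iff b.add b.scale)
  qed
  have im: "?h b f \<in> modular_forms (k - 2 * n) \<Gamma>" if "b \<in> B" "f \<in> filtered_forms k \<Gamma> n" for b f
  proof -
    have "component (component v n) n = component v n" for v
      using component_homogeneous[OF component_in[of v n]] by simp
    then show ?thesis using top_coordinate_modular[OF that(2) lin[OF that(1)]] by simp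
  qed
  have "{f \<in> filtered_forms k \<Gamma> n. \<forall>b\<in>B. ?h b f = 0} = filtered_forms k \<Gamma> (n - 1)"
    unfolding filtered_forms_step using ker by (auto simp: fun_eq_iff)
  then show ?thesis
    using edim_joint_kernel[where h = ?h and S = "filtered_forms k \<Gamma> n",
        OF B(1) linh fn.vector_space_axioms cfn.vector_space_axioms subspace_filtered_forms im]
    by (simp add: B(2))
qed

lemma edim_filtered_forms_le:
  "edim (\<lambda>c f \<tau>. scale c (f \<tau>)) (filtered_forms k \<Gamma> (int m - 1))
   \<le> (\<Sum>n\<in>{0..<int m}. edim (\<lambda>c f \<tau>. c * f \<tau>) (modular_forms (k - 2 * n) \<Gamma>) * edim scale (V n))"
proof (induction m)
  case 0
  interpret fn: vector_space "\<lambda>c (f::complex\<Rightarrow>'v) \<tau>. scale c (f \<tau>)"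
    by (rule vector_space_functions) unfold_locales
  have "filtered_forms k \<Gamma> (-1) \<subseteq> {0}"
    using F_negative[of "-1"] by (auto simp: filtered_forms_def fun_eq_iff)
  then have "filtered_forms k \<Gamma> (-1) \<subseteq> module.span (\<lambda>c f \<tau>. scale c (f \<tau>)) {}"
    by simp
  then show ?case
    using edim_le_card[OF fn.vector_space_axioms, of "{}"] by (simp add: zero_enat_def[symmetric])
next
  case (Suc m)
  have "{0..<int (Suc m)} = insert (int m) {0..<int m}" by auto
  then show ?case
    using order_trans[OF edim_filtered_forms_step[of k "int m"] add_right_mono[OF Suc.IH]]
    by (simp add: add.commute)
qed

text \<open>
For \<open>n > k/2\<close> the coordinates of the degree \<open>n\<close> component have negative weight and vanish, so every
form takes values in \<open>F (k/2)\<close>, and \<open>edim_filtered_forms_le\<close> applies.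
\<close>

lemma edim_modular_formsV_le:
  assumes even: "even k" and k: "k \<ge> 0"
    and neg: "\<And>k f. k < 0 \<Longrightarrow> f \<in> modular_forms k \<Gamma> \<Longrightarrow> f = 0"
  shows "edim (\<lambda>c f \<tau>. scale c (f \<tau>)) (modular_formsV k \<Gamma>)
    \<le> (\<Sum>i\<in>{0..k div 2}. edim (\<lambda>c f \<tau>. c * f \<tau>) (modular_forms (2 * i) \<Gamma>)
                            * edim scale (V (k div 2 - i)))"
proof -
  have vs: "vector_space (\<lambda>c (f::complex\<Rightarrow>'v) \<tau>. scale c (f \<tau>))"
    by (rule vector_space_functions) unfold_locales
  have drop: "f \<in> filtered_forms k \<Gamma> (n - 1)" if f: "f \<in> filtered_forms k \<Gamma> n" and n: "k div 2 < n" for f n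
  proof -
    obtain B where B: "finite B"
      and lin: "\<And>b. b \<in> B \<Longrightarrow> Vector_Spaces.linear scale (*) (\<lambda>v. representation B (component v n) b)"
      and ker: "\<And>v. (\<forall>b\<in>B. representation B (component v n) b = 0) \<longleftrightarrow> component v n = 0"
      using coordinates_on_V[of n] by blast
    have "k - 2 * n < 0" using n by linarith
    then have "(\<lambda>\<tau>. representation B (component (component (f \<tau>) n) n) b) = 0" if "b \<in> B" for b
      using neg top_coordinate_modular[OF f lin[OF that]] by blast
    then have "\<forall>b\<in>B. representation B (component (component (f \<tau>) n) n) b = 0" for \<tau>
      by (metis zero_fun_apply)
    then have "component (component (f \<tau>) n) n = 0" for \<tau> using ker by blast
    then have "component (f \<tau>) n = 0" for \<tau>
      using fun_cong[OF component_homogeneous[OF component_in[of "f \<tau>" n]], of n] by simp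
    then show ?thesis using f by (simp add: filtered_forms_step)
  qed
  have "f \<in> filtered_forms k \<Gamma> (k div 2 + int m) \<Longrightarrow> f \<in> filtered_forms k \<Gamma> (k div 2)" for f m
  proof (induction m)
    case (Suc m)
    then show ?case using drop[of f "k div 2 + int (Suc m)"] by (simp add: algebra_simps)
  qed simp
  moreover have "filtered_forms k \<Gamma> M \<subseteq> filtered_forms k \<Gamma> N" if "M \<le> N" for M N
    using F_mono[OF that] by (auto simp: filtered_forms_def)
  ultimately have in_half: "f \<in> filtered_forms k \<Gamma> (k div 2)" if "f \<in> filtered_forms k \<Gamma> N" for f N
    using that by (metis linorder_linear subsetD zle_iff_zadd)
  have "modular_formsV k \<Gamma> \<subseteq> filtered_forms k \<Gamma> (k div 2)"
  proof
    fix f assume "f \<in> modular_formsV k \<Gamma>"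
    then obtain N where "f \<in> filtered_forms k \<Gamma> N" using modular_formsV_in_filtered_forms by blast
    then show "f \<in> filtered_forms k \<Gamma> (k div 2)" by (rule in_half)
  qed
  then have "edim (\<lambda>c f \<tau>. scale c (f \<tau>)) (modular_formsV k \<Gamma>)
      \<le> edim (\<lambda>c f \<tau>. scale c (f \<tau>)) (filtered_forms k \<Gamma> (k div 2))"
    by (rule edim_mono[OF vs])
  also have "\<dots> \<le> (\<Sum>n\<in>{0..<k div 2 + 1}. edim (\<lambda>c f \<tau>. c * f \<tau>) (modular_forms (k - 2 * n) \<Gamma>) * edim scale (V n))"
    using edim_filtered_forms_le[of k "nat (k div 2 + 1)"] k by simp
  also have "\<dots> = (\<Sum>i\<in>{0..k div 2}. edim (\<lambda>c f \<tau>. c * f \<tau>) (modular_forms (2 * i) \<Gamma>)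
                            * edim scale (V (k div 2 - i)))"
    using even by (intro sum.reindex_bij_witness[of _ "\<lambda>i. k div 2 - i" "\<lambda>n. k div 2 - n"])
      (auto simp: algebra_simps)
  finally show ?thesis .
qed

end

end

section \<open>The dimension bound\<close>

theorem theorem8p1:
  fixes scale :: "complex \<Rightarrow> 'v::ab_group_add \<Rightarrow> 'v"
    and V :: "int \<Rightarrow> 'v set"
    and Y :: "'v \<Rightarrow> int \<Rightarrow> 'v \<Rightarrow> 'v"
    and vac \<omega> :: 'v
    and central_charge :: complex
    and \<Gamma> :: "(real^2^2) set set"
    and k :: int
  assumes "fuchsian_first_kind \<Gamma>"
    and "vertex_operator_algebra scale V Y vac \<omega> central_charge"
    and "even k" and "k \<ge> 0"
  shows "edim (\<lambda>c f \<tau>. scale c (f \<tau>)) (vertex_operator_algebra.modular_formsV scale V Y \<omega> k \<Gamma>)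
    \<le> (\<Sum>i\<in>{0..k div 2}. edim (\<lambda>c f \<tau>. c * f \<tau>) (modular_forms (2 * i) \<Gamma>)
                            * edim scale (V (k div 2 - i)))"
proof -
  interpret vertex_operator_algebra scale V Y vac \<omega> central_charge by (rule assms(2))
  obtain D where "cofinite_matrix_group (\<Union>\<Gamma>) D"
    using cofinite_matrix_group_preimage[OF assms(1)] by blast
  then interpret cofinite_matrix_group "\<Union>\<Gamma>" D .
  show ?thesis
    by (rule edim_modular_formsV_le[OF det_G assms(3,4) no_modular_forms_of_negative_weight[OF assms(1)]])
qed

end
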